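(* Let $p_t$ be the marginal densities of a (perfect) diffusion model with forward SDE $\mathrm{d}X_t=f_t(X_t)\mathrm{d}t+\sigma_t\overrightarrow{\mathrm{d}W_t}$. Let $\beta>0$, $c\in[0,1/2]$, $\eta=\beta+(1-\beta)c$, $\zeta=\sqrt{1+(1-\beta)2c/\beta}$. In the annealing weight $w_{[\tau,\tau']}=[R^\nu_\mu(X_{[\tau,\tau']})]^\beta[R^a_b(X_{[\tau,\tau']})]^{-1}$ (for targets $q_t\propto p_t^\beta$) choose $$a_t=f_t-\eta\sigma_t^2\nabla\log p_t,\qquad b_t=f_t-(\eta\sigma_t^2-\beta\epsilon_t^2)\nabla\log p_t,\qquad \epsilon_t=\zeta\sigma_t.$$ Then this is equivalent to the annealed Feynman–Kac corrector: the sampling process is the backward SDE $$\mathrm{d}X_t=\big(f_t(X_t)-\eta\sigma_t^2\nabla\log p_t(X_t)\big)\mathrm{d}t+\zeta\sigma_t\overleftarrow{\mathrm{d}W_t},$$ and along it the weight $w_t:=w_{[t,\tau']}(X_{[t,\tau']})$ satisfies the backward ODE $$\mathrm{d}\log w_t=-(\beta-1)\Big(\nabla\cdot f_t(X_t)+\frac{\sigma_t^2}{2}\beta\|\nabla\log p_t(X_t)\|^2\Big)\mathrm{d}t.$$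
   Context: Notation. $\overrightarrow{\mathrm{d}\cdot}$: forward It\^o SDE/integral (left-endpoint evaluation). $\overleftarrow{\mathrm{d}\cdot}$: backward SDE/integral, run from the later time $\tau'$ downwards (right-endpoint evaluation). The ODE for $\log w_t$ is in the variable $t$, solved backwards from $\log w_{\tau'}=0$, i.e. $\log w_\tau=-\int_\tau^{\tau'}(\cdots)\mathrm{d}t$ with $(\cdots)$ the right-hand side coefficient. Time-reversal pair with marginals $p_t$ and diffusion coefficient $\epsilon_t$: $\mu_t=f_t+\frac{\epsilon_t^2-\sigma_t^2}{2}\nabla\log p_t$ (forward drift), $\nu_t=f_t-\frac{\epsilon_t^2+\sigma_t^2}{2}\nabla\log p_t$ (backward drift). For a forward drift $\mu$ and backward drift $\nu$ with diffusion coefficient $\epsilon_t$: $$R^\nu_\mu(X_{[\tau,\tau']})=\exp\Big(\int_\tau^{\tau'}\tfrac1{\epsilon_t^2}\nu_t\cdot\overleftarrow{\mathrm{d}X_t}-\int_\tau^{\tau'}\tfrac1{\epsilon_t^2}\mu_t\cdot\overrightarrow{\mathrm{d}X_t}+\tfrac12\int_\tau^{\tau'}\tfrac1{\epsilon_t^2}(\|\mu_t\|^2-\|\nu_t\|^2)\mathrm{d}t\Big),$$ drifts evaluated along $X_t$; $R^a_b$ is the same with backward drift $a$ and forward drift $b$. The weight $w_{[\tau,\tau']}$ equals, up to a path-independent constant, $\mathrm{d}\overrightarrow{\mathbb Q}^b/\mathrm{d}\overleftarrow{\mathbb Q}^a$, where $\overleftarrow{\mathbb Q}^a$ is the law of the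 backward SDE with drift $a$ started from $q_{\tau'}$ and $\overrightarrow{\mathbb Q}^b$ the law of the forward SDE with drift $b$ started from $q_\tau$. $f_t$, $\log p_t$ and $\sigma_t>0$ are assumed sufficiently smooth. *)

theory Defs
  imports "HOL-Probability.Probability"
begin

section \<open>Vector calculus\<close>

definition gradient :: "('a::euclidean_space \<Rightarrow> real) \<Rightarrow> 'a \<Rightarrow> 'a" where
  "gradient g x = (THE D. GDERIV g x :> D)"

definition divergence :: "('a::euclidean_space \<Rightarrow> 'a) \<Rightarrow> 'a \<Rightarrow> real" where
  "divergence g x = (\<Sum>b\<in>Basis. frechet_derivative g (at x) b \<bullet> b)"

text \<open>Derivatives are taken within \<open>S\<close>, so that closed time intervals are allowed
  (one-sided time derivatives at the end points).\<close>

definition C1_on :: "'a::euclidean_space set \<Rightarrow> ('a \<Rightarrow> 'b::euclidean_space) \<Rightarrow> bool" where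
  "C1_on S g \<longleftrightarrow>
    (\<exists>g' :: 'a \<Rightarrow> 'a \<Rightarrow>\<^sub>L 'b.
       (\<forall>z\<in>S. (g has_derivative blinfun_apply (g' z)) (at z within S)) \<and> continuous_on S g')"

definition score :: "(real \<Rightarrow> 'a::euclidean_space \<Rightarrow> real) \<Rightarrow> real \<Rightarrow> 'a \<Rightarrow> 'a" where
  "score p t x = gradient (\<lambda>y. ln (p t y)) x"


section \<open>Forward and backward stochastic integrals\<close>

definition fine_grid :: "real \<Rightarrow> real \<Rightarrow> real \<Rightarrow> nat \<Rightarrow> (nat \<Rightarrow> real) \<Rightarrow> bool" where
  "fine_grid s t \<delta> n u \<longleftrightarrow>
     u 0 = s \<and> u n = t \<and> (\<forall>i<n. u i \<le> u (Suc i) \<and> u (Suc i) - u i < \<delta>)"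

text \<open>The stochastic integrals are the limits in probability, as the mesh of the partition tends
  to zero, of the left-endpoint (forward) and right-endpoint (backward) Riemann sums. For
  continuous integrands adapted to the (forward resp. backward) filtration of a semimartingale
  these are the Ito integrals. Both kinds of sums use the increments \<open>Z (u (Suc i)) - Z (u i)\<close>, so
  both integrals run from the earlier time \<open>s\<close> to the later time \<open>t\<close>. The pairing \<open>pr\<close> of
  integrand and increment is the inner product or scalar multiplication. Measurability is demanded
  because \<open>measure\<close> is \<open>0\<close> on nonmeasurable sets.\<close>

definition has_fwd_integral ::
  "'w measure \<Rightarrow> ('b::euclidean_space \<Rightarrow> 'a::euclidean_space \<Rightarrow> 'c::euclidean_space) \<Rightarrow>
   (real \<Rightarrow> 'w \<Rightarrow> 'b) \<Rightarrow> (real \<Rightarrow> 'w \<Rightarrow> 'a) \<Rightarrow> real \<Rightarrow> real \<Rightarrow> ('w \<Rightarrow> 'c) \<Rightarrow> bool" where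
  "has_fwd_integral M pr H Z s t I \<longleftrightarrow>
     (\<forall>r\<in>{s..t}. H r \<in> borel_measurable M \<and> Z r \<in> borel_measurable M) \<and>
     I \<in> borel_measurable M \<and>
     (\<forall>e>0. \<exists>\<delta>>0. \<forall>n u. fine_grid s t \<delta> n u \<longrightarrow>
        measure M {\<omega> \<in> space M.
          e < norm ((\<Sum>i<n. pr (H (u i) \<omega>) (Z (u (Suc i)) \<omega> - Z (u i) \<omega>)) - I \<omega>)} < e)"

definition has_bwd_integral ::
  "'w measure \<Rightarrow> ('b::euclidean_space \<Rightarrow> 'a::euclidean_space \<Rightarrow> 'c::euclidean_space) \<Rightarrow>
   (real \<Rightarrow> 'w \<Rightarrow> 'b) \<Rightarrow> (real \<Rightarrow> 'w \<Rightarrow> 'a) \<Rightarrow> real \<Rightarrow> real \<Rightarrow> ('w \<Rightarrow> 'c) \<Rightarrow> bool" where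
  "has_bwd_integral M pr H Z s t I \<longleftrightarrow>
     (\<forall>r\<in>{s..t}. H r \<in> borel_measurable M \<and> Z r \<in> borel_measurable M) \<and>
     I \<in> borel_measurable M \<and>
     (\<forall>e>0. \<exists>\<delta>>0. \<forall>n u. fine_grid s t \<delta> n u \<longrightarrow>
        measure M {\<omega> \<in> space M.
          e < norm ((\<Sum>i<n. pr (H (u (Suc i)) \<omega>) (Z (u (Suc i)) \<omega> - Z (u i) \<omega>)) - I \<omega>)} < e)"

text \<open>A version of the integral; it is determined only almost surely, and it is meaningful only
  when some random variable satisfies the corresponding predicate.\<close>

definition fwd_integral ::
  "'w measure \<Rightarrow> (real \<Rightarrow> 'w \<Rightarrow> 'a::euclidean_space) \<Rightarrow> (real \<Rightarrow> 'w \<Rightarrow> 'a) \<Rightarrow>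
   real \<Rightarrow> real \<Rightarrow> 'w \<Rightarrow> real" where
  "fwd_integral M H Z s t = (SOME I. has_fwd_integral M (\<bullet>) H Z s t I)"

definition bwd_integral ::
  "'w measure \<Rightarrow> (real \<Rightarrow> 'w \<Rightarrow> 'a::euclidean_space) \<Rightarrow> (real \<Rightarrow> 'w \<Rightarrow> 'a) \<Rightarrow>
   real \<Rightarrow> real \<Rightarrow> 'w \<Rightarrow> real" where
  "bwd_integral M H Z s t = (SOME I. has_bwd_integral M (\<bullet>) H Z s t I)"


section \<open>Brownian motion and stochastic differential equations\<close>

text \<open>Standard Brownian motion on \<open>{s..t}\<close>, started at time \<open>s\<close> in the origin, with respect to the
  filtration \<open>F\<close>. The increment density is that of a centred normal vector with covariance
  \<open>(v - r)\<close> times the identity. \<open>F\<close> is indexed by all reals, but only its part on \<open>{s..t}\<close>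
  matters.\<close>

definition brownian_motion ::
  "'w measure \<Rightarrow> (real \<Rightarrow> 'w measure) \<Rightarrow> (real \<Rightarrow> 'w \<Rightarrow> 'a::euclidean_space) \<Rightarrow>
   real \<Rightarrow> real \<Rightarrow> bool" where
  "brownian_motion M F W s t \<longleftrightarrow>
     prob_space M \<and> filtration (space M) F \<and>
     (\<forall>r\<in>{s..t}. subalgebra M (F r) \<and> W r \<in> borel_measurable (F r)) \<and>
     (AE \<omega> in M. W s \<omega> = 0 \<and> continuous_on {s..t} (\<lambda>r. W r \<omega>)) \<and>
     (\<forall>r v. s \<le> r \<and> r < v \<and> v \<le> t \<longrightarrow>
        distributed M lborel (\<lambda>\<omega>. W v \<omega> - W r \<omega>)
          (\<lambda>x. ennreal (\<Prod>b\<in>Basis. normal_density 0 (sqrt (v - r)) (x \<bullet> b))) \<and>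
        prob_space.indep_set M (sets (F r))
          {(\<lambda>\<omega>. W v \<omega> - W r \<omega>) -` A \<inter> space M | A. A \<in> sets borel})"

text \<open>\<open>Y\<close> solves \<open>dY = b(Y) dr + d dB\<close> forwards from time \<open>s\<close>.\<close>

definition forward_sde ::
  "'w measure \<Rightarrow> (real \<Rightarrow> 'w measure) \<Rightarrow> (real \<Rightarrow> 'w \<Rightarrow> 'a::euclidean_space) \<Rightarrow>
   (real \<Rightarrow> 'a \<Rightarrow> 'a) \<Rightarrow> (real \<Rightarrow> real) \<Rightarrow> real \<Rightarrow> real \<Rightarrow> (real \<Rightarrow> 'w \<Rightarrow> 'a) \<Rightarrow> bool" where
  "forward_sde M F B b d s t Y \<longleftrightarrow>
     brownian_motion M F B s t \<and>
     (\<forall>r\<in>{s..t}. Y r \<in> borel_measurable (F r)) \<and>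
     (AE \<omega> in M. continuous_on {s..t} (\<lambda>r. Y r \<omega>) \<and>
        (\<lambda>r. b r (Y r \<omega>)) absolutely_integrable_on {s..t}) \<and>
     (\<forall>r\<in>{s..t}. \<exists>J. has_fwd_integral M (*\<^sub>R) (\<lambda>v \<omega>. d v) B s r J \<and>
        (AE \<omega> in M. Y r \<omega> - Y s \<omega> = integral {s..r} (\<lambda>v. b v (Y v \<omega>)) + J \<omega>))"

text \<open>\<open>X\<close> solves \<open>dX = b(X) dr + d dW\<close> backwards from the later time \<open>t\<close>: the filtration \<open>G\<close> is
  decreasing, and \<open>W\<close> is a Brownian motion, started at time \<open>t\<close>, when time is reversed.\<close>

definition backward_sde ::
  "'w measure \<Rightarrow> (real \<Rightarrow> 'w measure) \<Rightarrow> (real \<Rightarrow> 'w \<Rightarrow> 'a::euclidean_space) \<Rightarrow>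
   (real \<Rightarrow> 'a \<Rightarrow> 'a) \<Rightarrow> (real \<Rightarrow> real) \<Rightarrow> real \<Rightarrow> real \<Rightarrow> (real \<Rightarrow> 'w \<Rightarrow> 'a) \<Rightarrow> bool" where
  "backward_sde M G W b d s t X \<longleftrightarrow>
     brownian_motion M (\<lambda>r. G (s + t - r)) (\<lambda>r. W (s + t - r)) s t \<and>
     (\<forall>r\<in>{s..t}. X r \<in> borel_measurable (G r)) \<and>
     (AE \<omega> in M. continuous_on {s..t} (\<lambda>r. X r \<omega>) \<and>
        (\<lambda>r. b r (X r \<omega>)) absolutely_integrable_on {s..t}) \<and>
     (\<forall>r\<in>{s..t}. \<exists>J. has_bwd_integral M (*\<^sub>R) (\<lambda>v \<omega>. d v) W r t J \<and>
        (AE \<omega> in M. X t \<omega> - X r \<omega> = integral {r..t} (\<lambda>v. b v (X v \<omega>)) + J \<omega>))"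


section \<open>Time reversal pairs and path weights\<close>

definition reversal_fwd_drift ::
  "(real \<Rightarrow> 'a::euclidean_space \<Rightarrow> 'a) \<Rightarrow> (real \<Rightarrow> real) \<Rightarrow> (real \<Rightarrow> real) \<Rightarrow>
   (real \<Rightarrow> 'a \<Rightarrow> real) \<Rightarrow> real \<Rightarrow> 'a \<Rightarrow> 'a" where
  "reversal_fwd_drift f \<sigma> \<epsilon> p t x = f t x + (((\<epsilon> t)\<^sup>2 - (\<sigma> t)\<^sup>2) / 2) *\<^sub>R score p t x"

definition reversal_bwd_drift ::
  "(real \<Rightarrow> 'a::euclidean_space \<Rightarrow> 'a) \<Rightarrow> (real \<Rightarrow> real) \<Rightarrow> (real \<Rightarrow> real) \<Rightarrow>
   (real \<Rightarrow> 'a \<Rightarrow> real) \<Rightarrow> real \<Rightarrow> 'a \<Rightarrow> 'a" where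
  "reversal_bwd_drift f \<sigma> \<epsilon> p t x = f t x - (((\<epsilon> t)\<^sup>2 + (\<sigma> t)\<^sup>2) / 2) *\<^sub>R score p t x"

definition scaled_along ::
  "(real \<Rightarrow> real) \<Rightarrow> (real \<Rightarrow> 'w \<Rightarrow> 'a::euclidean_space) \<Rightarrow> (real \<Rightarrow> 'a \<Rightarrow> 'a) \<Rightarrow>
   real \<Rightarrow> 'w \<Rightarrow> 'a" where
  "scaled_along \<epsilon> X v t \<omega> = (1 / (\<epsilon> t)\<^sup>2) *\<^sub>R v t (X t \<omega>)"

text \<open>\<open>path_ratio M \<epsilon> \<nu> \<mu> X s t\<close> has the backward drift \<open>\<nu>\<close> as first and the forward drift \<open>\<mu>\<close> as
  second drift argument. The law of \<open>X\<close> under \<open>M\<close> determines the integrals almost surely.\<close>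

definition path_ratio ::
  "'w measure \<Rightarrow> (real \<Rightarrow> real) \<Rightarrow> (real \<Rightarrow> 'a::euclidean_space \<Rightarrow> 'a) \<Rightarrow> (real \<Rightarrow> 'a \<Rightarrow> 'a) \<Rightarrow>
   (real \<Rightarrow> 'w \<Rightarrow> 'a) \<Rightarrow> real \<Rightarrow> real \<Rightarrow> 'w \<Rightarrow> real" where
  "path_ratio M \<epsilon> \<nu> \<mu> X s t \<omega> =
     exp (bwd_integral M (scaled_along \<epsilon> X \<nu>) X s t \<omega>
        - fwd_integral M (scaled_along \<epsilon> X \<mu>) X s t \<omega>
        + 1/2 * integral {s..t}
            (\<lambda>r. 1 / (\<epsilon> r)\<^sup>2 * ((norm (\<mu> r (X r \<omega>)))\<^sup>2 - (norm (\<nu> r (X r \<omega>)))\<^sup>2)))"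

definition annealing_weight ::
  "'w measure \<Rightarrow> real \<Rightarrow> (real \<Rightarrow> real) \<Rightarrow> (real \<Rightarrow> 'a::euclidean_space \<Rightarrow> 'a) \<Rightarrow>
   (real \<Rightarrow> 'a \<Rightarrow> 'a) \<Rightarrow> (real \<Rightarrow> 'a \<Rightarrow> 'a) \<Rightarrow> (real \<Rightarrow> 'a \<Rightarrow> 'a) \<Rightarrow>
   (real \<Rightarrow> 'w \<Rightarrow> 'a) \<Rightarrow> real \<Rightarrow> real \<Rightarrow> 'w \<Rightarrow> real" where
  "annealing_weight M \<beta> \<epsilon> \<nu> \<mu> a b X s t \<omega> =
     path_ratio M \<epsilon> \<nu> \<mu> X s t \<omega> powr \<beta> * inverse (path_ratio M \<epsilon> a b X s t \<omega>)"

text \<open>The density proportional to \<open>p t x powr \<beta>\<close>.\<close>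

definition annealed_density ::
  "(real \<Rightarrow> 'a::euclidean_space \<Rightarrow> real) \<Rightarrow> real \<Rightarrow> real \<Rightarrow> 'a \<Rightarrow> real" where
  "annealed_density p \<beta> t x = p t x powr \<beta> / (\<integral>y. p t y powr \<beta> \<partial>lborel)"

text \<open>Each \<open>V r\<close> is a random variable defined up to null sets; \<open>w\<close> is a process with almost surely
  continuous paths whose value at each time is a version of it. Such a process is unique up to
  indistinguishability.\<close>

definition continuous_version ::
  "'w measure \<Rightarrow> (real \<Rightarrow> 'w \<Rightarrow> real) \<Rightarrow> real \<Rightarrow> real \<Rightarrow> (real \<Rightarrow> 'w \<Rightarrow> real) \<Rightarrow> bool" where
  "continuous_version M V s t w \<longleftrightarrow>
     (AE \<omega> in M. continuous_on {s..t} (\<lambda>r. w r \<omega>)) \<and>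
     (\<forall>r\<in>{s..t}. AE \<omega> in M. w r \<omega> = V r \<omega>)"

end

theory Submission
  imports Defs
begin

text \<open>The choice of \<open>\<eta>\<close> and \<open>\<zeta>\<close> makes the score terms cancel:
  \<open>\<beta> \<nu> - a = \<beta> \<mu> - b = (\<beta> - 1) f\<close>. Hence the stochastic part of \<open>log w\<close> is the backward minus the
  forward integral of the single field \<open>H = (\<beta> - 1) f / \<epsilon>\<^sup>2\<close> against \<open>X\<close>, which is the covariation of
  \<open>H(r, X)\<close> and \<open>X\<close>, that is, the time integral of \<open>\<epsilon>\<^sup>2 div H = (\<beta> - 1) div f\<close>. The squared norms of
  the drifts contribute \<open>(\<beta> - 1) \<beta> \<sigma>\<^sup>2 / 2\<close> times the squared norm of the score.

  Backward integrals of continuous adapted integrands exist because, after truncation, Riemann sums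
  over two partitions are close in \<open>L\<^sup>2\<close>. Forward integrals of \<open>C\<^sup>1\<close> fields then exist as backward
  integrals minus covariations.\<close>

section \<open>Convergence in probability along partitions\<close>

text \<open>All score cancellations come from the single relation
  \<open>\<eta> = \<beta> * (\<zeta>\<^sup>2 + 1) / 2\<close>, and \<open>c\<close> leaves the final
  formula because \<open>2 * \<eta> - \<beta> * \<zeta>\<^sup>2 = \<beta>\<close>. Hence fields that
  are \<open>C1_on\<close> jointly in time and space: linearizing them at the right end point turns
  the difference of the two sums into weighted squares of increments. The integrals are versions
  chosen among limits in probability, so several of them are compared through their Riemann sums on
  one sequence of partitions, along a subsequence on which all errors vanish almost surely. What
  remains is deterministic analysis of one continuous path. It yields one null set for each starting
  time, and continuity of paths merges these into one.\<close>

context prob_space begin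

text \<open>Truncated at 1, convergence in probability becomes convergence in mean, and a sequence
  that is null in mean has an almost surely null subsequence. One number \<open>e\<close> serves as
  threshold and as probability bound, as in the definition of the integrals.\<close>

lemma in_prob_subseq_AE:
  fixes D :: "nat \<Rightarrow> 'a \<Rightarrow> real"
  assumes [measurable]: "\<And>k. D k \<in> borel_measurable M"
    and lim: "\<And>e. 0 < e \<Longrightarrow> \<forall>\<^sub>F k in sequentially. prob {w \<in> space M. e < \<bar>D k w\<bar>} < e"
  obtains r where "strict_mono r" "AE w in M. (\<lambda>k. D (r k) w) \<longlonglongrightarrow> 0"
proof -
  define m where "m = (\<lambda>k w. min 1 \<bar>D k w\<bar>)"
  have [measurable]: "m k \<in> borel_measurable M" for k by (simp add: m_def)
  have bnd: "norm (m k w) \<le> 1" for k w by (simp add: m_def)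
  have int: "integrable M (m k)" for k
    by (rule integrable_const_bound[where B=1]) (use bnd in auto)
  have "(\<lambda>k. \<integral>w. norm (m k w) \<partial>M) \<longlonglongrightarrow> 0"
  proof (rule tendstoI)
    fix e :: real assume "0 < e"
    then have "0 < e / 2" by simp
    from lim[OF this] show "\<forall>\<^sub>F k in sequentially. dist (\<integral>w. norm (m k w) \<partial>M) 0 < e"
    proof eventually_elim
      case (elim k)
      let ?A = "{w \<in> space M. e / 2 < \<bar>D k w\<bar>}"
      have "(\<integral>w. norm (m k w) \<partial>M) \<le> (\<integral>w. e / 2 + indicator ?A w \<partial>M)"
      proof (rule integral_mono)
        show "integrable M (\<lambda>w. norm (m k w))" using int by simp
        show "integrable M (\<lambda>w. e / 2 + indicator ?A w)" by (simp add: emeasure_eq_measure)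
        show "norm (m k w) \<le> e / 2 + indicator ?A w" if "w \<in> space M" for w
          using that \<open>0 < e\<close> by (auto simp: m_def indicator_def)
      qed
      also have "\<dots> = e / 2 + prob ?A"
        by (simp add: emeasure_eq_measure prob_space)
      finally show ?case using elim by simp
    qed
  qed
  from tendsto_L1_AE_subseq[OF int this] obtain r
    where r: "strict_mono r" "AE w in M. (\<lambda>k. m (r k) w) \<longlonglongrightarrow> 0" by auto
  have "AE w in M. (\<lambda>k. D (r k) w) \<longlonglongrightarrow> 0"
    using r(2)
  proof eventually_elim
    case (elim w)
    have "(\<lambda>k. \<bar>D (r k) w\<bar>) \<longlonglongrightarrow> 0"
    proof (rule Lim_transform_eventually[OF elim])
      show "\<forall>\<^sub>F k in sequentially. m (r k) w = \<bar>D (r k) w\<bar>"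
        using order_tendstoD(2)[OF elim zero_less_one]
        by eventually_elim (auto simp: m_def)
    qed
    then show ?case by (rule tendsto_rabs_zero_cancel)
  qed
  with r(1) show thesis by (rule that)
qed

lemma AE_tendsto_imp_in_prob:
  fixes D :: "nat \<Rightarrow> 'a \<Rightarrow> real"
  assumes [measurable]: "\<And>k. D k \<in> borel_measurable M"
    and lim: "AE w in M. (\<lambda>k. D k w) \<longlonglongrightarrow> 0" and "0 < e"
  shows "\<forall>\<^sub>F k in sequentially. prob {w \<in> space M. e < \<bar>D k w\<bar>} < e"
proof -
  define A where "A = (\<lambda>k. {w \<in> space M. e < \<bar>D k w\<bar>})"
  have [measurable]: "A k \<in> sets M" for k by (simp add: A_def)
  have "(\<lambda>k. \<integral>w. indicator (A k) w \<partial>M) \<longlonglongrightarrow> (\<integral>w. (0::real) \<partial>M)"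
  proof (rule integral_dominated_convergence[where w="\<lambda>_. 1"])
    show "AE w in M. (\<lambda>k. indicator (A k) w :: real) \<longlonglongrightarrow> 0"
      using lim
    proof eventually_elim
      case (elim w)
      have "\<forall>\<^sub>F k in sequentially. \<bar>D k w\<bar> < e"
        using order_tendstoD(2)[OF tendsto_rabs_zero[OF elim] \<open>0 < e\<close>] .
      then have "\<forall>\<^sub>F k in sequentially. 0 = (indicator (A k) w :: real)"
        by eventually_elim (auto simp: A_def indicator_def)
      then show ?case by (rule Lim_transform_eventually[OF tendsto_const])
    qed
  qed (auto simp: indicator_def)
  then have "(\<lambda>k. prob (A k)) \<longlonglongrightarrow> 0" by simp
  from order_tendstoD(2)[OF this \<open>0 < e\<close>] show ?thesis by (simp add: A_def)
qed

text \<open>Along a subsequence with tolerances \<open>(1/2)^k\<close>, Borel-Cantelli makes the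
  consecutive differences summable almost surely, and the telescoping series converges.\<close>

lemma in_prob_Cauchy_subseq:
  fixes S :: "nat \<Rightarrow> 'a \<Rightarrow> real"
  assumes [measurable]: "\<And>k. S k \<in> borel_measurable M"
    and cauchy: "\<And>e. 0 < e \<Longrightarrow>
      \<exists>N. \<forall>k\<ge>N. \<forall>l\<ge>N. prob {w \<in> space M. e < \<bar>S k w - S l w\<bar>} < e"
  obtains r I where "strict_mono r" "I \<in> borel_measurable M"
    "AE w in M. (\<lambda>k. S (r k) w) \<longlonglongrightarrow> I w"
proof -
  have "\<exists>N. \<forall>j. \<forall>k\<ge>N j. \<forall>l\<ge>N j. prob {w \<in> space M. (1/2)^j < \<bar>S k w - S l w\<bar>} < (1/2)^j"
    by (intro choice allI cauchy) simp
  then obtain N where N: "\<And>j k l. N j \<le> k \<Longrightarrow> N j \<le> l \<Longrightarrow>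
    prob {w \<in> space M. (1/2)^j < \<bar>S k w - S l w\<bar>} < (1/2)^j" by metis
  \<comment> \<open>\<open>Suc x\<close> makes \<open>r\<close> strictly increasing;
    \<open>N (Suc k)\<close> keeps \<open>N k \<le> r k\<close>, so that the \<open>k\<close>-th
    tolerance applies to \<open>r k\<close> and all later indices.\<close>
  define r where "r = rec_nat (N 0) (\<lambda>k x. max (Suc x) (N (Suc k)))"
  have rS: "r (Suc k) = max (Suc (r k)) (N (Suc k))" for k by (simp add: r_def)
  have r: "strict_mono r" by (auto simp: strict_mono_Suc_iff rS less_max_iff_disj)
  have rN: "N k \<le> r k" for k by (cases k) (simp_all add: rS, simp add: r_def)
  define A where "A = (\<lambda>k. {w \<in> space M. (1/2)^k < \<bar>S (r k) w - S (r (Suc k)) w\<bar>})"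
  have [measurable]: "A k \<in> sets M" for k by (simp add: A_def)
  have A: "prob (A k) \<le> (1/2)^k" for k
  proof -
    have "r k < r (Suc k)" using r by (simp add: strict_mono_def)
    then show ?thesis unfolding A_def using N[of k "r k" "r (Suc k)"] rN[of k] by simp
  qed
  have "summable (\<lambda>k. prob (A k))"
    by (rule summable_comparison_test'[OF summable_geometric, of "1/2" 0]) (use A in auto)
  then have "AE w in M. \<forall>\<^sub>F k in sequentially. w \<in> space M - A k"
    by (intro borel_cantelli_AE1) (auto simp: emeasure_eq_measure)
  then have conv: "AE w in M. convergent (\<lambda>k. S (r k) w)"
  proof eventually_elim
    case (elim w)
    from elim have "\<forall>\<^sub>F k in sequentially. norm (S (r (Suc k)) w - S (r k) w) \<le> (1/2)^k"
      by eventually_elim (auto simp: A_def abs_minus_commute)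
    then have "summable (\<lambda>k. S (r (Suc k)) w - S (r k) w)"
      by (rule summable_comparison_test_ev) (simp add: summable_geometric)
    then have "convergent (\<lambda>n. \<Sum>k<n. S (r (Suc k)) w - S (r k) w)"
      by (simp add: summable_iff_convergent)
    then have "convergent (\<lambda>n. S (r n) w - S (r 0) w)"
      by (simp only: sum_lessThan_telescope[of "\<lambda>k. S (r k) w"])
    from convergent_add[OF this convergent_const[of "S (r 0) w"]] show ?case by simp
  qed
  define I where "I = (\<lambda>w. lim (\<lambda>k. S (r k) w))"
  have "I \<in> borel_measurable M" unfolding I_def by (rule borel_measurable_lim_metric) simp
  moreover have "AE w in M. (\<lambda>k. S (r k) w) \<longlonglongrightarrow> I w"
    using conv by eventually_elim (simp add: I_def convergent_LIMSEQ_iff)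
  ultimately show thesis using that r by blast
qed

end

section \<open>Sequences of partitions with vanishing mesh\<close>

lemma fine_grid_mono:
  assumes "fine_grid s t \<delta> n u" "i \<le> j" "j \<le> n"
  shows "u i \<le> u j"
  using assms(2,3)
proof (induction j rule: dec_induct)
  case (step j)
  then have "u i \<le> u j" "u j \<le> u (Suc j)"
    using assms(1) by (auto simp: fine_grid_def)
  then show ?case by simp
qed simp

lemma fine_grid_range:
  assumes "fine_grid s t \<delta> n u" "i \<le> n"
  shows "u i \<in> {s..t}"
  using fine_grid_mono[OF assms(1), of 0 i] fine_grid_mono[OF assms(1), of i n] assms
  by (auto simp: fine_grid_def)

text \<open>The mesh bounds are hidden behind a quantifier, so that a subsequence of partitions is
  again an instance without further bookkeeping.\<close>

definition fine_grids :: "real \<Rightarrow> real \<Rightarrow> (nat \<Rightarrow> nat) \<Rightarrow> (nat \<Rightarrow> nat \<Rightarrow> real) \<Rightarrow> bool" where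
  "fine_grids s t n u \<longleftrightarrow> (\<exists>\<delta>. \<delta> \<longlonglongrightarrow> 0 \<and> (\<forall>k. fine_grid s t (\<delta> k) (n k) (u k)))"

lemma fine_grids_subseq:
  assumes "fine_grids s t n u" "strict_mono r"
  shows "fine_grids s t (n \<circ> r) (u \<circ> r)"
proof -
  from assms(1) obtain \<delta> where d: "\<delta> \<longlonglongrightarrow> 0" "\<And>k. fine_grid s t (\<delta> k) (n k) (u k)"
    unfolding fine_grids_def by auto
  from LIMSEQ_subseq_LIMSEQ[OF d(1) assms(2)] d(2) show ?thesis
    unfolding fine_grids_def by (intro exI[of _ "\<delta> \<circ> r"]) (simp add: comp_def)
qed

text \<open>The summand 1 keeps the mesh bound positive when \<open>s = t\<close>, because the
  inequality in \<open>fine_grid\<close> is strict.\<close>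

lemma uniform_fine_grid:
  assumes "s \<le> t"
  shows "fine_grid s t (2 * (t - s + 1) / real (Suc k)) (Suc k) (\<lambda>i. s + (t - s) * real i / real (Suc k))"
proof -
  have "s + (t - s) * real (Suc i) / real (Suc k) - (s + (t - s) * real i / real (Suc k)) = (t - s) / real (Suc k)" for i
    by (simp add: diff_divide_distrib[symmetric] algebra_simps)
  moreover have "(t - s) / real (Suc k) \<ge> 0" "(t - s) / real (Suc k) < 2 * (t - s + 1) / real (Suc k)"
    using assms by (simp_all add: divide_strict_right_mono)
  ultimately have "s + (t - s) * real i / real (Suc k) \<le> s + (t - s) * real (Suc i) / real (Suc k)"
    "s + (t - s) * real (Suc i) / real (Suc k) - (s + (t - s) * real i / real (Suc k))
      < 2 * (t - s + 1) / real (Suc k)" for i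
    by (smt (verit))+
  then show ?thesis unfolding fine_grid_def by simp
qed

lemma ex_fine_grids:
  assumes "s \<le> t"
  obtains n u where "fine_grids s t n u"
proof -
  have "(\<lambda>k. 2 * (t - s + 1) / real (Suc k)) \<longlonglongrightarrow> 0"
    by (rule lim_const_over_n[THEN LIMSEQ_Suc])
  then show thesis
    using uniform_fine_grid[OF assms]
    by (intro that[of Suc "\<lambda>k i. s + (t - s) * real i / real (Suc k)"])
      (unfold fine_grids_def, intro exI[of _ "\<lambda>k. 2 * (t - s + 1) / real (Suc k)"] conjI allI)
qed

lemma fine_grids_eventually:
  assumes "fine_grids s t n u" "0 < \<delta>"
  shows "\<forall>\<^sub>F k in sequentially. fine_grid s t \<delta> (n k) (u k)"
proof -
  from assms(1) obtain d where d: "d \<longlonglongrightarrow> 0" "\<And>k. fine_grid s t (d k) (n k) (u k)"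
    unfolding fine_grids_def by auto
  from order_tendstoD(2)[OF d(1) assms(2)] show ?thesis
  proof eventually_elim
    case (elim k)
    then show ?case using d(2)[of k] unfolding fine_grid_def by force
  qed
qed

lemma fine_grids_ranges:
  assumes "fine_grids s t n u"  "i \<le> n k"
  shows "u k i \<in> {s..t}"
  using assms fine_grid_range unfolding fine_grids_def by blast

lemma fine_grids_le:
  assumes "fine_grids s t n u"  "i < n k"
  shows "u k i \<le> u k (Suc i)"
  using assms unfolding fine_grids_def fine_grid_def by blast

context prob_space begin

text \<open>The limit condition of the two stochastic integrals, for an arbitrary real functional of
  the partition. Errors of forward, backward and quadratic sums are thereby treated alike.\<close>

definition grid_null :: "real \<Rightarrow> real \<Rightarrow> (nat \<Rightarrow> (nat \<Rightarrow> real) \<Rightarrow> 'a \<Rightarrow> real) \<Rightarrow> bool" where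
  "grid_null s t D \<longleftrightarrow>
    (\<forall>e>0. \<exists>\<delta>>0. \<forall>n u. fine_grid s t \<delta> n u \<longrightarrow> prob {w \<in> space M. e < \<bar>D n u w\<bar>} < e)"

lemma grid_null_subseq:
  assumes "grid_null s t D" and g: "fine_grids s t n u"
    and meas: "\<And>k. D (n k) (u k) \<in> borel_measurable M"
  obtains r where "strict_mono r" "AE w in M. (\<lambda>k. D (n (r k)) (u (r k)) w) \<longlonglongrightarrow> 0"
proof (rule in_prob_subseq_AE[of "\<lambda>k. D (n k) (u k)"])
  fix e :: real assume "0 < e"
  with assms(1) obtain \<delta> where "\<delta> > 0" and
    d: "\<And>n u. fine_grid s t \<delta> n u \<Longrightarrow> prob {w \<in> space M. e < \<bar>D n u w\<bar>} < e"
    unfolding grid_null_def by blast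
  from fine_grids_eventually[OF g \<open>\<delta> > 0\<close>]
  show "\<forall>\<^sub>F k in sequentially. prob {w \<in> space M. e < \<bar>D (n k) (u k) w\<bar>} < e"
    by eventually_elim (rule d)
qed (use meas that in auto)

text \<open>Convergence in probability is tested on sequences of partitions: a supremum over the
  uncountably many partitions of small mesh need not be measurable.\<close>

lemma grid_nullI:
  assumes meas: "\<And>n u \<delta>. fine_grid s t \<delta> n u \<Longrightarrow> D n u \<in> borel_measurable M"
    and sub: "\<And>n u. fine_grids s t n u \<Longrightarrow>
      \<exists>r. strict_mono r \<and> (AE w in M. (\<lambda>k. D (n (r k)) (u (r k)) w) \<longlonglongrightarrow> 0)"
  shows "grid_null s t D"
  unfolding grid_null_def
proof (intro allI impI, rule ccontr)
  fix e :: real assume "0 < e"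
  assume "\<not> (\<exists>\<delta>>0. \<forall>n u. fine_grid s t \<delta> n u \<longrightarrow> prob {w \<in> space M. e < \<bar>D n u w\<bar>} < e)"
  \<comment> \<open>Failure at every mesh \<open>1 / (k + 1)\<close> produces a sequence of bad
    partitions, and every subsequence of it stays bad for the same \<open>e\<close>.\<close>
  then have "\<forall>k. \<exists>n u. fine_grid s t (1 / real (Suc k)) n u \<and> \<not> prob {w \<in> space M. e < \<bar>D n u w\<bar>} < e"
    by (metis of_nat_0_less_iff zero_less_Suc zero_less_divide_1_iff)
  then obtain n u where nu: "\<And>k. fine_grid s t (1 / real (Suc k)) (n k) (u k)"
    "\<And>k. \<not> prob {w \<in> space M. e < \<bar>D (n k) (u k) w\<bar>} < e" by metis
  have "fine_grids s t n u"
    unfolding fine_grids_def using nu(1) lim_const_over_n[of 1, THEN LIMSEQ_Suc] by blast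
  from sub[OF this] obtain r where "AE w in M. (\<lambda>k. D (n (r k)) (u (r k)) w) \<longlonglongrightarrow> 0" by blast
  from AE_tendsto_imp_in_prob[OF meas[OF nu(1)] this \<open>0 < e\<close>] nu(2) show False
    by (simp add: eventually_sequentially)
qed

text \<open>Completeness of convergence in probability, for sums indexed by partitions. The limit is
  found along uniform partitions; the Cauchy condition transfers it to all fine partitions.\<close>

lemma grid_Cauchy_limit:
  fixes S :: "nat \<Rightarrow> (nat \<Rightarrow> real) \<Rightarrow> 'a \<Rightarrow> real"
  assumes "s \<le> t"
    and meas: "\<And>n u \<delta>. fine_grid s t \<delta> n u \<Longrightarrow> S n u \<in> borel_measurable M"
    and cauchy: "\<And>e. 0 < e \<Longrightarrow> \<exists>\<delta>>0. \<forall>n u m v. fine_grid s t \<delta> n u \<longrightarrow> fine_grid s t \<delta> m v \<longrightarrow>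
      prob {w \<in> space M. e < \<bar>S n u w - S m v w\<bar>} < e"
  obtains I where "I \<in> borel_measurable M" "grid_null s t (\<lambda>n u w. S n u w - I w)"
proof -
  obtain n u where g: "fine_grids s t n u" using ex_fine_grids[OF \<open>s \<le> t\<close>] .
  then have m[measurable]: "S (n k) (u k) \<in> borel_measurable M" for k
    using meas unfolding fine_grids_def by blast
  have "\<exists>N. \<forall>k\<ge>N. \<forall>l\<ge>N. prob {w \<in> space M. e < \<bar>S (n k) (u k) w - S (n l) (u l) w\<bar>} < e"
    if e: "0 < e" for e
  proof -
    from cauchy[OF e] obtain \<delta> where "\<delta> > 0" and d: "\<And>n u m v. fine_grid s t \<delta> n u \<Longrightarrow>
      fine_grid s t \<delta> m v \<Longrightarrow> prob {w \<in> space M. e < \<bar>S n u w - S m v w\<bar>} < e" by blast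
    from fine_grids_eventually[OF g \<open>\<delta> > 0\<close>] obtain N where
      "\<And>k. N \<le> k \<Longrightarrow> fine_grid s t \<delta> (n k) (u k)" by (auto simp: eventually_sequentially)
    with d show ?thesis by (intro exI[of _ N]) simp
  qed
  then obtain r I where r: "strict_mono r"
    and I[measurable]: "I \<in> borel_measurable M"
    and lim: "AE w in M. (\<lambda>k. S (n (r k)) (u (r k)) w) \<longlonglongrightarrow> I w"
    by (rule in_prob_Cauchy_subseq[of "\<lambda>k. S (n k) (u k)", OF m])
  have "grid_null s t (\<lambda>n u w. S n u w - I w)"
    unfolding grid_null_def
  proof (intro allI impI)
    fix e :: real assume e: "0 < e"
    then have e2: "0 < e / 2" by simp
    from cauchy[OF e2] obtain \<delta> where "\<delta> > 0" and d: "\<And>n u m v. fine_grid s t \<delta> n u \<Longrightarrow>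
      fine_grid s t \<delta> m v \<Longrightarrow> prob {w \<in> space M. e/2 < \<bar>S n u w - S m v w\<bar>} < e/2" by blast
    have "AE w in M. (\<lambda>k. S (n (r k)) (u (r k)) w - I w) \<longlonglongrightarrow> 0"
      using lim by eventually_elim (simp add: LIM_zero)
    then have "\<forall>\<^sub>F k in sequentially. prob {w \<in> space M. e/2 < \<bar>S (n (r k)) (u (r k)) w - I w\<bar>} < e/2"
      by (intro AE_tendsto_imp_in_prob e2) auto
    moreover have "\<forall>\<^sub>F k in sequentially. fine_grid s t \<delta> (n (r k)) (u (r k))"
      using fine_grids_eventually[OF fine_grids_subseq[OF g r] \<open>\<delta> > 0\<close>] by simp
    \<comment> \<open>One partition of the sequence, both fine and close to \<open>I\<close>,
      mediates between \<open>I\<close> and an arbitrary fine partition; each half of the triangle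
      inequality costs \<open>e/2\<close>.\<close>
    ultimately obtain k where k: "prob {w \<in> space M. e/2 < \<bar>S (n (r k)) (u (r k)) w - I w\<bar>} < e/2"
      "fine_grid s t \<delta> (n (r k)) (u (r k))"
      using eventually_happens'[OF sequentially_bot eventually_conj] by blast
    show "\<exists>\<delta>>0. \<forall>n u. fine_grid s t \<delta> n u \<longrightarrow> prob {w \<in> space M. e < \<bar>S n u w - I w\<bar>} < e"
    proof (intro exI[of _ \<delta>] conjI allI impI)
      fix n' u' assume g': "fine_grid s t \<delta> n' u'"
      then have [measurable]: "S n' u' \<in> borel_measurable M" by (rule meas)
      let ?A = "{w \<in> space M. e/2 < \<bar>S (n (r k)) (u (r k)) w - I w\<bar>}"
      let ?B = "{w \<in> space M. e/2 < \<bar>S n' u' w - S (n (r k)) (u (r k)) w\<bar>}"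
      have "{w \<in> space M. e < \<bar>S n' u' w - I w\<bar>} \<subseteq> ?A \<union> ?B"
      proof safe
        fix w assume "e < \<bar>S n' u' w - I w\<bar>" "\<not> e/2 < \<bar>S n' u' w - S (n (r k)) (u (r k)) w\<bar>"
        then show "e/2 < \<bar>S (n (r k)) (u (r k)) w - I w\<bar>" by linarith
      qed
      then have "prob {w \<in> space M. e < \<bar>S n' u' w - I w\<bar>} \<le> prob (?A \<union> ?B)"
        by (rule finite_measure_mono) auto
      also have "\<dots> \<le> prob ?A + prob ?B" by (rule measure_Un_le) auto
      also have "\<dots> < e" using k(1) d[OF g' k(2)] by linarith
      finally show "prob {w \<in> space M. e < \<bar>S n' u' w - I w\<bar>} < e" .
    qed fact
  qed
  with I show thesis by (rule that)
qed

end

section \<open>Common refinements of partitions\<close>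

text \<open>The integrand is evaluated at \<open>c i\<close>, possibly beyond the right end point \<open>u (Suc i)\<close>: a
  refinement keeps the evaluation points of the coarser partition.\<close>

definition eval_grid :: "real \<Rightarrow> real \<Rightarrow> nat \<Rightarrow> (nat \<Rightarrow> real) \<Rightarrow> (nat \<Rightarrow> real) \<Rightarrow> bool" where
  "eval_grid t \<delta> n u c \<longleftrightarrow>
    (\<forall>i<n. u i \<le> u (Suc i) \<and> u (Suc i) \<le> c i \<and> c i \<le> t \<and> c i < u i + \<delta>)"

definition eval_sum ::
  "(real \<Rightarrow> real) \<Rightarrow> (real \<Rightarrow> real) \<Rightarrow> nat \<Rightarrow> (nat \<Rightarrow> real) \<Rightarrow> (nat \<Rightarrow> real) \<Rightarrow> real" where
  "eval_sum h W n u c = (\<Sum>i<n. h (c i) * (W (u (Suc i)) - W (u i)))"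

text \<open>After refinement both sums run over the same points \<open>z\<close> and differ only in
  their evaluation points, so their difference is a single sum with integrand
  \<open>h (c' i) - h (d' i)\<close>. The identities hold for all \<open>h\<close> and
  \<open>W\<close>, so that one refinement serves all paths and also the truncated
  integrand.\<close>

definition common_refinement where
  "common_refinement t \<delta> n u c m v d \<longleftrightarrow>
    (\<exists>k z c' d'. z 0 = u 0 \<and> z k = u n \<and> eval_grid t \<delta> k z c' \<and> eval_grid t \<delta> k z d' \<and>
      (\<forall>h W. eval_sum h W n u c = eval_sum h W k z c' \<and> eval_sum h W m v d = eval_sum h W k z d'))"

lemma common_refinement_sym:
  assumes "common_refinement t \<delta> n u c m v d" "u 0 = v 0" "u n = v m"
  shows "common_refinement t \<delta> m v d n u c"
  using assms unfolding common_refinement_def by metis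

lemma eval_grid_mono:
  assumes "eval_grid t \<delta> n u c" "i \<le> j" "j \<le> n"
  shows "u i \<le> u j"
  using assms(2,3)
proof (induction j rule: dec_induct)
  case (step j)
  with assms(1) have "u i \<le> u j" "u j \<le> u (Suc j)" by (auto simp: eval_grid_def)
  then show ?case by simp
qed simp

lemma eval_grid_const:
  assumes "eval_grid t \<delta> n u c" "u 0 = u n"
  shows "eval_sum h W n u c = 0"
proof -
  have "u i = u 0" if "i \<le> n" for i
    using eval_grid_mono[OF assms(1), of 0 i] eval_grid_mono[OF assms(1), of i n] assms(2) that by simp
  then have "u (Suc i) = u i" if "i < n" for i using that by (metis Suc_leI less_imp_le_nat)
  then show ?thesis unfolding eval_sum_def by (intro sum.neutral) auto
qed

lemma fine_grid_eval_grid: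
  assumes "fine_grid s t \<delta> n u"
  shows "eval_grid t \<delta> n u (\<lambda>i. u (Suc i))"
  using assms fine_grid_range[OF assms] unfolding eval_grid_def fine_grid_def
  by (auto simp: less_diff_eq diff_less_eq add.commute)

text \<open>The grids are merged from the left: the one whose first interval ends earlier loses that
  interval, and the first interval of the other is shortened accordingly. The total number of
  intervals drops by one.\<close>

lemma common_refinement_exists:
  assumes "eval_grid t \<delta> n u c" "eval_grid t \<delta> m v d" "u 0 = v 0" "u n = v m"
  shows "common_refinement t \<delta> n u c m v d"
  using assms
proof (induction "n + m" arbitrary: n m u v c d rule: less_induct)
  case less
  \<comment> \<open>The case in which the first grid has the earlier division point. It is stated
    for fresh grids with the same total number of intervals, so that the opposite case follows by
    exchanging the grids.\<close>
  have step: "common_refinement t \<delta> n' u c m' v d"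
    if eq: "n' + m' = n + m"
      and gu: "eval_grid t \<delta> n' u c" and gv: "eval_grid t \<delta> m' v d"
      and st: "u 0 = v 0" "u n' = v m'"
      and first: "n' = 0 \<or> (0 < m' \<and> u 1 \<le> v 1)" for n' m' and u v c d :: "nat \<Rightarrow> real"
  proof (cases n')
    case 0
    with gv st have "eval_sum h W m' v d = 0" for h W by (intro eval_grid_const) auto
    with 0 st show ?thesis
      unfolding common_refinement_def
      by (intro exI[of _ 0] exI[of _ u]) (auto simp: eval_grid_def eval_sum_def)
  next
    case (Suc n1)
    with first have m: "0 < m'" and le: "u 1 \<le> v 1" by auto
    from gu Suc have u01: "u 0 \<le> u 1" "u 1 \<le> c 0" "c 0 \<le> t" "c 0 < u 0 + \<delta>"
      by (auto simp: eval_grid_def)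
    from gv m have v01: "v 0 \<le> v 1" "v 1 \<le> d 0" "d 0 \<le> t" "d 0 < v 0 + \<delta>"
      by (auto simp: eval_grid_def)
    \<comment> \<open>The shortened first interval keeps its evaluation point \<open>d 0\<close>.
      The bound \<open>d 0 < u 1 + \<delta>\<close> survives because the left end point only moves
      to the right.\<close>
    let ?v = "v(0 := u 1)"
    have "common_refinement t \<delta> n1 (u \<circ> Suc) (c \<circ> Suc) m' ?v d"
    proof (rule less.hyps)
      show "n1 + m' < n + m" using Suc eq by simp
      show "eval_grid t \<delta> n1 (u \<circ> Suc) (c \<circ> Suc)" using gu Suc by (auto simp: eval_grid_def)
      show "eval_grid t \<delta> m' ?v d"
        using gv le v01 u01 st by (auto simp: eval_grid_def)
      show "(u \<circ> Suc) 0 = ?v 0" by simp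
      show "(u \<circ> Suc) n1 = ?v m'" using st Suc m by simp
    qed
    then obtain k z c' d' where z: "z 0 = u 1" "z k = u n'"
      and g: "eval_grid t \<delta> k z c'" "eval_grid t \<delta> k z d'"
      and sums: "\<And>h W. eval_sum h W n1 (u \<circ> Suc) (c \<circ> Suc) = eval_sum h W k z c'"
        "\<And>h W. eval_sum h W m' ?v d = eval_sum h W k z d'"
      unfolding common_refinement_def using Suc by auto
    let ?z = "case_nat (u 0) z" and ?c = "case_nat (c 0) c'" and ?d = "case_nat (d 0) d'"
    have "eval_grid t \<delta> (Suc k) ?z ?c" "eval_grid t \<delta> (Suc k) ?z ?d"
      using g u01 v01 st le z by (auto simp: eval_grid_def All_less_Suc2)
    moreover have "eval_sum h W n' u c = eval_sum h W (Suc k) ?z ?c" for h W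
      using sums(1)[of h W] z unfolding eval_sum_def Suc sum.lessThan_Suc_shift by simp
    moreover have "eval_sum h W m' v d = eval_sum h W (Suc k) ?z ?d" for h W
    proof -
      obtain m1 where m1: "m' = Suc m1" using m by (cases m') auto
      show ?thesis
        using sums(2)[of h W] z st unfolding eval_sum_def m1 sum.lessThan_Suc_shift
        by (simp add: algebra_simps)
    qed
    moreover have "?z 0 = u 0" "?z (Suc k) = u n'" using z by simp_all
    ultimately show ?thesis unfolding common_refinement_def by blast
  qed
  consider "n = 0 \<or> (0 < m \<and> u 1 \<le> v 1)" | "m = 0 \<or> (0 < n \<and> v 1 \<le> u 1)" by force
  then show ?case
  proof cases
    case 1
    show ?thesis by (rule step[OF refl less.prems 1])
  next
    case 2
    have "common_refinement t \<delta> m v d n u c"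
      by (rule step[OF add.commute less.prems(2,1) less.prems(3,4)[symmetric] 2])
    then show ?thesis by (rule common_refinement_sym[OF _ less.prems(3,4)[symmetric]])
  qed
qed

section \<open>Brownian increments\<close>

lemma normal_moments:
  assumes "0 < \<sigma>"
  shows "(\<integral>x. normal_density 0 \<sigma> x * x ^ 0 \<partial>lborel) = 1"
    and "(\<integral>x. normal_density 0 \<sigma> x * x ^ 1 \<partial>lborel) = 0"
    and "(\<integral>x. normal_density 0 \<sigma> x * x ^ 2 \<partial>lborel) = \<sigma>\<^sup>2"
    and "(\<integral>x. normal_density 0 \<sigma> x * x ^ 4 \<partial>lborel) = 3 * (\<sigma>\<^sup>2)\<^sup>2"
  using assms integral_normal_moment_even[OF assms, of 0 1] integral_normal_moment_odd[OF assms, of 0 0]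
    integral_normal_moment_even[OF assms, of 0 2]
  by (simp_all add: fact_numeral power_divide)

context prob_space begin

text \<open>In coordinates the density and the monomial both factor, so Fubini on the product of the
  coordinate axes reduces the moment to one-dimensional ones.\<close>

lemma gaussian_product_moment:
  fixes Z :: "'a \<Rightarrow> 'b::euclidean_space" and k :: "'b \<Rightarrow> nat"
  assumes D: "distributed M lborel Z (\<lambda>x. ennreal (\<Prod>b\<in>Basis. normal_density 0 \<sigma> (x \<bullet> b)))"
    and "0 < \<sigma>"
  shows "integrable M (\<lambda>w. \<Prod>b\<in>Basis. (Z w \<bullet> b) ^ k b)"
    and "(\<integral>w. (\<Prod>b\<in>Basis. (Z w \<bullet> b) ^ k b) \<partial>M) =
      (\<Prod>b\<in>Basis. \<integral>x. normal_density 0 \<sigma> x * x ^ k b \<partial>lborel)"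
proof -
  interpret P: product_sigma_finite "\<lambda>b::'b. lborel :: real measure" by standard
  let ?N = "\<lambda>x::'b. \<Prod>b\<in>Basis. normal_density 0 \<sigma> (x \<bullet> b)"
  let ?g = "\<lambda>x::'b. \<Prod>b\<in>Basis. (x \<bullet> b) ^ k b"
  let ?f = "\<lambda>b x. normal_density 0 \<sigma> x * x ^ k b"
  have nn: "0 \<le> ?N x" for x by (intro prod_nonneg) simp
  have int1: "integrable lborel (?f b)" for b
    using integrable_normal_moment[OF \<open>0 < \<sigma>\<close>, of 0 "k b"] by simp
  have int: "integrable (\<Pi>\<^sub>M b\<in>Basis. lborel) (\<lambda>x. \<Prod>b\<in>(Basis::'b set). ?f b (x b))"
    by (intro P.product_integrable_prod int1) simp
  have eq: "?N (\<Sum>b\<in>Basis. x b *\<^sub>R b) * ?g (\<Sum>b\<in>Basis. x b *\<^sub>R b) = (\<Prod>b\<in>Basis. ?f b (x b))" for x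
    by (simp add: prod.distrib[symmetric])
  have m: "(\<lambda>x. \<Sum>b\<in>(Basis::'b set). x b *\<^sub>R b) \<in> (\<Pi>\<^sub>M b\<in>Basis. lborel) \<rightarrow>\<^sub>M borel"
    by measurable
  have "integrable lborel (\<lambda>x. ?N x * ?g x)"
    by (subst lborel_eq[where 'a='b], subst integrable_distr_eq[OF m])
      (use int in \<open>simp_all only: eq\<close>, measurable)
  then show "integrable M (\<lambda>w. ?g (Z w))"
    using distributed_integrable[OF D _ nn, of ?g] by simp
  have "(\<integral>w. ?g (Z w) \<partial>M) = (\<integral>x. ?N x * ?g x \<partial>lborel)"
    by (rule distributed_integral[OF D _ nn, symmetric]) simp
  also have "\<dots> = (\<integral>x. (\<Prod>b\<in>Basis. ?f b (x b)) \<partial>(\<Pi>\<^sub>M b\<in>(Basis::'b set). lborel))"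
    by (subst lborel_eq[where 'a='b], subst integral_distr[OF m]) (simp_all only: eq, measurable)
  also have "\<dots> = (\<Prod>b\<in>Basis. \<integral>x. ?f b x \<partial>lborel)"
    by (intro P.product_integral_prod int1) simp
  finally show "(\<integral>w. ?g (Z w) \<partial>M) = (\<Prod>b\<in>Basis. \<integral>x. ?f b x \<partial>lborel)" .
qed

lemma gaussian_moments:
  fixes Z :: "'a \<Rightarrow> 'b::euclidean_space"
  assumes D: "distributed M lborel Z (\<lambda>x. ennreal (\<Prod>b\<in>Basis. normal_density 0 \<sigma> (x \<bullet> b)))"
    and \<sigma>: "0 < \<sigma>" and b: "b1 \<in> Basis" "b2 \<in> Basis"
  shows "integrable M (\<lambda>w. Z w \<bullet> b1)" "(\<integral>w. Z w \<bullet> b1 \<partial>M) = 0"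
    and "integrable M (\<lambda>w. (Z w \<bullet> b1) * (Z w \<bullet> b2))"
    and "(\<integral>w. (Z w \<bullet> b1) * (Z w \<bullet> b2) \<partial>M) = (if b1 = b2 then \<sigma>\<^sup>2 else 0)"
    and "integrable M (\<lambda>w. ((Z w \<bullet> b1) * (Z w \<bullet> b2))\<^sup>2)"
    and "(\<integral>w. ((Z w \<bullet> b1) * (Z w \<bullet> b2))\<^sup>2 \<partial>M) \<le> 3 * (\<sigma>\<^sup>2)\<^sup>2"
proof -
  \<comment> \<open>The exponents of the monomial
    \<open>((x \<bullet> b1) * (x \<bullet> b2)) ^ i\<close>. They add up when
    \<open>b1 = b2\<close>, so one formula covers both cases; the constant 3 in the last bound is
    the fourth moment for \<open>b1 = b2\<close>.\<close>
  let ?k = "\<lambda>i (b::'b). (if b = b1 then i else 0) + (if b = b2 then i else 0 :: nat)"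
  let ?k1 = "\<lambda>b. if b = b1 then 1 else 0 :: nat"
  have p1: "(\<Prod>b\<in>Basis. (x \<bullet> b) ^ ?k1 b) = x \<bullet> b1" for x :: 'b
  proof -
    have "(\<Prod>b\<in>Basis. (x \<bullet> b) ^ ?k1 b) = (\<Prod>b\<in>Basis. if b = b1 then x \<bullet> b else 1)"
      by (intro prod.cong) auto
    then show ?thesis using b by simp
  qed
  have p2: "(\<Prod>b\<in>Basis. (x \<bullet> b) ^ ?k i b) = ((x \<bullet> b1) * (x \<bullet> b2)) ^ i" for x :: 'b and i
  proof -
    have "(\<Prod>b\<in>Basis. (x \<bullet> b) ^ ?k i b) =
      (\<Prod>b\<in>Basis. (if b = b1 then (x \<bullet> b) ^ i else 1) * (if b = b2 then (x \<bullet> b) ^ i else 1))"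
      by (intro prod.cong) (auto simp: power_add)
    then show ?thesis using b by (simp add: prod.distrib power_mult_distrib)
  qed
  let ?m = "\<lambda>i. \<integral>x. normal_density 0 \<sigma> x * x ^ i \<partial>lborel"
  note m = normal_moments[OF \<sigma>]
  have q1: "(\<Prod>b\<in>Basis. ?m (?k1 b)) = 0"
    using b m(2) by (intro prod_zero bexI[of _ b1]) auto
  have q2: "(\<Prod>b\<in>Basis. ?m (?k i b)) = (if b1 = b2 then ?m (i + i) else ?m i * ?m i)" for i
  proof -
    have "(\<Prod>b\<in>Basis. ?m (?k i b)) =
      (\<Prod>b\<in>Basis. (if b = b1 then if b1 = b2 then ?m (i + i) else ?m i else 1) *
        (if b = b2 then if b1 = b2 then 1 else ?m i else 1))"
      by (intro prod.cong) (use m(1) in auto)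
    then show ?thesis using b by (simp add: prod.distrib)
  qed
  note gp = gaussian_product_moment[OF D \<sigma>]
  show "integrable M (\<lambda>w. Z w \<bullet> b1)" using gp(1)[of ?k1] unfolding p1 .
  show "(\<integral>w. Z w \<bullet> b1 \<partial>M) = 0" using gp(2)[of ?k1] unfolding p1 q1 .
  show "integrable M (\<lambda>w. (Z w \<bullet> b1) * (Z w \<bullet> b2))"
    using gp(1)[of "?k 1"] unfolding p2 by simp
  show "integrable M (\<lambda>w. ((Z w \<bullet> b1) * (Z w \<bullet> b2))\<^sup>2)"
    using gp(1)[of "?k 2"] unfolding p2 .
  show "(\<integral>w. (Z w \<bullet> b1) * (Z w \<bullet> b2) \<partial>M) = (if b1 = b2 then \<sigma>\<^sup>2 else 0)"
  proof -
    have "(1::nat) + 1 = 2" by simp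
    then show ?thesis using gp(2)[of "?k 1"] m unfolding p2 q2 by (simp del: One_nat_def)
  qed
  show "(\<integral>w. ((Z w \<bullet> b1) * (Z w \<bullet> b2))\<^sup>2 \<partial>M) \<le> 3 * (\<sigma>\<^sup>2)\<^sup>2"
  proof -
    have "(2::nat) + 2 = 4" by simp
    moreover have "(0::real) \<le> (\<sigma>\<^sup>2)\<^sup>2" "\<sigma>\<^sup>2 * \<sigma>\<^sup>2 = (\<sigma>\<^sup>2)\<^sup>2" by (simp_all add: power2_eq_square)
    ultimately show ?thesis using gp(2)[of "?k 2"] m unfolding p2 q2 by (simp split: if_splits)
  qed
qed

text \<open>The abstract isometry, with indices running against the flow of information: every later
  summand is known to \<open>A i\<close>. Removing the smallest index \<open>m\<close> from the sum
  leaves a cross term \<open>(g m * T) * Y m\<close> whose first factor is known to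
  \<open>A m\<close>, and \<open>first\<close> makes it vanish. Boundedness of \<open>g\<close>
  supplies the integrability of that factor.\<close>

lemma orthogonal_sum_second_moment:
  fixes g Y :: "nat \<Rightarrow> 'a \<Rightarrow> real" and A :: "nat \<Rightarrow> 'a measure"
  assumes sub: "\<And>i. i < n \<Longrightarrow> subalgebra M (A i)"
    and g: "\<And>i. i < n \<Longrightarrow> g i \<in> borel_measurable (A i)"
    and bound: "\<And>i w. i < n \<Longrightarrow> \<bar>g i w\<bar> \<le> K"
    and Y: "\<And>i. i < n \<Longrightarrow> Y i \<in> borel_measurable M"
    and adapted: "\<And>i j. i < j \<Longrightarrow> j < n \<Longrightarrow>
      g j \<in> borel_measurable (A i) \<and> Y j \<in> borel_measurable (A i)"
    and first: "\<And>i Z. i < n \<Longrightarrow> Z \<in> borel_measurable (A i) \<Longrightarrow> integrable M Z \<Longrightarrow>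
      integrable M (\<lambda>w. Z w * Y i w) \<and> (\<integral>w. Z w * Y i w \<partial>M) = 0"
    and second: "\<And>i Z. i < n \<Longrightarrow> Z \<in> borel_measurable (A i) \<Longrightarrow> integrable M Z \<Longrightarrow>
      integrable M (\<lambda>w. Z w * (Y i w)\<^sup>2) \<and> (\<integral>w. Z w * (Y i w)\<^sup>2 \<partial>M) = (\<integral>w. Z w \<partial>M) * v i"
  shows "integrable M (\<lambda>w. (\<Sum>i<n. g i w * Y i w)\<^sup>2)"
    and "(\<integral>w. (\<Sum>i<n. g i w * Y i w)\<^sup>2 \<partial>M) = (\<Sum>i<n. (\<integral>w. (g i w)\<^sup>2 \<partial>M) * v i)"
proof -
  have gM: "g i \<in> borel_measurable M" if "i < n" for i
    using measurable_from_subalg[OF sub g] that by simp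
  have "integrable M (\<lambda>w. (\<Sum>i=m..<n. g i w * Y i w)\<^sup>2) \<and>
    (\<integral>w. (\<Sum>i=m..<n. g i w * Y i w)\<^sup>2 \<partial>M) = (\<Sum>i=m..<n. (\<integral>w. (g i w)\<^sup>2 \<partial>M) * v i)"
    if "m \<le> n" for m
    using that
  proof (induction m rule: inc_induct)
    case (step m)
    have m: "m < n" by fact
    let ?T = "\<lambda>w. \<Sum>i=Suc m..<n. g i w * Y i w"
    have TA: "?T \<in> borel_measurable (A m)"
      using adapted[of m] by (intro borel_measurable_sum borel_measurable_times) auto
    have T: "?T \<in> borel_measurable M" by (rule measurable_from_subalg[OF sub[OF m] TA])
    have T2: "integrable M (\<lambda>w. (?T w)\<^sup>2)" using step.IH by simp
    have Tint: "integrable M ?T" by (rule square_integrable_imp_integrable[OF T T2])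
    have gint: "integrable M (\<lambda>w. (g m w)\<^sup>2)"
      using gM[OF m] bound[OF m]
      by (intro integrable_const_bound[where B="K\<^sup>2"]) (auto intro!: always_eventually power2_le_iff_abs_le[THEN iffD2] intro: order_trans[OF abs_ge_zero])
    have gT: "integrable M (\<lambda>w. g m w * ?T w)"
    proof (rule Bochner_Integration.integrable_bound[where f="\<lambda>w. K * ?T w"])
      show "AE w in M. norm (g m w * ?T w) \<le> norm (K * ?T w)"
        using bound[OF m]
        by (auto simp: abs_mult intro!: always_eventually mult_right_mono intro: order_trans[OF _ abs_ge_self])
    qed (use Tint T gM[OF m] in auto)
    have c1: "integrable M (\<lambda>w. (g m w * ?T w) * Y m w)" "(\<integral>w. (g m w * ?T w) * Y m w \<partial>M) = 0"
      using first[OF m _ gT] TA g[OF m] by auto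
    have c2: "integrable M (\<lambda>w. (g m w)\<^sup>2 * (Y m w)\<^sup>2)"
      "(\<integral>w. (g m w)\<^sup>2 * (Y m w)\<^sup>2 \<partial>M) = (\<integral>w. (g m w)\<^sup>2 \<partial>M) * v m"
      using second[OF m _ gint] g[OF m] by auto
    have eq: "(\<Sum>i=m..<n. g i w * Y i w)\<^sup>2 =
      (g m w)\<^sup>2 * (Y m w)\<^sup>2 + 2 * ((g m w * ?T w) * Y m w) + (?T w)\<^sup>2" for w
      using m by (simp add: sum.atLeast_Suc_lessThan power2_eq_square algebra_simps)
    show ?case
      unfolding eq using c1 c2 T2 step.IH m by (simp add: sum.atLeast_Suc_lessThan)
  qed simp
  from this[of 0] show "integrable M (\<lambda>w. (\<Sum>i<n. g i w * Y i w)\<^sup>2)"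
    "(\<integral>w. (\<Sum>i<n. g i w * Y i w)\<^sup>2 \<partial>M) = (\<Sum>i<n. (\<integral>w. (g i w)\<^sup>2 \<partial>M) * v i)"
    by (simp_all add: atLeast0LessThan)
qed

lemma prob_abs_le_second_moment:
  assumes "T \<in> borel_measurable M" "integrable M (\<lambda>w. (T w)\<^sup>2 :: real)" "0 < e"
  shows "prob {w \<in> space M. e < \<bar>T w\<bar>} \<le> (\<integral>w. (T w)\<^sup>2 \<partial>M) / e\<^sup>2"
proof -
  have [measurable]: "T \<in> borel_measurable M" by fact
  have "prob {w \<in> space M. e < \<bar>T w\<bar>} \<le> prob {w \<in> space M. e\<^sup>2 \<le> (T w)\<^sup>2}"
    by (rule finite_measure_mono) (use \<open>0 < e\<close> in \<open>auto simp: abs_le_square_iff[symmetric]\<close>)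
  also have "\<dots> \<le> (\<integral>w. (T w)\<^sup>2 \<partial>M) / e\<^sup>2"
    by (rule integral_Markov_inequality_measure[where A="{}"]) (use assms in auto)
  finally show ?thesis .
qed

end

text \<open>The reversed Brownian motion in the original time: \<open>G v\<close> holds the
  information from \<open>v\<close> onwards, and the increment over \<open>{r..v}\<close> is
  independent of it. Increments are written earlier minus later, as they appear to the reversed
  motion. Only conditions on subintervals occur, so that the locale passes to later starting
  times.\<close>

locale backward_brownian = prob_space M for M :: "'w measure" +
  fixes G :: "real \<Rightarrow> 'w measure" and W :: "real \<Rightarrow> 'w \<Rightarrow> 'a::euclidean_space" and s t :: real
  assumes subalg: "\<And>r. r \<in> {s..t} \<Longrightarrow> subalgebra M (G r)"
    and anti: "\<And>r v. s \<le> r \<Longrightarrow> r \<le> v \<Longrightarrow> v \<le> t \<Longrightarrow> sets (G v) \<subseteq> sets (G r)"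
    and W_adapted: "\<And>r. r \<in> {s..t} \<Longrightarrow> W r \<in> borel_measurable (G r)"
    and increment_distributed: "\<And>r v. s \<le> r \<Longrightarrow> r < v \<Longrightarrow> v \<le> t \<Longrightarrow>
      distributed M lborel (\<lambda>w. W r w - W v w)
        (\<lambda>x. ennreal (\<Prod>b\<in>Basis. normal_density 0 (sqrt (v - r)) (x \<bullet> b)))"
    and increment_indep: "\<And>r v. s \<le> r \<Longrightarrow> r < v \<Longrightarrow> v \<le> t \<Longrightarrow>
      indep_set (sets (G v)) {(\<lambda>w. W r w - W v w) -` A \<inter> space M | A. A \<in> sets borel}"
begin

lemma measurable_G_mono:
  assumes "f \<in> measurable (G v) N" "s \<le> r" "r \<le> v" "v \<le> t"
  shows "f \<in> measurable (G r) N"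
proof -
  have "space (G v) = space (G r)"
    using subalg[of v] subalg[of r] assms(2-) by (auto simp: subalgebra_def)
  then show ?thesis using assms(1) anti[OF assms(2-)] unfolding measurable_def by auto
qed

lemma measurable_G:
  assumes "f \<in> measurable (G r) N" "r \<in> {s..t}"
  shows "f \<in> measurable M N"
  using measurable_from_subalg[OF subalg] assms by blast

lemma W_measurable: "r \<in> {s..t} \<Longrightarrow> W r \<in> borel_measurable M"
  using W_adapted measurable_G by blast

text \<open>\<open>Z\<close> is known at the later time \<open>v\<close> and hence independent of
  the increment, so expectations multiply.\<close>

lemma increment_integral:
  assumes rv: "s \<le> r" "r \<le> v" "v \<le> t"
    and Z: "Z \<in> borel_measurable (G v)" "integrable M Z"
    and \<phi>: "\<phi> \<in> borel_measurable borel" "integrable M (\<lambda>w. \<phi> (W r w - W v w))"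
  shows "integrable M (\<lambda>w. Z w * \<phi> (W r w - W v w) :: real)"
    and "(\<integral>w. Z w * \<phi> (W r w - W v w) \<partial>M) = (\<integral>w. Z w \<partial>M) * (\<integral>w. \<phi> (W r w - W v w) \<partial>M)"
proof -
  have "integrable M (\<lambda>w. Z w * \<phi> (W r w - W v w)) \<and>
    (\<integral>w. Z w * \<phi> (W r w - W v w) \<partial>M) = (\<integral>w. Z w \<partial>M) * (\<integral>w. \<phi> (W r w - W v w) \<partial>M)"
  \<comment> \<open>Partitions may repeat points, whereas law and independence of an increment are
    given only for \<open>r < v\<close>. For \<open>r = v\<close> the second factor is the constant
    \<open>\<phi> 0\<close>.\<close>
  proof (cases "r = v")
    case True
    then show ?thesis using Z by (simp add: prob_space)
  next
    case False
    then have "r < v" using rv by simp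
    have sp: "space (G v) = space M" using subalg[of v] rv by (auto simp: subalgebra_def)
    have [measurable]: "W r \<in> borel_measurable M" "W v \<in> borel_measurable M"
      using W_measurable rv by auto
    have Zm[measurable]: "Z \<in> borel_measurable M" using measurable_G[OF Z(1)] rv by simp
    note \<phi>(1)[measurable]
    let ?D = "\<lambda>w. W r w - W v w"
    have "indep_var borel Z borel (\<lambda>w. \<phi> (?D w))"
      unfolding indep_var_eq
    proof (intro conjI indep_set_sigma_sets indep_setI)
      fix a b assume a: "a \<in> {Z -` A \<inter> space M |A. A \<in> sets borel}"
        and b: "b \<in> {(\<lambda>w. \<phi> (?D w)) -` A \<inter> space M |A. A \<in> sets borel}"
      have "a \<in> sets (G v)" using a Z(1) unfolding sp[symmetric] by (auto intro: measurable_sets)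
      moreover from b obtain B where B: "B \<in> sets borel" "b = (\<lambda>w. \<phi> (?D w)) -` B \<inter> space M" by blast
      have "b = ?D -` (\<phi> -` B) \<inter> space M" using B by auto
      moreover have "\<phi> -` B \<in> sets borel"
        using measurable_sets[OF \<phi>(1) B(1)] by simp
      ultimately show "prob (a \<inter> b) = prob a * prob b"
        by (intro indep_setD[OF increment_indep[OF rv(1) \<open>r < v\<close> rv(3)]]) auto
    next
      have stable: "Int_stable {h -` A \<inter> space M |A. A \<in> sets borel}" for h :: "'w \<Rightarrow> real"
      proof (rule Int_stableI, clarify)
        fix A B :: "real set" assume "A \<in> sets borel" "B \<in> sets borel"
        then show "\<exists>C. (h -` A \<inter> space M) \<inter> (h -` B \<inter> space M) = h -` C \<inter> space M \<and> C \<in> sets borel"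
          by (intro exI[of _ "A \<inter> B"]) auto
      qed
      show "Int_stable {Z -` A \<inter> space M |A. A \<in> sets borel}" by (rule stable)
      show "Int_stable {(\<lambda>w. \<phi> (?D w)) -` A \<inter> space M |A. A \<in> sets borel}" by (rule stable)
    qed auto
    from indep_var_integrable[OF this Z(2) \<phi>(2)] indep_var_lebesgue_integral[OF this Z(2) \<phi>(2)]
    show ?thesis by simp
  qed
  then show "integrable M (\<lambda>w. Z w * \<phi> (W r w - W v w))"
    "(\<integral>w. Z w * \<phi> (W r w - W v w) \<partial>M) = (\<integral>w. Z w \<partial>M) * (\<integral>w. \<phi> (W r w - W v w) \<partial>M)" by auto
qed

lemma increment_moments:
  assumes rv: "s \<le> r" "r \<le> v" "v \<le> t" and b: "b1 \<in> Basis" "b2 \<in> Basis"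
  defines "D \<equiv> \<lambda>w. W r w - W v w"
  shows "integrable M (\<lambda>w. D w \<bullet> b1)" "(\<integral>w. D w \<bullet> b1 \<partial>M) = 0"
    and "integrable M (\<lambda>w. (D w \<bullet> b1) * (D w \<bullet> b2))"
    and "(\<integral>w. (D w \<bullet> b1) * (D w \<bullet> b2) \<partial>M) = (if b1 = b2 then v - r else 0)"
    and "integrable M (\<lambda>w. ((D w \<bullet> b1) * (D w \<bullet> b2))\<^sup>2)"
    and "(\<integral>w. ((D w \<bullet> b1) * (D w \<bullet> b2))\<^sup>2 \<partial>M) \<le> 3 * (v - r)\<^sup>2"
proof -
  show "integrable M (\<lambda>w. D w \<bullet> b1)" "(\<integral>w. D w \<bullet> b1 \<partial>M) = 0"
    "integrable M (\<lambda>w. (D w \<bullet> b1) * (D w \<bullet> b2))"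
    "(\<integral>w. (D w \<bullet> b1) * (D w \<bullet> b2) \<partial>M) = (if b1 = b2 then v - r else 0)"
    "integrable M (\<lambda>w. ((D w \<bullet> b1) * (D w \<bullet> b2))\<^sup>2)"
    "(\<integral>w. ((D w \<bullet> b1) * (D w \<bullet> b2))\<^sup>2 \<partial>M) \<le> 3 * (v - r)\<^sup>2"
    using gaussian_moments[OF increment_distributed[OF rv(1) _ rv(3)] _ b] rv(2)
    by (cases "r = v"; simp add: D_def)+
qed

end

section \<open>The backward Ito integral and the quadratic variation\<close>

lemma Icc_countable_dense:
  obtains D where "countable D" "D \<subseteq> {s..t}" "closure D = {s..t::real}"
proof -
  obtain D where D: "countable D" "D \<subseteq> {s..t}" "{s..t} \<subseteq> closure D" by (rule separable)
  moreover have "closure D \<subseteq> {s..t}" by (rule closure_minimal[OF D(2)]) simp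
  ultimately show thesis by (intro that[of D]) auto
qed

definition clamp_real :: "real \<Rightarrow> real \<Rightarrow> real" where
  "clamp_real K x = max (- K) (min K x)"

lemma clamp_real_bound: "0 \<le> K \<Longrightarrow> \<bar>clamp_real K x\<bar> \<le> K"
  by (auto simp: clamp_real_def)

lemma clamp_real_eq: "\<bar>x\<bar> \<le> K \<Longrightarrow> clamp_real K x = x"
  by (auto simp: clamp_real_def)

lemma measurable_clamp_real[measurable]: "clamp_real K \<in> borel_measurable borel"
  unfolding clamp_real_def[abs_def] by measurable

lemma continuous_on_clamp_real: "continuous_on A f \<Longrightarrow> continuous_on A (\<lambda>x. clamp_real K (f x))"
  unfolding clamp_real_def by (intro continuous_intros)

context prob_space begin

text \<open>The events that the bound \<open>k\<close> is exceeded on a countable dense set of times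
  are measurable and decrease to a null set, since continuous paths on a compact interval are
  bounded. Continuity carries the bound from the dense set to all times. This replaces stopping
  times: off a small event the process equals its truncation.\<close>

lemma continuous_process_bounded:
  fixes H :: "real \<Rightarrow> 'a \<Rightarrow> real"
  assumes meas: "\<And>r. r \<in> {s..t} \<Longrightarrow> H r \<in> borel_measurable M"
    and cont: "AE w in M. continuous_on {s..t} (\<lambda>r. H r w)" and "0 < e"
  obtains K A where "0 < K" "A \<in> sets M" "prob A < e"
    "\<And>w r. w \<in> space M - A \<Longrightarrow> r \<in> {s..t} \<Longrightarrow> \<bar>H r w\<bar> \<le> K"
proof -
  obtain D where D: "countable D" "D \<subseteq> {s..t}" "closure D = {s..t}" by (rule Icc_countable_dense)
  from cont obtain N where N: "\<And>w. w \<in> space M - N \<Longrightarrow> continuous_on {s..t} (\<lambda>r. H r w)"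
    "N \<in> null_sets M" by (rule AE_E3) blast
  then have [measurable]: "N \<in> sets M" by auto
  define A where "A = (\<lambda>k::nat. N \<union> {w \<in> space M. \<exists>r\<in>D. real k < \<bar>H r w\<bar>})"
  have "{w \<in> space M. \<exists>r\<in>D. real k < \<bar>H r w\<bar>} = (\<Union>r\<in>D. {w \<in> space M. real k < \<bar>H r w\<bar>})" for k
    by auto
  moreover have "(\<Union>r\<in>D. {w \<in> space M. real k < \<bar>H r w\<bar>}) \<in> sets M" for k
  proof (rule sets.countable_UN''[OF D(1)])
    fix r assume "r \<in> D"
    then have [measurable]: "H r \<in> borel_measurable M" using meas D(2) by auto
    show "{w \<in> space M. real k < \<bar>H r w\<bar>} \<in> sets M" by measurable
  qed
  ultimately have A[measurable]: "A k \<in> sets M" for k unfolding A_def by auto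
  have bounded: "\<bar>H r w\<bar> \<le> real k" if "w \<in> space M - A k" "r \<in> {s..t}" for w r k
  proof (rule continuous_le_on_closure[where S=D and f="\<lambda>r. \<bar>H r w\<bar>"])
    show "continuous_on (closure D) (\<lambda>r. \<bar>H r w\<bar>)"
      unfolding D(3) using N(1)[of w] that by (intro continuous_intros) (auto simp: A_def)
  qed (use that D in \<open>auto simp: A_def not_less\<close>)
  have "decseq A"
    unfolding decseq_def A_def by (auto, meson le_less_trans of_nat_le_iff)
  then have lim: "(\<lambda>k. prob (A k)) \<longlonglongrightarrow> prob (\<Inter>k. A k)"
    by (intro finite_Lim_measure_decseq) auto
  have "(\<Inter>k. A k) \<subseteq> N"
  proof
    fix w assume w: "w \<in> (\<Inter>k. A k)"
    show "w \<in> N"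
    proof (rule ccontr)
      assume "w \<notin> N"
      moreover have "w \<in> space M" using w sets.sets_into_space[OF A] by blast
      ultimately have "continuous_on {s..t} (\<lambda>r. H r w)" using N(1) by blast
      then have "compact ((\<lambda>r. H r w) ` {s..t})" by (intro compact_continuous_image) auto
      then obtain B where B: "\<forall>r\<in>{s..t}. \<bar>H r w\<bar> \<le> B"
        by (auto dest!: compact_imp_bounded simp: bounded_iff)
      obtain k :: nat where "B \<le> real k" using real_arch_simple by blast
      moreover obtain r where "r \<in> D" "real k < \<bar>H r w\<bar>"
        using w \<open>w \<notin> N\<close> by (auto simp: A_def)
      ultimately show False using B D(2) by (meson not_less order_trans subsetD)
    qed
  qed
  then have "prob (\<Inter>k. A k) \<le> prob N" by (rule finite_measure_mono) auto
  moreover have "prob N = 0" using N(2) by (auto simp: null_sets_def measure_def)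
  ultimately have "prob (\<Inter>k. A k) = 0" using measure_nonneg[of M "\<Inter>k. A k"] by linarith
  with lim have "(\<lambda>k. prob (A k)) \<longlonglongrightarrow> 0" by simp
  from order_tendstoD(2)[OF this \<open>0 < e\<close>] obtain k where "prob (A k) < e"
    using eventually_happens'[OF sequentially_bot] by blast
  \<comment> \<open>The shift by 1 makes the bound positive even if \<open>k\<close> is 0.\<close>
  with bounded[of _ k] show thesis
    by (intro that[of "real k + 1" "A k"]) fastforce+
qed

text \<open>By dominated convergence \<open>?F\<close> is continuous on the compact square, hence
  uniformly continuous. Comparing \<open>(r, v)\<close> with the diagonal point
  \<open>(v, v)\<close>, where \<open>?F\<close> vanishes, gives the claim.\<close>

lemma continuous_process_uniform_L2:
  fixes H :: "real \<Rightarrow> 'a \<Rightarrow> real"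
  assumes meas: "\<And>r. r \<in> {s..t} \<Longrightarrow> H r \<in> borel_measurable M"
    and cont: "AE w in M. continuous_on {s..t} (\<lambda>r. H r w)"
    and bound: "\<And>r w. \<bar>H r w\<bar> \<le> K" and "0 < e"
  obtains \<delta> where "0 < \<delta>"
    "\<And>r v. r \<in> {s..t} \<Longrightarrow> v \<in> {s..t} \<Longrightarrow> \<bar>r - v\<bar> < \<delta> \<Longrightarrow> (\<integral>w. (H r w - H v w)\<^sup>2 \<partial>M) < e"
proof -
  let ?F = "\<lambda>z. \<integral>w. (H (fst z) w - H (snd z) w)\<^sup>2 \<partial>M"
  have "continuous_on ({s..t} \<times> {s..t}) ?F"
    unfolding continuous_on_sequentially comp_def
  proof (intro allI ballI impI, elim conjE)
    fix x z assume z: "z \<in> {s..t} \<times> {s..t}" and x: "\<forall>n. x n \<in> {s..t} \<times> {s..t}" "x \<longlonglongrightarrow> z"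
    show "(\<lambda>n. ?F (x n)) \<longlonglongrightarrow> ?F z"
    proof (rule integral_dominated_convergence[where w="\<lambda>_. (2 * K)\<^sup>2"])
      show "AE w in M. (\<lambda>n. (H (fst (x n)) w - H (snd (x n)) w)\<^sup>2) \<longlonglongrightarrow> (H (fst z) w - H (snd z) w)\<^sup>2"
        using cont
      proof eventually_elim
        case (elim w)
        have "(\<lambda>n. H (fst (x n)) w) \<longlonglongrightarrow> H (fst z) w" "(\<lambda>n. H (snd (x n)) w) \<longlonglongrightarrow> H (snd z) w"
          using x z by (auto intro!: continuous_on_tendsto_compose[OF elim] tendsto_fst tendsto_snd
            always_eventually simp: mem_Times_iff)
        then show ?case by (intro tendsto_intros)
      qed
      show "AE w in M. norm ((H (fst (x n)) w - H (snd (x n)) w)\<^sup>2) \<le> (2 * K)\<^sup>2" for n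
      proof (rule AE_I2)
        fix w
        have "\<bar>H (fst (x n)) w - H (snd (x n)) w\<bar> \<le> 2 * K"
          using bound[of "fst (x n)" w] bound[of "snd (x n)" w] by linarith
        from power_mono[OF this, of 2] show "norm ((H (fst (x n)) w - H (snd (x n)) w)\<^sup>2) \<le> (2 * K)\<^sup>2"
          by simp
      qed
      show "(\<lambda>w. (H (fst z) w - H (snd z) w)\<^sup>2) \<in> borel_measurable M"
        using z by (intro borel_measurable_power borel_measurable_diff meas) auto
      show "(\<lambda>w. (H (fst (x n)) w - H (snd (x n)) w)\<^sup>2) \<in> borel_measurable M" for n
        using x by (intro borel_measurable_power borel_measurable_diff meas) (auto simp: mem_Times_iff)
    qed simp
  qed
  then have "uniformly_continuous_on ({s..t} \<times> {s..t}) ?F"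
    by (intro compact_uniformly_continuous compact_Times) auto
  with \<open>0 < e\<close> obtain \<delta> where \<delta>: "0 < \<delta>" "\<And>z z'. z \<in> {s..t} \<times> {s..t} \<Longrightarrow> z' \<in> {s..t} \<times> {s..t} \<Longrightarrow>
    dist z' z < \<delta> \<Longrightarrow> dist (?F z') (?F z) < e"
    unfolding uniformly_continuous_on_def by meson
  show thesis
  proof (rule that[OF \<delta>(1)])
    fix r v assume rv: "r \<in> {s..t}" "v \<in> {s..t}" "\<bar>r - v\<bar> < \<delta>"
    then have "dist (r, v) (v, v) < \<delta>" by (simp add: dist_Pair_Pair dist_real_def)
    from \<delta>(2)[OF _ _ this] rv show "(\<integral>w. (H r w - H v w)\<^sup>2 \<partial>M) < e" by simp
  qed
qed

text \<open>\<open>T\<close> is the truncated version of \<open>S\<close>, and \<open>l\<close> is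
  the length of the time interval. Dividing the second moment by \<open>e\<^sup>2\<close> leaves
  \<open>e / 4 * (l / (l + 1))\<close>, at most \<open>e / 4\<close>; together with the exceptional
  event this stays below \<open>e\<close>. The summand 1 admits \<open>l = 0\<close>.\<close>

lemma prob_localized_bound:
  fixes S T :: "'a \<Rightarrow> real"
  assumes [measurable]: "S \<in> borel_measurable M" "T \<in> borel_measurable M" "A \<in> sets M"
    and A: "prob A < e / 2" "\<And>w. w \<in> space M - A \<Longrightarrow> T w = S w"
    and T: "integrable M (\<lambda>w. (T w)\<^sup>2)" "(\<integral>w. (T w)\<^sup>2 \<partial>M) \<le> e ^ 3 / (4 * (l + 1)) * l"
    and "0 < e" "0 \<le> l"
  shows "prob {w \<in> space M. e < \<bar>S w\<bar>} < e"
proof -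
  have "prob {w \<in> space M. e < \<bar>S w\<bar>} \<le> prob (A \<union> {w \<in> space M. e < \<bar>T w\<bar>})"
    by (rule finite_measure_mono) (use A(2) in auto)
  also have "\<dots> \<le> prob A + prob {w \<in> space M. e < \<bar>T w\<bar>}" by (rule measure_Un_le) auto
  also have "prob {w \<in> space M. e < \<bar>T w\<bar>} \<le> (\<integral>w. (T w)\<^sup>2 \<partial>M) / e\<^sup>2"
    by (rule prob_abs_le_second_moment) (use T \<open>0 < e\<close> in auto)
  also have "\<dots> \<le> e ^ 3 / (4 * (l + 1)) * l / e\<^sup>2" by (intro divide_right_mono T) simp
  also have "\<dots> = e / 4 * (l / (l + 1))"
    using \<open>0 < e\<close> by (simp add: power3_eq_cube power2_eq_square)
  also have "\<dots> \<le> e / 4 * 1"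
    using \<open>0 \<le> l\<close> \<open>0 < e\<close> by (intro mult_left_mono) simp_all
  finally show ?thesis using A(1) \<open>0 < e\<close> by simp
qed

end

section \<open>Isometry, backward integral and quadratic variation\<close>

context backward_brownian begin

text \<open>The isometry with a general function \<open>\<phi> i\<close> of the increment: linear
  \<open>\<phi>\<close> gives the stochastic integral, centred quadratic \<open>\<phi>\<close> the
  quadratic variation. The weight \<open>g i\<close> may use information from the right end point
  onwards.\<close>

lemma increment_sum_second_moment:
  fixes g :: "nat \<Rightarrow> 'w \<Rightarrow> real" and \<phi> :: "nat \<Rightarrow> 'a \<Rightarrow> real"
  assumes z: "\<And>i. i < k \<Longrightarrow> z i \<le> z (Suc i)" "\<And>i. i \<le> k \<Longrightarrow> z i \<in> {s..t}"
    and g: "\<And>i. i < k \<Longrightarrow> g i \<in> borel_measurable (G (z (Suc i)))" "\<And>i w. i < k \<Longrightarrow> \<bar>g i w\<bar> \<le> K"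
    and \<phi>: "\<And>i. \<phi> i \<in> borel_measurable borel"
  defines "Y \<equiv> \<lambda>i w. \<phi> i (W (z i) w - W (z (Suc i)) w)"
  assumes Y: "\<And>i. i < k \<Longrightarrow> integrable M (Y i)" "\<And>i. i < k \<Longrightarrow> (\<integral>w. Y i w \<partial>M) = 0"
      "\<And>i. i < k \<Longrightarrow> integrable M (\<lambda>w. (Y i w)\<^sup>2)"
  shows "(\<lambda>w. \<Sum>i<k. g i w * Y i w) \<in> borel_measurable M"
    and "integrable M (\<lambda>w. (\<Sum>i<k. g i w * Y i w)\<^sup>2)"
    and "(\<integral>w. (\<Sum>i<k. g i w * Y i w)\<^sup>2 \<partial>M) =
      (\<Sum>i<k. (\<integral>w. (g i w)\<^sup>2 \<partial>M) * (\<integral>w. (Y i w)\<^sup>2 \<partial>M))"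
proof -
  have mono: "z i \<le> z j" if "i \<le> j" "j \<le> k" for i j
    using that
  proof (induction j rule: dec_induct)
    case (step j)
    with z(1)[of j] show ?case by simp
  qed simp
  have Ym: "Y i \<in> borel_measurable (G v)" if "i < k" "s \<le> v" "v \<le> z i" for i v
  proof -
    have "W (z i) \<in> borel_measurable (G v)" "W (z (Suc i)) \<in> borel_measurable (G v)"
      using z(1)[OF that(1)] z(2)[of i] z(2)[of "Suc i"] that
      by (auto intro!: measurable_G_mono[of "W (z i)" "z i"]
        measurable_G_mono[of "W (z (Suc i))" "z (Suc i)"] W_adapted)
    then show ?thesis
      unfolding Y_def by (intro measurable_compose[OF _ \<phi>]) simp
  qed
  have YM: "Y i \<in> borel_measurable M" if "i < k" for i
    using z(2)[of i] that by (intro measurable_G[OF Ym[of i "z i"]]) auto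
  have gM: "g i \<in> borel_measurable M" if "i < k" for i
    using measurable_G[OF g(1)[OF that]] z(2)[of "Suc i"] that by simp
  have first: "integrable M (\<lambda>w. Z w * Y i w) \<and> (\<integral>w. Z w * Y i w \<partial>M) = 0"
    and second: "integrable M (\<lambda>w. Z w * (Y i w)\<^sup>2) \<and>
      (\<integral>w. Z w * (Y i w)\<^sup>2 \<partial>M) = (\<integral>w. Z w \<partial>M) * (\<integral>w. (Y i w)\<^sup>2 \<partial>M)"
    if "i < k" "Z \<in> borel_measurable (G (z (Suc i)))" "integrable M Z" for i Z
  proof -
    have r: "s \<le> z i" "z i \<le> z (Suc i)" "z (Suc i) \<le> t" using z(1)[of i] z(2)[of i] z(2)[of "Suc i"] that by auto
    show "integrable M (\<lambda>w. Z w * Y i w) \<and> (\<integral>w. Z w * Y i w \<partial>M) = 0"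
      using increment_integral[OF r that(2,3) \<phi>[of i]] Y(1,2)[OF that(1)] unfolding Y_def by simp
    show "integrable M (\<lambda>w. Z w * (Y i w)\<^sup>2) \<and>
      (\<integral>w. Z w * (Y i w)\<^sup>2 \<partial>M) = (\<integral>w. Z w \<partial>M) * (\<integral>w. (Y i w)\<^sup>2 \<partial>M)"
      using increment_integral[OF r that(2,3) borel_measurable_power[OF \<phi>[of i], of 2]] Y(3)[OF that(1)]
      unfolding Y_def by simp
  qed
  have adapted: "g j \<in> borel_measurable (G (z (Suc i))) \<and> Y j \<in> borel_measurable (G (z (Suc i)))"
    if "i < j" "j < k" for i j
    using mono[of "Suc i" "Suc j"] mono[of "Suc i" j] z(2)[of "Suc i"] z(2)[of "Suc j"] that
    by (intro conjI measurable_G_mono[OF g(1)] Ym) auto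
  have sub: "subalgebra M (G (z (Suc i)))" if "i < k" for i using z(2)[of "Suc i"] that by (intro subalg) simp
  show "(\<lambda>w. \<Sum>i<k. g i w * Y i w) \<in> borel_measurable M"
    using gM YM by (intro borel_measurable_sum borel_measurable_times) auto
  show "integrable M (\<lambda>w. (\<Sum>i<k. g i w * Y i w)\<^sup>2)"
    and "(\<integral>w. (\<Sum>i<k. g i w * Y i w)\<^sup>2 \<partial>M) =
      (\<Sum>i<k. (\<integral>w. (g i w)\<^sup>2 \<partial>M) * (\<integral>w. (Y i w)\<^sup>2 \<partial>M))"
    using orthogonal_sum_second_moment[where A="\<lambda>i. G (z (Suc i))" and v="\<lambda>i. \<integral>w. (Y i w)\<^sup>2 \<partial>M",
      OF sub g YM adapted first second] by blast+
qed

text \<open>Since evaluation points lie at or beyond the right end point \<open>z (Suc i)\<close>,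
  the difference \<open>H (c i) - H (d i)\<close> is known before the increment in reversed time,
  and the isometry applies. Both points lie within \<open>\<delta>\<close> of \<open>z i\<close>,
  which makes each mean square at most \<open>\<eta>\<close>.\<close>

lemma ito_step_second_moment:
  assumes adapted: "\<And>r. r \<in> {s..t} \<Longrightarrow> H r \<in> borel_measurable (G r)"
    and bound: "\<And>r w. \<bar>H r w\<bar> \<le> K"
    and z: "eval_grid t \<delta> k z c" "eval_grid t \<delta> k z d" "z 0 = s" "z k \<le> t"
    and osc: "\<And>r v. r \<in> {s..t} \<Longrightarrow> v \<in> {s..t} \<Longrightarrow> \<bar>r - v\<bar> < \<delta> \<Longrightarrow> (\<integral>w. (H r w - H v w)\<^sup>2 \<partial>M) \<le> \<eta>"
    and b: "b \<in> Basis"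
  defines "S \<equiv> \<lambda>c w. eval_sum (\<lambda>r. H r w) (\<lambda>r. W r w \<bullet> b) k z c"
  shows "(\<lambda>w. S c w - S d w) \<in> borel_measurable M"
    and "integrable M (\<lambda>w. (S c w - S d w)\<^sup>2)"
    and "(\<integral>w. (S c w - S d w)\<^sup>2 \<partial>M) \<le> \<eta> * (z k - s)"
proof -
  define g where "g = (\<lambda>i w. H (c i) w - H (d i) w)"
  \<comment> \<open>The sums use later minus earlier values, the locale earlier minus later; hence
    the sign.\<close>
  let ?Y = "\<lambda>i w. - ((W (z i) w - W (z (Suc i)) w) \<bullet> b)"
  have zr: "z i \<in> {s..t}" if "i \<le> k" for i
    using eval_grid_mono[OF z(1), of 0 i] eval_grid_mono[OF z(1), of i k] z(3,4) that by simp
  have cd: "z (Suc i) \<le> c i" "c i \<le> t" "z (Suc i) \<le> d i" "d i \<le> t" "\<bar>c i - d i\<bar> < \<delta>" "z i \<le> z (Suc i)"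
    if "i < k" for i
    using z(1,2) that unfolding eval_grid_def by (auto simp: abs_less_iff) (smt (verit, best))+
  have gm: "g i \<in> borel_measurable (G (z (Suc i)))" if "i < k" for i
  proof -
    have "H (c i) \<in> borel_measurable (G (z (Suc i)))" "H (d i) \<in> borel_measurable (G (z (Suc i)))"
      using cd[OF that] zr[of "Suc i"] that
      by (auto intro!: measurable_G_mono[of "H (c i)" "c i"] measurable_G_mono[of "H (d i)" "d i"] adapted)
    then show ?thesis unfolding g_def by simp
  qed
  have gb: "\<bar>g i w\<bar> \<le> 2 * K" for i w
    using bound[of "c i" w] bound[of "d i" w] unfolding g_def by linarith
  have S: "S c w - S d w = (\<Sum>i<k. g i w * ?Y i w)" for w
    by (simp add: S_def eval_sum_def g_def sum_subtractf[symmetric] algebra_simps)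
  have Y: "integrable M (?Y i)" "(\<integral>w. ?Y i w \<partial>M) = 0"
    "integrable M (\<lambda>w. (?Y i w)\<^sup>2)" "(\<integral>w. (?Y i w)\<^sup>2 \<partial>M) = z (Suc i) - z i" if "i < k" for i
    using increment_moments[OF _ cd(6)[OF that] _ b b] zr[of i] zr[of "Suc i"] that
    by (simp_all add: power2_eq_square)
  note sums = increment_sum_second_moment[of k z g "2 * K" "\<lambda>i x. - (x \<bullet> b)", OF cd(6) zr gm gb _ Y(1-3)]
  show "(\<lambda>w. S c w - S d w) \<in> borel_measurable M" "integrable M (\<lambda>w. (S c w - S d w)\<^sup>2)"
    unfolding S using sums(1,2) by simp_all
  have "(\<integral>w. (S c w - S d w)\<^sup>2 \<partial>M) = (\<Sum>i<k. (\<integral>w. (g i w)\<^sup>2 \<partial>M) * (z (Suc i) - z i))"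
    unfolding S using sums(3) Y(4) by simp
  also have "\<dots> \<le> (\<Sum>i<k. \<eta> * (z (Suc i) - z i))"
  proof (intro sum_mono mult_right_mono)
    fix i assume "i \<in> {..<k}"
    then have i: "i < k" by simp
    show "(\<integral>w. (g i w)\<^sup>2 \<partial>M) \<le> \<eta>"
      unfolding g_def using cd[OF i] zr[of "Suc i"] i by (intro osc) auto
    show "0 \<le> z (Suc i) - z i" using cd[OF i] by simp
  qed
  also have "\<dots> = \<eta> * (z k - s)"
    unfolding z(3)[symmetric] by (simp add: sum_distrib_left[symmetric] sum_lessThan_telescope)
  finally show "(\<integral>w. (S c w - S d w)\<^sup>2 \<partial>M) \<le> \<eta> * (z k - s)" .
qed

lemma backward_ito_integral_exists:
  fixes H :: "real \<Rightarrow> 'w \<Rightarrow> real"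
  assumes "s \<le> t" and adapted: "\<And>r. r \<in> {s..t} \<Longrightarrow> H r \<in> borel_measurable (G r)"
    and cont: "AE w in M. continuous_on {s..t} (\<lambda>r. H r w)"
    and b: "b \<in> Basis"
  obtains I where "I \<in> borel_measurable M"
    "grid_null s t (\<lambda>n u w. (\<Sum>i<n. H (u (Suc i)) w * ((W (u (Suc i)) w - W (u i) w) \<bullet> b)) - I w)"
proof -
  define S where "S = (\<lambda>n u w. \<Sum>i<n. H (u (Suc i)) w * ((W (u (Suc i)) w - W (u i) w) \<bullet> b))"
  have S: "S n u w = eval_sum (\<lambda>r. H r w) (\<lambda>r. W r w \<bullet> b) n u (\<lambda>i. u (Suc i))" for n u w
    by (simp add: S_def eval_sum_def inner_diff_left)
  have HM: "H r \<in> borel_measurable M" if "r \<in> {s..t}" for r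
    by (rule measurable_G[OF adapted[OF that] that])
  have SM: "S n u \<in> borel_measurable M" if g: "fine_grid s t \<delta> n u" for n u \<delta>
    unfolding S_def using fine_grid_range[OF g] W_measurable HM
    by (intro borel_measurable_sum borel_measurable_times borel_measurable_inner borel_measurable_diff)
      auto
  have "\<exists>\<delta>>0. \<forall>n u m v. fine_grid s t \<delta> n u \<longrightarrow> fine_grid s t \<delta> m v \<longrightarrow>
      prob {w \<in> space M. e < \<bar>S n u w - S m v w\<bar>} < e" if "0 < e" for e
  proof -
    have "0 < e / 2" using that by simp
    from continuous_process_bounded[OF HM cont this] obtain K A where K: "0 < K"
      and A[measurable]: "A \<in> sets M" "prob A < e / 2"
      and bd: "\<And>w r. w \<in> space M - A \<Longrightarrow> r \<in> {s..t} \<Longrightarrow> \<bar>H r w\<bar> \<le> K" by metis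
    define HK where "HK = (\<lambda>r w. clamp_real K (H r w))"
    have HKad: "HK r \<in> borel_measurable (G r)" if "r \<in> {s..t}" for r
      unfolding HK_def using adapted[OF that] by measurable
    have HKc: "AE w in M. continuous_on {s..t} (\<lambda>r. HK r w)"
      unfolding HK_def using cont by eventually_elim (rule continuous_on_clamp_real)
    have HKb: "\<bar>HK r w\<bar> \<le> K" for r w unfolding HK_def using K by (intro clamp_real_bound) simp
    \<comment> \<open>The factor of the length in \<open>prob_localized_bound\<close>, with
      \<open>l = t - s\<close>.\<close>
    define \<eta> where "\<eta> = e ^ 3 / (4 * (t - s + 1))"
    have \<eta>: "0 < \<eta>" using \<open>s \<le> t\<close> that by (simp add: \<eta>_def)
    from continuous_process_uniform_L2[OF measurable_G[OF HKad] HKc HKb \<eta>] obtain \<delta>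
      where \<delta>: "0 < \<delta>" and osc: "\<And>r v. r \<in> {s..t} \<Longrightarrow> v \<in> {s..t} \<Longrightarrow> \<bar>r - v\<bar> < \<delta> \<Longrightarrow>
        (\<integral>w. (HK r w - HK v w)\<^sup>2 \<partial>M) < \<eta>" by metis
    have "prob {w \<in> space M. e < \<bar>S n u w - S m v w\<bar>} < e"
      if g: "fine_grid s t \<delta> n u" "fine_grid s t \<delta> m v" for n u m v
    proof -
      have ends: "u 0 = s" "u n = t" "v 0 = s" "v m = t" using g by (auto simp: fine_grid_def)
      have "common_refinement t \<delta> n u (\<lambda>i. u (Suc i)) m v (\<lambda>i. v (Suc i))"
        using g ends by (intro common_refinement_exists fine_grid_eval_grid) auto
      then obtain k z c d where z: "z 0 = s" "z k = t" "eval_grid t \<delta> k z c" "eval_grid t \<delta> k z d"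
        and sums: "\<And>h W. eval_sum h W n u (\<lambda>i. u (Suc i)) = eval_sum h W k z c"
          "\<And>h W. eval_sum h W m v (\<lambda>i. v (Suc i)) = eval_sum h W k z d"
        unfolding common_refinement_def ends by blast
      define T where "T = (\<lambda>w. eval_sum (\<lambda>r. HK r w) (\<lambda>r. W r w \<bullet> b) k z c -
        eval_sum (\<lambda>r. HK r w) (\<lambda>r. W r w \<bullet> b) k z d)"
      \<comment> \<open>The refinement identities hold for every integrand, so undoing the
        refinement and undoing the truncation off \<open>A\<close> are independent of each
        other.\<close>
      have TS: "T w = S n u w - S m v w" if "w \<in> space M - A" for w
      proof -
        have eq: "HK r w = H r w" if "r \<in> {s..t}" for r
          unfolding HK_def using bd[OF \<open>w \<in> space M - A\<close> that] by (rule clamp_real_eq)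
        show ?thesis
          unfolding T_def sums[symmetric] S
          by (simp add: eval_sum_def eq fine_grid_range[OF g(1), simplified] fine_grid_range[OF g(2), simplified] Suc_le_eq
            cong: sum.cong_simp)
      qed
      note st = ito_step_second_moment[OF HKad HKb z(3,4,1) _ osc[THEN less_imp_le] b, folded z(2)]
      show ?thesis
      proof (rule prob_localized_bound[OF _ _ A TS])
        show "T \<in> borel_measurable M" "integrable M (\<lambda>w. (T w)\<^sup>2)"
          "(\<integral>w. (T w)\<^sup>2 \<partial>M) \<le> e ^ 3 / (4 * (t - s + 1)) * (t - s)"
          unfolding T_def using st z(2) by (auto simp: \<eta>_def)
        show "(\<lambda>w. S n u w - S m v w) \<in> borel_measurable M" using SM g by (intro borel_measurable_diff)
      qed (use \<open>0 < e\<close> \<open>s \<le> t\<close> in auto)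
    qed
    with \<delta> show ?thesis by blast
  qed
  note cauchy = this
  show thesis
  proof (rule grid_Cauchy_limit[of s t S])
    fix I assume "I \<in> borel_measurable M" "grid_null s t (\<lambda>n u w. S n u w - I w)"
    then show thesis unfolding S_def by (rule that)
  qed (fact \<open>s \<le> t\<close> SM cauchy)+
qed

text \<open>Products of coordinate increments minus their mean are centred, with second moment at
  most three times the squared interval length. By the isometry the weighted sum has second moment
  at most \<open>3 * K\<^sup>2 * \<delta> * (t - s)\<close> after truncation. For
  \<open>b1 \<noteq> b2\<close> the mean is 0: distinct coordinates have no covariation.\<close>

lemma quadratic_variation:
  fixes H :: "real \<Rightarrow> 'w \<Rightarrow> real"
  assumes "s \<le> t" and adapted: "\<And>r. r \<in> {s..t} \<Longrightarrow> H r \<in> borel_measurable (G r)"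
    and cont: "AE w in M. continuous_on {s..t} (\<lambda>r. H r w)"
    and b: "b1 \<in> Basis" "b2 \<in> Basis"
  shows "grid_null s t (\<lambda>n u w. \<Sum>i<n. H (u (Suc i)) w *
    (((W (u (Suc i)) w - W (u i) w) \<bullet> b1) * ((W (u (Suc i)) w - W (u i) w) \<bullet> b2) -
      (if b1 = b2 then u (Suc i) - u i else 0)))"
  unfolding grid_null_def
proof (intro allI impI)
  fix e :: real assume "0 < e"
  define Y where "Y = (\<lambda>u (i::nat) w. ((W (u (Suc i)) w - W (u i) w) \<bullet> b1) * ((W (u (Suc i)) w - W (u i) w) \<bullet> b2) -
      (if b1 = b2 then u (Suc i) - u i else 0))"
  define S where "S = (\<lambda>n u w. \<Sum>i<n. H (u (Suc i)) w * Y u i w)"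
  have HM: "H r \<in> borel_measurable M" if "r \<in> {s..t}" for r
    by (rule measurable_G[OF adapted[OF that] that])
  have "0 < e / 2" using \<open>0 < e\<close> by simp
  from continuous_process_bounded[OF HM cont this] obtain K A where K: "0 < K"
    and A[measurable]: "A \<in> sets M" "prob A < e / 2"
    and bd: "\<And>w r. w \<in> space M - A \<Longrightarrow> r \<in> {s..t} \<Longrightarrow> \<bar>H r w\<bar> \<le> K" by metis
  define HK where "HK = (\<lambda>r w. clamp_real K (H r w))"
  have HKad: "HK r \<in> borel_measurable (G r)" if "r \<in> {s..t}" for r
    unfolding HK_def using adapted[OF that] by measurable
  have HKb: "\<bar>HK r w\<bar> \<le> K" for r w unfolding HK_def using K by (intro clamp_real_bound) simp
  define \<eta> where "\<eta> = e ^ 3 / (4 * (t - s + 1))"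
  \<comment> \<open>Chosen so that the mesh turns the bound \<open>3 * K\<^sup>2 * \<delta>\<close>
    into exactly \<open>\<eta>\<close>.\<close>
  define \<delta> where "\<delta> = \<eta> / (3 * K\<^sup>2)"
  have \<delta>: "0 < \<delta>" "3 * K\<^sup>2 * \<delta> = \<eta>" using \<open>s \<le> t\<close> \<open>0 < e\<close> K by (simp_all add: \<delta>_def \<eta>_def)
  have "prob {w \<in> space M. e < \<bar>S n u w\<bar>} < e" if g: "fine_grid s t \<delta> n u" for n u
  proof -
    have ends: "u 0 = s" "u n = t" using g by (auto simp: fine_grid_def)
    have step: "u i \<le> u (Suc i)" "u (Suc i) - u i \<le> \<delta>" if "i < n" for i
      using g that by (auto simp: fine_grid_def less_imp_le)
    note mono = fine_grid_mono[OF g] and ur = fine_grid_range[OF g]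
    define g where "g = (\<lambda>i w. HK (u (Suc i)) w)"
    let ?D = "\<lambda>i w. W (u i) w - W (u (Suc i)) w"
    define \<phi> where "\<phi> = (\<lambda>i x. (x \<bullet> b1) * (x \<bullet> b2) - (if b1 = b2 then u (Suc i) - u i else 0))"
    have \<phi>M: "\<phi> i \<in> borel_measurable borel" for i unfolding \<phi>_def by measurable
    have Y\<phi>: "Y u i w = \<phi> i (?D i w)" for i w
      by (simp add: Y_def \<phi>_def algebra_simps)
    have gm: "g i \<in> borel_measurable (G (u (Suc i)))" "\<bar>g i w\<bar> \<le> K" if "i < n" for i w
      using HKad HKb ur[of "Suc i"] that by (auto simp: g_def)
    have mom: "integrable M (\<lambda>w. \<phi> i (?D i w))" "(\<integral>w. \<phi> i (?D i w) \<partial>M) = 0"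
      "integrable M (\<lambda>w. (\<phi> i (?D i w))\<^sup>2)" "(\<integral>w. (\<phi> i (?D i w))\<^sup>2 \<partial>M) \<le> 3 * (u (Suc i) - u i)\<^sup>2"
      if "i < n" for i
    proof -
      have r: "s \<le> u i" "u i \<le> u (Suc i)" "u (Suc i) \<le> t" using ur[of i] ur[of "Suc i"] step that by auto
      note m = increment_moments[OF r b]
      show "integrable M (\<lambda>w. \<phi> i (?D i w))" using m(3) by (simp add: \<phi>_def)
      show "(\<integral>w. \<phi> i (?D i w) \<partial>M) = 0" using m(3,4) by (simp add: \<phi>_def prob_space)
      let ?c = "if b1 = b2 then u (Suc i) - u i else 0"
      have sq: "(\<phi> i x)\<^sup>2 = ((x \<bullet> b1) * (x \<bullet> b2))\<^sup>2 - 2 * ?c * ((x \<bullet> b1) * (x \<bullet> b2)) + ?c\<^sup>2" for x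
        unfolding \<phi>_def by (simp add: power2_diff)
      show "integrable M (\<lambda>w. (\<phi> i (?D i w))\<^sup>2)" unfolding sq using m(3,5) by simp
      have "(\<integral>w. (\<phi> i (?D i w))\<^sup>2 \<partial>M) = (\<integral>w. ((?D i w \<bullet> b1) * (?D i w \<bullet> b2))\<^sup>2 \<partial>M) - 2 * ?c * ?c + ?c\<^sup>2"
        unfolding sq using m(3,4,5) by (simp add: prob_space)
      also have "\<dots> \<le> (\<integral>w. ((?D i w \<bullet> b1) * (?D i w \<bullet> b2))\<^sup>2 \<partial>M)" by (simp add: power2_eq_square)
      also have "\<dots> \<le> 3 * (u (Suc i) - u i)\<^sup>2" by (rule m(6))
      finally show "(\<integral>w. (\<phi> i (?D i w))\<^sup>2 \<partial>M) \<le> 3 * (u (Suc i) - u i)\<^sup>2" .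
    qed
    define T where "T = (\<lambda>w. \<Sum>i<n. g i w * \<phi> i (?D i w))"
    note sums = increment_sum_second_moment[of n u g K \<phi>, OF step(1) ur gm \<phi>M mom(1-3), folded T_def]
    have "(\<integral>w. (T w)\<^sup>2 \<partial>M) = (\<Sum>i<n. (\<integral>w. (g i w)\<^sup>2 \<partial>M) * (\<integral>w. (\<phi> i (?D i w))\<^sup>2 \<partial>M))"
      unfolding T_def by (rule sums(3))
    also have "\<dots> \<le> (\<Sum>i<n. K\<^sup>2 * (3 * \<delta> * (u (Suc i) - u i)))"
    proof (intro sum_mono mult_mono)
      fix i assume "i \<in> {..<n}"
      then have i: "i < n" by simp
      have [measurable]: "g i \<in> borel_measurable M"
        unfolding g_def using ur[of "Suc i"] i by (intro measurable_G[OF HKad]) auto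
      have sq: "(g i w)\<^sup>2 \<le> K\<^sup>2" for w
        using power_mono[OF gm(2)[OF i, of w], of 2] by simp
      have "integrable M (\<lambda>w. (g i w)\<^sup>2)"
        by (rule integrable_const_bound[where B="K\<^sup>2"]) (use sq in auto)
      then have "(\<integral>w. (g i w)\<^sup>2 \<partial>M) \<le> (\<integral>w. K\<^sup>2 \<partial>M)" by (rule integral_mono) (use sq in auto)
      then show "(\<integral>w. (g i w)\<^sup>2 \<partial>M) \<le> K\<^sup>2" by (simp add: prob_space)
      have "(\<integral>w. (\<phi> i (?D i w))\<^sup>2 \<partial>M) \<le> 3 * ((u (Suc i) - u i) * (u (Suc i) - u i))"
        using mom(4)[OF i] by (simp add: power2_eq_square)
      also have "\<dots> \<le> 3 * (\<delta> * (u (Suc i) - u i))"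
        using step[OF i] by (intro mult_left_mono mult_right_mono) auto
      finally show "(\<integral>w. (\<phi> i (?D i w))\<^sup>2 \<partial>M) \<le> 3 * \<delta> * (u (Suc i) - u i)" by simp
    qed simp_all
    also have "\<dots> = 3 * K\<^sup>2 * \<delta> * (\<Sum>i<n. u (Suc i) - u i)"
      unfolding sum_distrib_left by (intro sum.cong) (simp_all add: algebra_simps)
    also have "(\<Sum>i<n. u (Suc i) - u i) = t - s" by (simp add: sum_lessThan_telescope ends)
    finally have T2: "(\<integral>w. (T w)\<^sup>2 \<partial>M) \<le> e ^ 3 / (4 * (t - s + 1)) * (t - s)"
      unfolding \<delta>(2) \<eta>_def .
    have TS: "T w = S n u w" if "w \<in> space M - A" for w
      unfolding T_def S_def g_def HK_def Y\<phi>[symmetric]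
      by (intro sum.cong refl arg_cong2[where f="(*)"] clamp_real_eq bd[OF that] ur) auto
    have "S n u \<in> borel_measurable M"
      unfolding S_def Y_def using ur W_measurable
      by (intro borel_measurable_sum borel_measurable_times borel_measurable_diff borel_measurable_inner HM) auto
    then show ?thesis
      using sums(1,2) \<open>0 < e\<close> \<open>s \<le> t\<close>
      by (intro prob_localized_bound[OF _ _ A TS _ T2]) (auto simp: T_def)
  qed
  with \<delta>(1) show "\<exists>\<delta>>0. \<forall>n u. fine_grid s t \<delta> n u \<longrightarrow> prob {w \<in> space M. e < \<bar>\<Sum>i<n. H (u (Suc i)) w *
    (((W (u (Suc i)) w - W (u i) w) \<bullet> b1) * ((W (u (Suc i)) w - W (u i) w) \<bullet> b2) -
      (if b1 = b2 then u (Suc i) - u i else 0))\<bar>} < e"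
    unfolding S_def Y_def by blast
qed

end

section \<open>Pathwise limits of Riemann sums\<close>

lemma continuous_on_Icc_bounded:
  fixes f :: "real \<Rightarrow> 'b::real_normed_vector"
  assumes "continuous_on {s..t} f"
  obtains B where "0 \<le> B" "\<And>r. r \<in> {s..t} \<Longrightarrow> norm (f r) \<le> B"
proof -
  have "bounded (f ` {s..t})"
    using assms by (intro compact_imp_bounded compact_continuous_image) auto
  then obtain B where "\<forall>r\<in>{s..t}. norm (f r) \<le> B" by (auto simp: bounded_iff)
  then show thesis by (intro that[of "max 0 B"]) (auto intro: max.coboundedI2)
qed

lemma fine_grid_sum_increments:
  assumes "fine_grid s t \<delta> n u"
  shows "(\<Sum>i<n. u (Suc i) - u i) = t - s"
  using assms by (simp add: sum_lessThan_telescope fine_grid_def)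

lemma fine_grids_sum_increments:
  assumes "fine_grids s t n u"
  shows "(\<Sum>i<n k. u k (Suc i) - u k i) = t - s"
  using assms fine_grid_sum_increments unfolding fine_grids_def by blast

lemma fine_grid_integral_sum:
  fixes f :: "real \<Rightarrow> 'b::banach"
  assumes g: "fine_grid s t \<delta> n u" and f: "continuous_on {s..t} f"
  shows "integral {s..t} f = (\<Sum>i<n. integral {u i..u (Suc i)} f)"
proof -
  have "integral {s..u m} f = (\<Sum>i<m. integral {u i..u (Suc i)} f)" if "m \<le> n" for m
    using that
  proof (induction m)
    case 0
    then show ?case using g by (simp add: fine_grid_def)
  next
    case (Suc m)
    have r: "s \<le> u m" "u m \<le> u (Suc m)" "u (Suc m) \<le> t"
      using fine_grid_range[OF g, of m] fine_grid_range[OF g, of "Suc m"] fine_grid_mono[OF g, of m "Suc m"] Suc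
      by auto
    have "f integrable_on {s..u (Suc m)}"
      using r by (intro integrable_continuous_interval continuous_on_subset[OF f]) auto
    from Henstock_Kurzweil_Integration.integral_combine[OF r(1,2) this] Suc show ?case by simp
  qed
  from this[of n] g show ?thesis by (simp add: fine_grid_def)
qed

text \<open>The first two arguments of \<open>\<Phi>\<close> are frozen at the end points of each
  interval, the third is integrated. On a fine partition all three are close, and uniform continuity
  on the cube replaces them by the diagonal. This covers right-endpoint sums and sums in which a
  path is frozen at one end.\<close>

lemma fine_grids_riemann:
  fixes \<Phi> :: "real \<Rightarrow> real \<Rightarrow> real \<Rightarrow> 'b::banach"
  assumes g: "fine_grids s t n u"
    and cont: "continuous_on ({s..t} \<times> {s..t} \<times> {s..t}) (\<lambda>(x, y, q). \<Phi> x y q)"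
  shows "(\<lambda>k. \<Sum>i<n k. integral {u k i..u k (Suc i)} (\<Phi> (u k i) (u k (Suc i))))
    \<longlonglongrightarrow> integral {s..t} (\<lambda>q. \<Phi> q q q)"
proof (rule LIMSEQ_I)
  fix e :: real assume "0 < e"
  have st: "s \<le> t"
    using fine_grids_ranges[OF g, of 0] by fastforce
  define e' where "e' = e / (2 * (t - s + 1))"
  have e': "0 < e'" using \<open>0 < e\<close> st by (simp add: e'_def)
  have "uniformly_continuous_on ({s..t} \<times> {s..t} \<times> {s..t}) (\<lambda>(x, y, q). \<Phi> x y q)"
    using cont by (intro compact_uniformly_continuous compact_Times) auto
  with e' obtain \<delta> where \<delta>: "0 < \<delta>" and uc: "\<And>z z'. z \<in> {s..t} \<times> {s..t} \<times> {s..t} \<Longrightarrow>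
    z' \<in> {s..t} \<times> {s..t} \<times> {s..t} \<Longrightarrow> dist z' z < \<delta> \<Longrightarrow>
    dist ((\<lambda>(x, y, q). \<Phi> x y q) z') ((\<lambda>(x, y, q). \<Phi> x y q) z) < e'"
    unfolding uniformly_continuous_on_def by meson
  have contD: "continuous_on {s..t} (\<lambda>q. \<Phi> q q q)"
    using continuous_on_compose2[OF cont, of "{s..t}" "\<lambda>q. (q, q, q)"] by (fastforce intro: continuous_intros)
  have "0 < \<delta> / 2" using \<delta> by simp
  from fine_grids_eventually[OF g this] obtain N where
    N: "\<And>k. N \<le> k \<Longrightarrow> fine_grid s t (\<delta> / 2) (n k) (u k)" by (auto simp: eventually_sequentially)
  have "norm ((\<Sum>i<n k. integral {u k i..u k (Suc i)} (\<Phi> (u k i) (u k (Suc i)))) -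
      integral {s..t} (\<lambda>q. \<Phi> q q q)) < e" if "N \<le> k" for k
  proof -
    let ?u = "u k"
    note gk = N[OF that]
    have "norm ((\<Sum>i<n k. integral {?u i..?u (Suc i)} (\<Phi> (?u i) (?u (Suc i)))) -
      integral {s..t} (\<lambda>q. \<Phi> q q q)) =
      norm (\<Sum>i<n k. integral {?u i..?u (Suc i)} (\<Phi> (?u i) (?u (Suc i))) -
        integral {?u i..?u (Suc i)} (\<lambda>q. \<Phi> q q q))"
      unfolding fine_grid_integral_sum[OF gk contD] sum_subtractf ..
    also have "\<dots> \<le> (\<Sum>i<n k. e' * (?u (Suc i) - ?u i))"
    proof (rule sum_norm_le)
      fix i assume "i \<in> {..<n k}"
      then have i: "i < n k" by simp
      have r: "s \<le> ?u i" "?u i \<le> ?u (Suc i)" "?u (Suc i) \<le> t" "?u (Suc i) - ?u i < \<delta> / 2"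
        using fine_grid_range[OF gk, of i] fine_grid_range[OF gk, of "Suc i"] gk i
        by (auto simp: fine_grid_def)
      let ?I = "{?u i..?u (Suc i)}"
      have c1: "continuous_on ?I (\<Phi> (?u i) (?u (Suc i)))"
        using continuous_on_compose2[OF cont, of ?I "\<lambda>q. (?u i, ?u (Suc i), q)"] r
        by (fastforce intro: continuous_intros)
      have c2: "continuous_on ?I (\<lambda>q. \<Phi> q q q)"
        using r by (intro continuous_on_subset[OF contD]) auto
      have "norm (integral ?I (\<lambda>q. \<Phi> (?u i) (?u (Suc i)) q - \<Phi> q q q)) \<le> e' * (?u (Suc i) - ?u i)"
      proof (rule integral_bound[OF r(2)])
        show "continuous_on ?I (\<lambda>q. \<Phi> (?u i) (?u (Suc i)) q - \<Phi> q q q)"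
          by (intro continuous_on_diff c1 c2)
        fix q assume q: "q \<in> ?I"
        have "dist (?u i, ?u (Suc i), q) (q, q, q) \<le> dist (?u i) q + dist (?u (Suc i)) q"
          by (simp add: dist_Pair_Pair sqrt_sum_squares_le_sum)
        also have "\<dots> < \<delta>" using q r(4) by (simp add: dist_real_def)
        finally show "norm (\<Phi> (?u i) (?u (Suc i)) q - \<Phi> q q q) \<le> e'"
          using uc[of "(q, q, q)" "(?u i, ?u (Suc i), q)"] q r by (auto simp: dist_norm)
      qed
      then show "norm (integral ?I (\<Phi> (?u i) (?u (Suc i))) - integral ?I (\<lambda>q. \<Phi> q q q))
        \<le> e' * (?u (Suc i) - ?u i)"
        by (subst (asm) Henstock_Kurzweil_Integration.integral_diff)
          (auto intro!: integrable_continuous_interval c1 c2)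
    qed
    also have "\<dots> = e' * (t - s)"
      unfolding sum_distrib_left[symmetric] fine_grid_sum_increments[OF gk] ..
    also have "\<dots> < e" using \<open>0 < e\<close> st unfolding e'_def
      by (simp add: field_simps) (smt (verit) mult_nonneg_nonneg mult_left_mono)
    finally show ?thesis .
  qed
  then show "\<exists>N. \<forall>k\<ge>N. norm ((\<Sum>i<n k. integral {u k i..u k (Suc i)} (\<Phi> (u k i) (u k (Suc i)))) -
      integral {s..t} (\<lambda>q. \<Phi> q q q)) < e" by blast
qed

lemma fine_grids_riemann_right:
  fixes \<phi> :: "real \<Rightarrow> 'b::banach"
  assumes g: "fine_grids s t n u" and cont: "continuous_on {s..t} \<phi>"
  shows "(\<lambda>k. \<Sum>i<n k. (u k (Suc i) - u k i) *\<^sub>R \<phi> (u k (Suc i))) \<longlonglongrightarrow> integral {s..t} \<phi>"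
proof -
  have "continuous_on ({s..t} \<times> {s..t} \<times> {s..t}) (\<lambda>(x, y, q). \<phi> y)"
    using continuous_on_compose2[OF cont, of "{s..t} \<times> {s..t} \<times> {s..t}" "\<lambda>z. fst (snd z)"]
    by (fastforce simp: case_prod_beta intro: continuous_intros)
  from fine_grids_riemann[OF g this] fine_grids_le[OF g] show ?thesis by (simp cong: sum.cong_simp)
qed

lemma fine_grids_increments_small:
  fixes X :: "real \<Rightarrow> 'b::real_normed_vector"
  assumes g: "fine_grids s t n u" and cont: "continuous_on {s..t} X" and "0 < e"
  shows "\<forall>\<^sub>F k in sequentially. \<forall>i<n k. norm (X (u k (Suc i)) - X (u k i)) < e"
proof -
  have "uniformly_continuous_on {s..t} X" using cont by (rule compact_uniformly_continuous) simp
  with \<open>0 < e\<close> obtain \<delta> where \<delta>: "0 < \<delta>" "\<And>r v. r \<in> {s..t} \<Longrightarrow> v \<in> {s..t} \<Longrightarrow> dist v r < \<delta> \<Longrightarrow> dist (X v) (X r) < e"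
    unfolding uniformly_continuous_on_def by meson
  from fine_grids_eventually[OF g \<delta>(1)] show ?thesis
  proof eventually_elim
    case (elim k)
    show ?case
    proof (intro allI impI)
      fix i assume i: "i < n k"
      then have "dist (u k (Suc i)) (u k i) < \<delta>" using elim by (auto simp: fine_grid_def dist_real_def)
      then show "norm (X (u k (Suc i)) - X (u k i)) < e"
        using \<delta>(2)[of "u k i" "u k (Suc i)"] fine_grid_range[OF elim] i by (auto simp: dist_norm)
    qed
  qed
qed

text \<open>Path increments are uniformly small and time increments sum to \<open>t - s\<close>.
  This disposes of every remainder that has one time increment and one path increment as
  factors.\<close>

lemma fine_grids_sum_increments_null:
  fixes X :: "real \<Rightarrow> 'b::real_normed_vector"
  assumes g: "fine_grids s t n u" and cont: "continuous_on {s..t} X"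
  shows "(\<lambda>k. \<Sum>i<n k. (u k (Suc i) - u k i) * norm (X (u k (Suc i)) - X (u k i))) \<longlonglongrightarrow> 0"
proof (rule LIMSEQ_I)
  fix e :: real assume "0 < e"
  have st: "s \<le> t" using fine_grids_ranges[OF g, of 0] by fastforce
  define e' where "e' = e / (2 * (t - s + 1))"
  have "0 < e'" using st \<open>0 < e\<close> by (simp add: e'_def)
  from fine_grids_increments_small[OF g cont \<open>0 < e'\<close>] obtain N where
    N: "\<And>k i. N \<le> k \<Longrightarrow> i < n k \<Longrightarrow> norm (X (u k (Suc i)) - X (u k i)) < e'"
    by (auto simp: eventually_sequentially)
  have "norm ((\<Sum>i<n k. (u k (Suc i) - u k i) * norm (X (u k (Suc i)) - X (u k i))) - 0) < e"
    if k: "N \<le> k" for k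
  proof -
    have "norm (\<Sum>i<n k. (u k (Suc i) - u k i) * norm (X (u k (Suc i)) - X (u k i)))
      \<le> (\<Sum>i<n k. (u k (Suc i) - u k i) * e')"
    proof (rule sum_norm_le)
      fix i assume "i \<in> {..<n k}"
      then have "u k i \<le> u k (Suc i)" "norm (X (u k (Suc i)) - X (u k i)) \<le> e'"
        using fine_grids_le[OF g] N[OF k, THEN less_imp_le] by auto
      then show "norm ((u k (Suc i) - u k i) * norm (X (u k (Suc i)) - X (u k i))) \<le> (u k (Suc i) - u k i) * e'"
        by (simp add: abs_mult mult_left_mono)
    qed
    also have "\<dots> = (t - s) * e'"
      unfolding sum_distrib_right[symmetric] fine_grids_sum_increments[OF g] ..
    also have "\<dots> < e" using \<open>0 < e\<close> st
      by (simp add: e'_def field_simps) (smt (verit) mult_nonneg_nonneg mult_left_mono)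
    finally show ?thesis by simp
  qed
  then show "\<exists>N. \<forall>k\<ge>N. norm ((\<Sum>i<n k. (u k (Suc i) - u k i) * norm (X (u k (Suc i)) - X (u k i))) - 0) < e"
    by blast
qed

text \<open>Summation by parts moves the difference onto \<open>d\<close>: what remains is
  \<open>(d (u (Suc i)) - d (u i)) *\<^sub>R W (u i)\<close>, the integral of \<open>d'\<close>
  times \<open>W\<close> frozen at the left end. Differentiability of \<open>d\<close> thus makes up
  for the roughness of \<open>W\<close>.\<close>

lemma fine_grids_integration_by_parts:
  fixes W :: "real \<Rightarrow> 'b::banach" and d d' :: "real \<Rightarrow> real"
  assumes g: "fine_grids s t n u" and W: "continuous_on {s..t} W"
    and d: "\<And>r. r \<in> {s..t} \<Longrightarrow> (d has_real_derivative d' r) (at r within {s..t})"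
    and d': "continuous_on {s..t} d'"
  shows "(\<lambda>k. \<Sum>i<n k. d (u k (Suc i)) *\<^sub>R (W (u k (Suc i)) - W (u k i)))
    \<longlonglongrightarrow> d t *\<^sub>R W t - d s *\<^sub>R W s - integral {s..t} (\<lambda>q. d' q *\<^sub>R W q)"
proof -
  have "continuous_on ({s..t} \<times> {s..t} \<times> {s..t}) (\<lambda>z. d' (snd (snd z)) *\<^sub>R W (fst z))"
    by (intro continuous_on_scaleR continuous_on_compose2[OF d'] continuous_on_compose2[OF W] continuous_intros) auto
  then have "continuous_on ({s..t} \<times> {s..t} \<times> {s..t}) (\<lambda>(x, y, q). d' q *\<^sub>R W x)"
    by (simp add: case_prod_beta)
  from fine_grids_riemann[OF g this]
  have lim: "(\<lambda>k. \<Sum>i<n k. integral {u k i..u k (Suc i)} (\<lambda>q. d' q *\<^sub>R W (u k i)))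
    \<longlonglongrightarrow> integral {s..t} (\<lambda>q. d' q *\<^sub>R W q)" .
  have "(\<Sum>i<n k. d (u k (Suc i)) *\<^sub>R (W (u k (Suc i)) - W (u k i))) =
    d t *\<^sub>R W t - d s *\<^sub>R W s - (\<Sum>i<n k. integral {u k i..u k (Suc i)} (\<lambda>q. d' q *\<^sub>R W (u k i)))" for k
  proof -
    have int: "integral {u k i..u k (Suc i)} (\<lambda>q. d' q *\<^sub>R W (u k i)) = (d (u k (Suc i)) - d (u k i)) *\<^sub>R W (u k i)"
      if "i < n k" for i
    proof -
      have sub: "{u k i..u k (Suc i)} \<subseteq> {s..t}"
        using fine_grids_ranges[OF g, of i k] fine_grids_ranges[OF g, of "Suc i" k] that by auto
      have "(d' has_integral d (u k (Suc i)) - d (u k i)) {u k i..u k (Suc i)}"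
      proof (rule fundamental_theorem_of_calculus[OF fine_grids_le[OF g that]])
        fix r assume r: "r \<in> {u k i..u k (Suc i)}"
        with sub have "r \<in> {s..t}" by blast
        from d[OF this] sub show "(d has_vector_derivative d' r) (at r within {u k i..u k (Suc i)})"
          unfolding has_real_derivative_iff_has_vector_derivative
          by (rule has_vector_derivative_within_subset)
      qed
      from has_integral_scaleR_left[OF this, of "W (u k i)"] show ?thesis by (rule integral_unique)
    qed
    have "(\<Sum>i<n k. d (u k (Suc i)) *\<^sub>R (W (u k (Suc i)) - W (u k i))) =
      (\<Sum>i<n k. d (u k (Suc i)) *\<^sub>R W (u k (Suc i)) - d (u k i) *\<^sub>R W (u k i)) -
      (\<Sum>i<n k. (d (u k (Suc i)) - d (u k i)) *\<^sub>R W (u k i))"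
      unfolding sum_subtractf[symmetric] by (intro sum.cong) (simp_all add: algebra_simps)
    also have "(\<Sum>i<n k. d (u k (Suc i)) *\<^sub>R W (u k (Suc i)) - d (u k i) *\<^sub>R W (u k i)) = d t *\<^sub>R W t - d s *\<^sub>R W s"
      using g by (subst sum_lessThan_telescope[of "\<lambda>i. d (u k i) *\<^sub>R W (u k i)"]) (auto simp: fine_grids_def fine_grid_def)
    finally show ?thesis using int by simp
  qed
  then show ?thesis using tendsto_diff[OF tendsto_const lim] by simp
qed

text \<open>Convexity keeps segments inside \<open>K\<close>, and uniform continuity of
  \<open>D\<close> bounds the variation of the derivative along short segments. The derivative is
  taken at the later point \<open>z v\<close>, because only weights at right end points are adapted
  to the decreasing filtration.\<close>

lemma C1_uniform_linearization:
  fixes H :: "'c::euclidean_space \<Rightarrow> 'b::real_normed_vector" and z :: "real \<Rightarrow> 'c"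
  assumes K: "compact K" "convex K" "z ` {s..t} \<subseteq> K"
    and H: "\<And>y. y \<in> K \<Longrightarrow> (H has_derivative blinfun_apply (D y)) (at y within K)"
    and D: "continuous_on K D" and z: "continuous_on {s..t} z" and "0 < e"
  obtains \<delta> where "0 < \<delta>" "\<And>r v. r \<in> {s..t} \<Longrightarrow> v \<in> {s..t} \<Longrightarrow> \<bar>v - r\<bar> < \<delta> \<Longrightarrow>
    norm (H (z v) - H (z r) - D (z v) (z v - z r)) \<le> e * norm (z v - z r)"
proof -
  have "uniformly_continuous_on K D" using D K(1) by (rule compact_uniformly_continuous)
  with \<open>0 < e\<close> obtain \<eta> where \<eta>: "0 < \<eta>" "\<And>x y. x \<in> K \<Longrightarrow> y \<in> K \<Longrightarrow> dist y x < \<eta> \<Longrightarrow> dist (D y) (D x) < e"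
    unfolding uniformly_continuous_on_def by meson
  have "uniformly_continuous_on {s..t} z" using z by (rule compact_uniformly_continuous) simp
  with \<eta>(1) obtain \<delta> where \<delta>: "0 < \<delta>" "\<And>r v. r \<in> {s..t} \<Longrightarrow> v \<in> {s..t} \<Longrightarrow> dist v r < \<delta> \<Longrightarrow> dist (z v) (z r) < \<eta>"
    unfolding uniformly_continuous_on_def by meson
  show thesis
  proof (rule that[OF \<delta>(1)])
    fix r v assume rv: "r \<in> {s..t}" "v \<in> {s..t}" "\<bar>v - r\<bar> < \<delta>"
    let ?S = "closed_segment (z r) (z v)"
    have SK: "?S \<subseteq> K" using K rv by (intro closed_segment_subset) auto
    have "norm (H (z v) - H (z r) - D (z v) (z v - z r)) \<le> norm (z v - z r) * e"
    proof (rule differentiable_bound_linearization[where S="?S" and f'="\<lambda>y. blinfun_apply (D y)"])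
      show "z r + l *\<^sub>R (z v - z r) \<in> ?S" if "l \<in> {0..1}" for l
        using that by (auto simp: in_segment algebra_simps intro!: exI[of _ l])
      show "(H has_derivative blinfun_apply (D y)) (at y within ?S)" if "y \<in> ?S" for y
        using H SK that by (blast intro: has_derivative_subset)
      show "onorm (blinfun_apply (D y) - blinfun_apply (D (z v))) \<le> e" if "y \<in> ?S" for y
      proof -
        have "dist y (z v) \<le> dist (z r) (z v)" using that by (simp add: dist_commute dist_in_closed_segment)
        also have "\<dots> < \<eta>" using \<delta>(2)[of v r] rv by (simp add: dist_real_def abs_minus_commute)
        finally have "dist (D y) (D (z v)) < e" using \<eta>(2) SK that rv K by blast
        moreover have "blinfun_apply (D y) - blinfun_apply (D (z v)) = blinfun_apply (D y - D (z v))"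
          by (auto simp: blinfun.diff_left)
        ultimately show ?thesis by (simp add: dist_norm norm_blinfun.rep_eq)
      qed
      show "z v \<in> ?S" by simp
    qed
    then show "norm (H (z v) - H (z r) - D (z v) (z v - z r)) \<le> e * norm (z v - z r)"
      by (simp add: mult.commute)
  qed
qed

text \<open>The path form of \<open>dX = \<alpha> dr + d dW\<close>: for \<open>C\<^sup>1\<close> coefficients \<open>d\<close>, integration by parts
  removes the stochastic integral.\<close>

definition sde_path ::
  "real \<Rightarrow> real \<Rightarrow> (real \<Rightarrow> 'a::euclidean_space) \<Rightarrow> (real \<Rightarrow> real) \<Rightarrow> (real \<Rightarrow> real) \<Rightarrow>
   (real \<Rightarrow> 'a) \<Rightarrow> (real \<Rightarrow> 'a) \<Rightarrow> bool" where
  "sde_path s t \<alpha> d d' X W \<longleftrightarrow>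
    continuous_on {s..t} X \<and> continuous_on {s..t} W \<and> continuous_on {s..t} \<alpha> \<and>
    (\<forall>r v. s \<le> r \<longrightarrow> r \<le> v \<longrightarrow> v \<le> t \<longrightarrow>
      X v - X r = integral {r..v} (\<lambda>q. \<alpha> q + d' q *\<^sub>R (W r - W q)) + d v *\<^sub>R (W v - W r))"

text \<open>With \<open>d\<close> evaluated at the later time, the remainder is the integral of
  \<open>\<alpha> q + d' q *\<^sub>R (W r - W q)\<close>, whose integrand is bounded along a
  continuous path.\<close>

lemma sde_path_remainder:
  assumes p: "sde_path s t \<alpha> d d' X W" and d': "continuous_on {s..t} d'"
  obtains K where "0 \<le> K"
    "\<And>r v. s \<le> r \<Longrightarrow> r \<le> v \<Longrightarrow> v \<le> t \<Longrightarrow> norm (X v - X r - d v *\<^sub>R (W v - W r)) \<le> K * (v - r)"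
proof -
  from p have \<alpha>: "continuous_on {s..t} \<alpha>" and W: "continuous_on {s..t} W" by (auto simp: sde_path_def)
  obtain A where A: "0 \<le> A" "\<And>r. r \<in> {s..t} \<Longrightarrow> norm (\<alpha> r) \<le> A"
    using continuous_on_Icc_bounded[OF \<alpha>] by blast
  obtain B where B: "0 \<le> B" "\<And>r. r \<in> {s..t} \<Longrightarrow> norm (W r) \<le> B"
    using continuous_on_Icc_bounded[OF W] by blast
  obtain C where C: "0 \<le> C" "\<And>r. r \<in> {s..t} \<Longrightarrow> norm (d' r) \<le> C"
    using continuous_on_Icc_bounded[OF d'] by blast
  show thesis
  proof (rule that[of "A + C * (B + B)"])
    show "0 \<le> A + C * (B + B)" using A(1) B(1) C(1) by simp
    fix r v assume rv: "s \<le> r" "r \<le> v" "v \<le> t"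
    have "X v - X r - d v *\<^sub>R (W v - W r) = integral {r..v} (\<lambda>q. \<alpha> q + d' q *\<^sub>R (W r - W q))"
      using p rv by (simp add: sde_path_def)
    also have "norm \<dots> \<le> (A + C * (B + B)) * (v - r)"
    proof (rule integral_bound[OF rv(2)])
      show "continuous_on {r..v} (\<lambda>q. \<alpha> q + d' q *\<^sub>R (W r - W q))"
        using rv by (intro continuous_intros continuous_on_subset[OF \<alpha>] continuous_on_subset[OF W]
          continuous_on_subset[OF d']) auto
      fix q assume "q \<in> {r..v}"
      then have q: "q \<in> {s..t}" "r \<in> {s..t}" using rv by auto
      have "norm (d' q *\<^sub>R (W r - W q)) \<le> C * (B + B)"
        unfolding norm_scaleR real_norm_def[symmetric]
        using C B(2)[OF q(1)] B(2)[OF q(2)] q norm_triangle_ineq4[of "W r" "W q"]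
        by (intro mult_mono) auto
      with A(2)[OF q(1)] show "norm (\<alpha> q + d' q *\<^sub>R (W r - W q)) \<le> A + C * (B + B)"
        by (intro norm_triangle_le) simp
    qed
    finally show "norm (X v - X r - d v *\<^sub>R (W v - W r)) \<le> (A + C * (B + B)) * (v - r)" .
  qed
qed

text \<open>The summands are integrals of
  \<open>h y \<bullet> (\<alpha> q + d' q *\<^sub>R (W x - W q))\<close> with \<open>x\<close> and
  \<open>y\<close> at the end points. On the diagonal the \<open>W\<close> terms cancel and only the
  drift survives.\<close>

lemma sde_path_drift_sum:
  assumes p: "sde_path s t \<alpha> d d' X W" and d': "continuous_on {s..t} d'"
    and h: "continuous_on {s..t} h" and g: "fine_grids s t n u"
  shows "(\<lambda>k. \<Sum>i<n k. h (u k (Suc i)) \<bullet>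
      (X (u k (Suc i)) - X (u k i) - d (u k (Suc i)) *\<^sub>R (W (u k (Suc i)) - W (u k i))))
    \<longlonglongrightarrow> integral {s..t} (\<lambda>q. h q \<bullet> \<alpha> q)"
proof -
  from p have \<alpha>: "continuous_on {s..t} \<alpha>" and W: "continuous_on {s..t} W" by (auto simp: sde_path_def)
  let ?\<Phi> = "\<lambda>x y q. h y \<bullet> (\<alpha> q + d' q *\<^sub>R (W x - W q))"
  have "continuous_on ({s..t} \<times> {s..t} \<times> {s..t})
    (\<lambda>z. h (fst (snd z)) \<bullet> (\<alpha> (snd (snd z)) + d' (snd (snd z)) *\<^sub>R (W (fst z) - W (snd (snd z)))))"
    by (intro continuous_on_inner continuous_on_add continuous_on_scaleR continuous_on_diff
      continuous_on_compose2[OF d'] continuous_on_compose2[OF W] continuous_on_compose2[OF h]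
      continuous_on_compose2[OF \<alpha>] continuous_intros) auto
  then have "continuous_on ({s..t} \<times> {s..t} \<times> {s..t}) (\<lambda>(x, y, q). ?\<Phi> x y q)"
    by (simp add: case_prod_beta)
  from fine_grids_riemann[OF g this]
  have lim: "(\<lambda>k. \<Sum>i<n k. integral {u k i..u k (Suc i)} (?\<Phi> (u k i) (u k (Suc i))))
    \<longlonglongrightarrow> integral {s..t} (\<lambda>q. h q \<bullet> \<alpha> q)" by simp
  have "integral {u k i..u k (Suc i)} (?\<Phi> (u k i) (u k (Suc i))) = h (u k (Suc i)) \<bullet>
      (X (u k (Suc i)) - X (u k i) - d (u k (Suc i)) *\<^sub>R (W (u k (Suc i)) - W (u k i)))"
    if i: "i < n k" for k i
  proof -
    have r: "s \<le> u k i" "u k i \<le> u k (Suc i)" "u k (Suc i) \<le> t"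
      using fine_grids_ranges[OF g, of i k] fine_grids_ranges[OF g, of "Suc i" k] fine_grids_le[OF g i] i by auto
    have "continuous_on {u k i..u k (Suc i)} (\<lambda>q. \<alpha> q + d' q *\<^sub>R (W (u k i) - W q))"
      using r by (intro continuous_intros continuous_on_subset[OF \<alpha>] continuous_on_subset[OF W]
          continuous_on_subset[OF d']) auto
    then have int: "(\<lambda>q. \<alpha> q + d' q *\<^sub>R (W (u k i) - W q)) integrable_on {u k i..u k (Suc i)}"
      by (rule integrable_continuous_interval)
    have "X (u k (Suc i)) - X (u k i) - d (u k (Suc i)) *\<^sub>R (W (u k (Suc i)) - W (u k i)) =
      integral {u k i..u k (Suc i)} (\<lambda>q. \<alpha> q + d' q *\<^sub>R (W (u k i) - W q))"
      using p r by (simp add: sde_path_def)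
    then show ?thesis
      using integral_linear[OF int bounded_linear_inner_right[of "h (u k (Suc i))"]]
      by (simp add: comp_def)
  qed
  with lim show ?thesis by simp
qed

text \<open>A statement about one path; all probability sits in \<open>qv\<close> and
  \<open>qv1\<close>. Linearizing \<open>H\<close> at the right end point and replacing the
  increment of \<open>X\<close> by that of \<open>d\<close> times \<open>W\<close> leaves weighted
  products of increments of \<open>W\<close>. Their limit is supplied by \<open>qv\<close>, while
  \<open>qv1\<close> keeps the sums of squared increments bounded so that the replacement errors
  vanish.\<close>

lemma sde_path_quadratic_covariation:
  fixes X W \<alpha> :: "real \<Rightarrow> 'a::euclidean_space" and H :: "real \<times> 'a \<Rightarrow> 'a"
    and D :: "real \<times> 'a \<Rightarrow> (real \<times> 'a) \<Rightarrow>\<^sub>L 'a"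
  assumes p: "sde_path s t \<alpha> d d' X W" and d': "continuous_on {s..t} d'" and d: "continuous_on {s..t} d"
    and g: "fine_grids s t n u"
    and H: "\<And>z. z \<in> {s..t} \<times> UNIV \<Longrightarrow> (H has_derivative blinfun_apply (D z)) (at z within {s..t} \<times> UNIV)"
    and D: "continuous_on ({s..t} \<times> UNIV) D"
    and qv: "\<And>b1 b2. b1 \<in> Basis \<Longrightarrow> b2 \<in> Basis \<Longrightarrow>
      (\<lambda>k. \<Sum>i<n k. (d (u k (Suc i)))\<^sup>2 * (D (u k (Suc i), X (u k (Suc i))) (0, b1) \<bullet> b2) *
        (((W (u k (Suc i)) - W (u k i)) \<bullet> b1) * ((W (u k (Suc i)) - W (u k i)) \<bullet> b2) -
          (if b1 = b2 then u k (Suc i) - u k i else 0))) \<longlonglongrightarrow> 0"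
    and qv1: "\<And>b. b \<in> Basis \<Longrightarrow>
      (\<lambda>k. \<Sum>i<n k. ((W (u k (Suc i)) - W (u k i)) \<bullet> b) * ((W (u k (Suc i)) - W (u k i)) \<bullet> b) -
          (u k (Suc i) - u k i)) \<longlonglongrightarrow> 0"
  shows "(\<lambda>k. \<Sum>i<n k. (H (u k (Suc i), X (u k (Suc i))) - H (u k i, X (u k i))) \<bullet> (X (u k (Suc i)) - X (u k i)))
    \<longlonglongrightarrow> integral {s..t} (\<lambda>r. (d r)\<^sup>2 * (\<Sum>b\<in>Basis. D (r, X r) (0, b) \<bullet> b))"
proof -
  from p have X: "continuous_on {s..t} X" and W: "continuous_on {s..t} W" by (auto simp: sde_path_def)
  have st: "s \<le> t" using fine_grids_ranges[OF g, of 0] by fastforce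
  define z where "z = (\<lambda>r. (r, X r))"
  define du where "du = (\<lambda>k i. u k (Suc i) - u k i)"
  define dX where "dX = (\<lambda>k i. X (u k (Suc i)) - X (u k i))"
  define dW where "dW = (\<lambda>k i. W (u k (Suc i)) - W (u k i))"
  define v where "v = (\<lambda>k i. u k (Suc i))"
  have z: "continuous_on {s..t} z" unfolding z_def by (intro continuous_intros X)
  have zS: "z r \<in> {s..t} \<times> UNIV" if "r \<in> {s..t}" for r using that by (simp add: z_def)
  have Dz: "continuous_on {s..t} (\<lambda>r. D (z r))"
    by (rule continuous_on_compose2[OF D z]) (auto simp: z_def)
  obtain C where C: "0 \<le> C" "\<And>r. r \<in> {s..t} \<Longrightarrow> norm (D (z r)) \<le> C"
    using continuous_on_Icc_bounded[OF Dz] by blast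
  obtain E where E: "0 \<le> E" "\<And>r. r \<in> {s..t} \<Longrightarrow> norm (d r) \<le> E"
    using continuous_on_Icc_bounded[OF d] by blast
  obtain K where K: "0 \<le> K" and R: "\<And>r v. s \<le> r \<Longrightarrow> r \<le> v \<Longrightarrow> v \<le> t \<Longrightarrow>
    norm (X v - X r - d v *\<^sub>R (W v - W r)) \<le> K * (v - r)"
    using sde_path_remainder[OF p d'] by blast
  obtain B where B: "\<And>r. r \<in> {s..t} \<Longrightarrow> norm (X r) \<le> B"
    using continuous_on_Icc_bounded[OF X] by blast
  have ur: "u k i \<in> {s..t}" "v k i \<in> {s..t}" "u k i \<le> v k i" "0 \<le> du k i" if "i < n k" for k i
    using fine_grids_ranges[OF g, of i k] fine_grids_ranges[OF g, of "Suc i" k] fine_grids_le[OF g that] that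
    by (auto simp: v_def du_def)
  have sum_du: "(\<Sum>i<n k. du k i) = t - s" for k
    unfolding du_def by (rule fine_grids_sum_increments[OF g])
  have nullX: "(\<lambda>k. \<Sum>i<n k. du k i * norm (dX k i)) \<longlonglongrightarrow> 0"
    unfolding du_def dX_def by (rule fine_grids_sum_increments_null[OF g X])
  have nullW: "(\<lambda>k. \<Sum>i<n k. du k i * norm (dW k i)) \<longlonglongrightarrow> 0"
    unfolding du_def dW_def by (rule fine_grids_sum_increments_null[OF g W])
  \<comment> \<open>Summing \<open>qv1\<close> over the coordinates shows that the squared norms of
    the increments of \<open>W\<close> have convergent, hence bounded, sums.\<close>
  have "(\<lambda>k. (\<Sum>b\<in>Basis. (\<Sum>i<n k. (dW k i \<bullet> b) * (dW k i \<bullet> b) - du k i) + (t - s)))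
    \<longlonglongrightarrow> (\<Sum>b\<in>(Basis::'a set). 0 + (t - s))"
    unfolding dW_def du_def by (intro tendsto_sum tendsto_add qv1 tendsto_const) auto
  moreover have "(\<Sum>b\<in>Basis. (\<Sum>i<n k. (dW k i \<bullet> b) * (dW k i \<bullet> b) - du k i) + (t - s)) =
    (\<Sum>i<n k. (norm (dW k i))\<^sup>2)" for k
  proof -
    have "(\<Sum>i<n k. (norm (dW k i))\<^sup>2) = (\<Sum>i<n k. \<Sum>b\<in>Basis. (dW k i \<bullet> b) * (dW k i \<bullet> b))"
      by (simp add: power2_norm_eq_inner euclidean_inner[symmetric])
    also have "\<dots> = (\<Sum>b\<in>Basis. \<Sum>i<n k. (dW k i \<bullet> b) * (dW k i \<bullet> b))" by (rule sum.swap)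
    finally show ?thesis by (simp add: sum_subtractf sum_du)
  qed
  ultimately have "convergent (\<lambda>k. \<Sum>i<n k. (norm (dW k i))\<^sup>2)" by (auto simp: convergent_def)
  from convergent_imp_Bseq[OF this] obtain BW where BW: "0 < BW" "\<And>k. (\<Sum>i<n k. (norm (dW k i))\<^sup>2) \<le> BW"
    by (auto simp: Bseq_def intro: order_trans[OF abs_ge_self])
  have dXb: "norm (dX k i - d (v k i) *\<^sub>R dW k i) \<le> K * du k i" if "i < n k" for k i
    unfolding dX_def dW_def du_def v_def using ur[OF that] by (intro R) (auto simp: v_def)
  \<comment> \<open>From \<open>norm (dX k i) \<le> E * norm (dW k i) + K * du k i\<close>, the
    inequality \<open>(x + y)\<^sup>2 \<le> 2 * x\<^sup>2 + 2 * y\<^sup>2\<close>, and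
    \<open>du k i \<le> t - s\<close> for one of the two time factors.\<close>
  define BX where "BX = 2 * E\<^sup>2 * BW + 2 * K\<^sup>2 * (t - s) * (t - s)"
  have BX: "(\<Sum>i<n k. (norm (dX k i))\<^sup>2) \<le> BX" for k
  proof -
    have "(\<Sum>i<n k. (norm (dX k i))\<^sup>2) \<le>
      (\<Sum>i<n k. 2 * E\<^sup>2 * (norm (dW k i))\<^sup>2 + 2 * K\<^sup>2 * (t - s) * du k i)"
    proof (rule sum_mono)
      fix i assume "i \<in> {..<n k}"
      then have i: "i < n k" by simp
      note uri = ur[OF i]
      have "norm (dX k i) \<le> norm (d (v k i) *\<^sub>R dW k i) + norm (dX k i - d (v k i) *\<^sub>R dW k i)"
        by (rule norm_triangle_sub)
      also have "\<dots> \<le> E * norm (dW k i) + K * du k i"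
        using E(2)[OF uri(2)] dXb[OF i] by (intro add_mono) (auto intro: mult_right_mono)
      finally have "(norm (dX k i))\<^sup>2 \<le> (E * norm (dW k i) + K * du k i)\<^sup>2" by (rule power_mono) simp
      also have "\<dots> \<le> 2 * (E * norm (dW k i))\<^sup>2 + 2 * (K * du k i)\<^sup>2"
        using sum_squares_bound[of "E * norm (dW k i)" "K * du k i"] by (simp add: power2_sum)
      also have "(K * du k i)\<^sup>2 \<le> K\<^sup>2 * (t - s) * du k i"
      proof -
        have "du k i \<le> t - s" using uri by (auto simp: du_def v_def)
        then have "du k i * du k i \<le> (t - s) * du k i" using uri(4) by (rule mult_right_mono)
        then have "K\<^sup>2 * (du k i * du k i) \<le> K\<^sup>2 * ((t - s) * du k i)" by (rule mult_left_mono) simp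
        then show ?thesis by (simp add: power2_eq_square mult_ac)
      qed
      finally show "(norm (dX k i))\<^sup>2 \<le> 2 * E\<^sup>2 * (norm (dW k i))\<^sup>2 + 2 * K\<^sup>2 * (t - s) * du k i"
        by (simp add: power_mult_distrib)
    qed
    also have "\<dots> = 2 * E\<^sup>2 * (\<Sum>i<n k. (norm (dW k i))\<^sup>2) + 2 * K\<^sup>2 * (t - s) * (t - s)"
      unfolding sum.distrib sum_distrib_left[symmetric] sum_du ..
    also have "\<dots> \<le> BX" unfolding BX_def using BW by (intro add_right_mono mult_left_mono) auto
    finally show ?thesis .
  qed
  have BX0: "0 \<le> BX" unfolding BX_def using BW st E by simp
  \<comment> \<open>The leading part of \<open>P\<close>: only the spatial derivative acts, and both
    increments are those of \<open>W\<close> scaled by \<open>d\<close>.\<close>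
  define Q where "Q = (\<lambda>k i. (d (v k i))\<^sup>2 * (D (z (v k i)) (0, dW k i) \<bullet> dW k i))"
  define P where "P = (\<lambda>k i. (H (z (v k i)) - H (z (u k i))) \<bullet> dX k i)"
  have diff: "(\<lambda>k. \<Sum>i<n k. P k i - Q k i) \<longlonglongrightarrow> 0"
  proof (rule LIMSEQ_I)
    fix e :: real assume "0 < e"
    define e' where "e' = e / (3 * (BX + 1))"
    have e': "0 < e'" using \<open>0 < e\<close> BX0 by (simp add: e'_def)
    \<comment> \<open>A compact convex set containing the space-time path; it depends on the path,
      not on the partition.\<close>
    let ?K = "{s..t} \<times> cball (0::'a) B"
    have "compact ?K" "convex ?K" by (auto intro!: compact_Times convex_Times)
    moreover have "z ` {s..t} \<subseteq> ?K" using B by (auto simp: z_def)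
    moreover have "(H has_derivative blinfun_apply (D y)) (at y within ?K)" if "y \<in> ?K" for y
      using H that by (blast intro: has_derivative_subset)
    moreover have "continuous_on ?K D" by (rule continuous_on_subset[OF D]) auto
    ultimately obtain \<delta> where \<delta>: "0 < \<delta>" "\<And>r v. r \<in> {s..t} \<Longrightarrow> v \<in> {s..t} \<Longrightarrow> \<bar>v - r\<bar> < \<delta> \<Longrightarrow>
      norm (H (z v) - H (z r) - D (z v) (z v - z r)) \<le> e' * norm (z v - z r)"
      using C1_uniform_linearization[OF _ _ _ _ _ z e', of ?K H D] by metis
    \<comment> \<open>The coefficients of the mixed sums of time increments with increments of
      \<open>X\<close> and of \<open>W\<close> in the estimate of \<open>P k i - Q k i\<close>. The
      remaining squares of increments of \<open>X\<close> carry the small factor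
      \<open>e'\<close>.\<close>
    define c1 c2 where "c1 = e' + C + C * K" and "c2 = C * E * K"
    have "(\<lambda>k. c1 * (\<Sum>i<n k. du k i * norm (dX k i))) \<longlonglongrightarrow> 0"
      "(\<lambda>k. c2 * (\<Sum>i<n k. du k i * norm (dW k i))) \<longlonglongrightarrow> 0"
      using tendsto_mult_left[OF nullX, of c1] tendsto_mult_left[OF nullW, of c2] by simp_all
    moreover have "0 < e / 3" using \<open>0 < e\<close> by simp
    ultimately have "\<forall>\<^sub>F k in sequentially. c1 * (\<Sum>i<n k. du k i * norm (dX k i)) < e / 3"
      "\<forall>\<^sub>F k in sequentially. c2 * (\<Sum>i<n k. du k i * norm (dW k i)) < e / 3"
      using order_tendstoD(2) by blast+
    moreover note fine_grids_eventually[OF g \<delta>(1)]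
    ultimately have "\<forall>\<^sub>F k in sequentially. norm ((\<Sum>i<n k. P k i - Q k i) - 0) < e"
    proof eventually_elim
      case (elim k)
      have "norm (\<Sum>i<n k. P k i - Q k i) \<le> (\<Sum>i<n k. e' * (norm (dX k i))\<^sup>2 +
        c1 * (du k i * norm (dX k i)) + c2 * (du k i * norm (dW k i)))"
      proof (rule sum_norm_le)
        fix i assume "i \<in> {..<n k}"
        then have i: "i < n k" by simp
        note uri = ur[OF i]
        let ?u = "du k i" and ?X = "dX k i" and ?W = "dW k i" and ?D = "blinfun_apply (D (z (v k i)))"
        let ?d = "d (v k i)"
        let ?R = "?X - ?d *\<^sub>R ?W"
        have zd: "z (v k i) - z (u k i) = (?u, ?X)" by (simp add: z_def v_def du_def dX_def)
        have X0: "(0, ?X) = (0::real, ?R) + (0, ?d *\<^sub>R ?W)" by simp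
        have sX: "(?u, ?X) = (?u, 0) + (0, ?X)" by simp
        have sW: "(0::real, ?d *\<^sub>R ?W) = ?d *\<^sub>R (0, ?W)" by simp
        have PQ1: "?D (?u, ?X) \<bullet> ?X = ?D (?u, 0) \<bullet> ?X + ?D (0, ?X) \<bullet> ?X"
          by (subst sX) (simp only: blinfun.add_right inner_add_left)
        have PQ2: "?D (0, ?X) \<bullet> ?X = ?D (0, ?R) \<bullet> ?X + ?D (0, ?d *\<^sub>R ?W) \<bullet> ?X"
          by (subst X0) (simp only: blinfun.add_right inner_add_left)
        have PQ3: "?D (0, ?d *\<^sub>R ?W) \<bullet> ?X = ?D (0, ?d *\<^sub>R ?W) \<bullet> ?R + Q k i"
          unfolding Q_def sW blinfun.scaleR_right by (simp add: inner_diff_right power2_eq_square)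
        \<comment> \<open>The four errors: linearization, time derivative, and replacement of the
          increment of \<open>X\<close> by \<open>?d *\<^sub>R ?W\<close> first in the argument of
          the derivative and then in the inner product.\<close>
        have PQ: "P k i - Q k i = (H (z (v k i)) - H (z (u k i)) - ?D (?u, ?X)) \<bullet> ?X +
          ?D (?u, 0) \<bullet> ?X + ?D (0, ?R) \<bullet> ?X + ?D (0, ?d *\<^sub>R ?W) \<bullet> ?R"
          unfolding P_def inner_diff_left using PQ1 PQ2 PQ3 by linarith
        have "norm (P k i - Q k i) \<le> norm ((H (z (v k i)) - H (z (u k i)) - ?D (?u, ?X)) \<bullet> ?X) +
          norm (?D (?u, 0) \<bullet> ?X) + norm (?D (0, ?R) \<bullet> ?X) + norm (?D (0, ?d *\<^sub>R ?W) \<bullet> ?R)"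
          unfolding PQ by (intro norm_triangle_mono order_refl)
        also have "\<dots> \<le> e' * (?u + norm ?X) * norm ?X + C * ?u * norm ?X +
          C * (K * ?u) * norm ?X + C * (E * norm ?W) * (K * ?u)"
        proof (intro add_mono)
          have CD: "norm (?D y) \<le> C * norm y" for y
            using norm_blinfun[of "D (z (v k i))" y] C(2)[OF uri(2)]
            by (meson mult_right_mono norm_ge_zero order_trans)
          have CS: "norm (x \<bullet> y) \<le> a * b" if "norm x \<le> a" "norm y \<le> b" for x y :: 'a and a b
            using Cauchy_Schwarz_ineq2[of x y] mult_mono[OF that] that
            by (metis norm_ge_zero order_trans real_norm_def)
          have "\<bar>v k i - u k i\<bar> < \<delta>" using elim(3) i by (simp add: fine_grid_def v_def)
          from \<delta>(2)[OF uri(1,2) this]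
          have "norm (H (z (v k i)) - H (z (u k i)) - ?D (?u, ?X)) \<le> e' * norm (?u, ?X)" unfolding zd .
          also have "\<dots> \<le> e' * (?u + norm ?X)"
            using e' uri(4) sqrt_sum_squares_le_sum[of ?u "norm ?X"]
            by (intro mult_left_mono) (auto simp: norm_Pair)
          finally show "norm ((H (z (v k i)) - H (z (u k i)) - ?D (?u, ?X)) \<bullet> ?X) \<le> e' * (?u + norm ?X) * norm ?X"
            by (rule CS) simp
          have "norm (?D (?u, 0)) \<le> C * ?u" using CD[of "(?u, 0)"] uri(4) by (simp add: norm_Pair)
          then show "norm (?D (?u, 0) \<bullet> ?X) \<le> C * ?u * norm ?X" by (rule CS) simp
          have "norm (?D (0, ?R)) \<le> C * norm ?R" using CD[of "(0, ?R)"] by (simp add: norm_Pair)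
          also have "\<dots> \<le> C * (K * ?u)" using dXb[OF i] C(1) by (rule mult_left_mono)
          finally show "norm (?D (0, ?R) \<bullet> ?X) \<le> C * (K * ?u) * norm ?X" by (rule CS) simp
          have "norm (?D (0, ?d *\<^sub>R ?W)) \<le> C * norm (?d *\<^sub>R ?W)" using CD[of "(0, ?d *\<^sub>R ?W)"] by (simp add: norm_Pair)
          also have "norm (?d *\<^sub>R ?W) \<le> E * norm ?W"
            using E(2)[OF uri(2)] by (auto intro: mult_right_mono)
          finally have "norm (?D (0, ?d *\<^sub>R ?W)) \<le> C * (E * norm ?W)" using C(1) by (simp add: mult_left_mono)
          then show "norm (?D (0, ?d *\<^sub>R ?W) \<bullet> ?R) \<le> C * (E * norm ?W) * (K * ?u)"
            using dXb[OF i] by (rule CS)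
        qed
        also have "\<dots> = e' * (norm ?X)\<^sup>2 + c1 * (?u * norm ?X) + c2 * (?u * norm ?W)"
          unfolding c1_def c2_def by (simp add: algebra_simps power2_eq_square)
        finally show "norm (P k i - Q k i) \<le> e' * (norm ?X)\<^sup>2 + c1 * (?u * norm ?X) + c2 * (?u * norm ?W)" .
      qed
      also have "\<dots> = e' * (\<Sum>i<n k. (norm (dX k i))\<^sup>2) + c1 * (\<Sum>i<n k. du k i * norm (dX k i)) +
        c2 * (\<Sum>i<n k. du k i * norm (dW k i))"
        unfolding sum.distrib sum_distrib_left[symmetric] ..
      also have "e' * (\<Sum>i<n k. (norm (dX k i))\<^sup>2) \<le> e' * BX" using e' BX by (intro mult_left_mono) auto
      also have "e' * BX \<le> e / 3" unfolding e'_def using BX0 \<open>0 < e\<close> by (simp add: field_simps)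
      finally show ?case using elim by simp
    qed
    then show "\<exists>N. \<forall>k\<ge>N. norm ((\<Sum>i<n k. P k i - Q k i) - 0) < e" by (simp add: eventually_sequentially)
  qed
  define \<kappa> where "\<kappa> = (\<lambda>b1 b2 r. (d r)\<^sup>2 * (D (z r) (0, b1) \<bullet> b2))"
  have \<kappa>c: "continuous_on {s..t} (\<kappa> b1 b2)" for b1 b2
    unfolding \<kappa>_def by (intro continuous_intros d Dz)
  \<comment> \<open>Each product of coordinate increments is split into fluctuation and mean.
    Fluctuations vanish by \<open>qv\<close>; the means live on the diagonal \<open>b1 = b2\<close>
    and form a right-endpoint Riemann sum, which is where the divergence comes from.\<close>
  have "(\<lambda>k. (\<Sum>b1\<in>Basis. \<Sum>b2\<in>Basis. \<Sum>i<n k. \<kappa> b1 b2 (v k i) *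
      ((dW k i \<bullet> b1) * (dW k i \<bullet> b2) - (if b1 = b2 then du k i else 0))) +
      (\<Sum>i<n k. du k i *\<^sub>R (\<Sum>b\<in>Basis. \<kappa> b b (v k i))))
    \<longlonglongrightarrow> (\<Sum>b1\<in>(Basis::'a set). \<Sum>b2\<in>(Basis::'a set). 0) + integral {s..t} (\<lambda>r. \<Sum>b\<in>Basis. \<kappa> b b r)"
    unfolding v_def du_def
    by (intro tendsto_add tendsto_sum fine_grids_riemann_right[OF g] continuous_on_sum \<kappa>c)
      (auto simp: \<kappa>_def z_def dW_def intro!: qv)
  moreover have "(\<Sum>b1\<in>Basis. \<Sum>b2\<in>Basis. \<Sum>i<n k. \<kappa> b1 b2 (v k i) *
      ((dW k i \<bullet> b1) * (dW k i \<bullet> b2) - (if b1 = b2 then du k i else 0))) +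
      (\<Sum>i<n k. du k i *\<^sub>R (\<Sum>b\<in>Basis. \<kappa> b b (v k i))) = (\<Sum>i<n k. Q k i)" for k
  proof -
    have Q: "Q k i = (\<Sum>b1\<in>Basis. \<Sum>b2\<in>Basis. \<kappa> b1 b2 (v k i) * ((dW k i \<bullet> b1) * (dW k i \<bullet> b2)))" for i
    proof -
      let ?D = "blinfun_apply (D (z (v k i)))"
      have "(0::real, dW k i) = (\<Sum>b\<in>Basis. (dW k i \<bullet> b) *\<^sub>R (0, b))"
        by (simp add: sum_prod euclidean_representation)
      then have "?D (0, dW k i) = (\<Sum>b\<in>Basis. (dW k i \<bullet> b) *\<^sub>R ?D (0, b))"
        by (simp only: blinfun.sum_right blinfun.scaleR_right)
      then have "?D (0, dW k i) \<bullet> dW k i =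
        (\<Sum>b1\<in>Basis. \<Sum>b2\<in>Basis. (dW k i \<bullet> b1) * (?D (0, b1) \<bullet> b2) * (dW k i \<bullet> b2))"
        by (simp add: inner_sum_left sum_distrib_left mult.assoc euclidean_inner[of "?D _" "dW k i"])
      then show ?thesis unfolding Q_def \<kappa>_def by (simp add: sum_distrib_left mult_ac)
    qed
    have "(\<Sum>i<n k. Q k i) = (\<Sum>b1\<in>Basis. \<Sum>b2\<in>Basis. \<Sum>i<n k. \<kappa> b1 b2 (v k i) * ((dW k i \<bullet> b1) * (dW k i \<bullet> b2)))"
      unfolding Q by (subst sum.swap) (intro sum.cong refl sum.swap)
    moreover have "(\<Sum>i<n k. du k i *\<^sub>R (\<Sum>b\<in>Basis. \<kappa> b b (v k i))) =
      (\<Sum>b1\<in>Basis. \<Sum>b2\<in>Basis. \<Sum>i<n k. \<kappa> b1 b2 (v k i) * (if b1 = b2 then du k i else 0))"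
    proof -
      have "(\<Sum>b2\<in>Basis. \<Sum>i<n k. \<kappa> b1 b2 (v k i) * (if b1 = b2 then du k i else 0)) =
        (\<Sum>i<n k. \<kappa> b1 b1 (v k i) * du k i)" if "b1 \<in> Basis" for b1
        using that by (subst sum.swap) (simp add: if_distrib[of "(*) _"] cong: if_cong)
      then have "(\<Sum>b1\<in>Basis. \<Sum>b2\<in>Basis. \<Sum>i<n k. \<kappa> b1 b2 (v k i) * (if b1 = b2 then du k i else 0)) =
        (\<Sum>b\<in>Basis. \<Sum>i<n k. \<kappa> b b (v k i) * du k i)" by simp
      also have "\<dots> = (\<Sum>i<n k. \<Sum>b\<in>Basis. \<kappa> b b (v k i) * du k i)" by (rule sum.swap)
      finally show ?thesis by (simp add: sum_distrib_left mult_ac)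
    qed
    ultimately show ?thesis
      by (simp add: right_diff_distrib sum_subtractf)
  qed
  ultimately have "(\<lambda>k. \<Sum>i<n k. Q k i) \<longlonglongrightarrow> integral {s..t} (\<lambda>r. \<Sum>b\<in>Basis. \<kappa> b b r)" by simp
  from tendsto_add[OF diff this] show ?thesis
    by (simp add: sum_subtractf P_def \<kappa>_def z_def v_def dX_def sum_distrib_left)
qed

section \<open>Integrals along backward diffusions\<close>

context prob_space begin

text \<open>Extracting successively over a finite family gives one subsequence and one null set for
  all members, so that pathwise arguments may use all limits at once.\<close>

lemma grid_null_common_subseq:
  assumes "finite A" and null: "\<And>a. a \<in> A \<Longrightarrow> grid_null s t (D a)"
    and meas: "\<And>a n u \<delta>. a \<in> A \<Longrightarrow> fine_grid s t \<delta> n u \<Longrightarrow> D a n u \<in> borel_measurable M"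
    and g: "fine_grids s t n u"
  obtains r where "strict_mono r" "AE w in M. \<forall>a\<in>A. (\<lambda>k. D a (n (r k)) (u (r k)) w) \<longlonglongrightarrow> 0"
proof -
  have "\<exists>r. strict_mono r \<and> (AE w in M. \<forall>a\<in>A. (\<lambda>k. D a (n (r k)) (u (r k)) w) \<longlonglongrightarrow> 0)"
    using assms(1) null meas
  proof (induction A rule: finite_induct)
    case empty
    then show ?case by (intro exI[of _ id]) (simp add: strict_mono_id)
  next
    case (insert a A)
    then obtain r1 where r1: "strict_mono r1"
      "AE w in M. \<forall>a\<in>A. (\<lambda>k. D a (n (r1 k)) (u (r1 k)) w) \<longlonglongrightarrow> 0" by blast
    note g1 = fine_grids_subseq[OF g r1(1)]
    have "D a ((n \<circ> r1) k) ((u \<circ> r1) k) \<in> borel_measurable M" for k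
      using g1 insert.prems(2)[of a] unfolding fine_grids_def by blast
    with insert.prems(1)[of a] obtain r2 where r2: "strict_mono r2"
      "AE w in M. (\<lambda>k. D a ((n \<circ> r1) (r2 k)) ((u \<circ> r1) (r2 k)) w) \<longlonglongrightarrow> 0"
      using grid_null_subseq[OF _ g1, of "D a"] by blast
    from r1(2) r2(2) have "AE w in M. \<forall>b\<in>insert a A. (\<lambda>k. D b (n ((r1 \<circ> r2) k)) (u ((r1 \<circ> r2) k)) w) \<longlonglongrightarrow> 0"
    proof eventually_elim
      case (elim w)
      have "(\<lambda>k. D b (n (r1 (r2 k))) (u (r1 (r2 k))) w) \<longlonglongrightarrow> 0" if "b \<in> A" for b
        using LIMSEQ_subseq_LIMSEQ[OF bspec[OF elim(1) that] r2(1)] by (simp add: comp_def)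
      with elim(2) show ?case by simp
    qed
    with strict_mono_o[OF r1(1) r2(1)] show ?case by blast
  qed
  with that show thesis by blast
qed

end

lemma continuous_on_path:
  assumes \<phi>: "continuous_on ({s..t} \<times> UNIV) \<phi>" and X: "continuous_on {s..t} X"
  shows "continuous_on {s..t} (\<lambda>r. \<phi> (r, X r))"
  by (rule continuous_on_compose2[OF \<phi>]) (auto intro!: continuous_intros X)

lemma continuous_on_slice:
  assumes "continuous_on (I \<times> UNIV) \<phi>" "r \<in> I"
  shows "continuous_on UNIV (\<lambda>x. \<phi> (r, x))"
  by (rule continuous_on_compose2[OF assms(1)]) (use assms(2) in \<open>auto intro!: continuous_intros\<close>)

lemma borel_measurable_slice:
  fixes \<phi> :: "'c::topological_space \<times> 'a::topological_space \<Rightarrow> 'b::topological_space"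
  assumes \<phi>: "continuous_on (I \<times> UNIV) \<phi>" "r \<in> I" and Y: "Y \<in> borel_measurable N"
  shows "(\<lambda>w. \<phi> (r, Y w)) \<in> borel_measurable N"
  using measurable_compose[OF Y borel_measurable_continuous_onI[OF continuous_on_slice[OF \<phi>]]] .

text \<open>The equation enters only in its path form \<open>sde_path\<close>, in which no
  stochastic integral is left. Adaptedness of \<open>X\<close> to \<open>G\<close> is what feeds
  weights along \<open>X\<close> into the isometry.\<close>

locale backward_diffusion = backward_brownian M G W s t
  for M :: "'w measure" and G :: "real \<Rightarrow> 'w measure" and W :: "real \<Rightarrow> 'w \<Rightarrow> 'a::euclidean_space"
    and s t :: real +
  fixes a :: "real \<Rightarrow> 'a \<Rightarrow> 'a" and d d' :: "real \<Rightarrow> real" and X :: "real \<Rightarrow> 'w \<Rightarrow> 'a"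
  assumes st: "s \<le> t"
    and X_adapted: "\<And>r. r \<in> {s..t} \<Longrightarrow> X r \<in> borel_measurable (G r)"
    and drift_continuous: "continuous_on ({s..t} \<times> UNIV) (\<lambda>(r, x). a r x)"
    and d_deriv: "\<And>r. r \<in> {s..t} \<Longrightarrow> (d has_real_derivative d' r) (at r within {s..t})"
    and d'_continuous: "continuous_on {s..t} d'"
    and paths: "AE w in M. sde_path s t (\<lambda>r. a r (X r w)) d d' (\<lambda>r. X r w) (\<lambda>r. W r w)"
begin

lemma X_measurable: "r \<in> {s..t} \<Longrightarrow> X r \<in> borel_measurable M"
  using X_adapted measurable_G by blast

lemma X_continuous: "AE w in M. continuous_on {s..t} (\<lambda>r. X r w)"
  using paths by eventually_elim (simp add: sde_path_def)

lemma d_continuous: "continuous_on {s..t} d"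
  unfolding continuous_on_eq_continuous_within using DERIV_continuous[OF d_deriv] by blast

abbreviation bwd_sum where
  "bwd_sum h n u w \<equiv> \<Sum>i<n. h (u (Suc i), X (u (Suc i)) w) \<bullet> (X (u (Suc i)) w - X (u i) w)"

abbreviation fwd_sum where
  "fwd_sum h n u w \<equiv> \<Sum>i<n. h (u i, X (u i) w) \<bullet> (X (u (Suc i)) w - X (u i) w)"

abbreviation cov_sum where
  "cov_sum h n u w \<equiv> \<Sum>i<n.
    (h (u (Suc i), X (u (Suc i)) w) - h (u i, X (u i) w)) \<bullet> (X (u (Suc i)) w - X (u i) w)"

abbreviation cov_integral where
  "cov_integral D w \<equiv> integral {s..t} (\<lambda>q. (d q)\<^sup>2 * (\<Sum>b\<in>Basis. blinfun_apply (D (q, X q w)) (0, b) \<bullet> b))"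

text \<open>\<open>M\<close> is not assumed complete, so the time integral itself need not be measurable.\<close>

lemma time_integral_measurable:
  fixes \<phi> :: "real \<times> 'a \<Rightarrow> real"
  assumes \<phi>: "continuous_on ({s..t} \<times> UNIV) \<phi>"
  obtains L where "L \<in> borel_measurable M" "AE w in M. L w = integral {s..t} (\<lambda>r. \<phi> (r, X r w))"
proof -
  obtain n u where g: "fine_grids s t n u" using ex_fine_grids[OF st] .
  define S where "S = (\<lambda>k w. \<Sum>i<n k. (u k (Suc i) - u k i) *\<^sub>R \<phi> (u k (Suc i), X (u k (Suc i)) w))"
  have "S k \<in> borel_measurable M" for k
    unfolding S_def using fine_grids_ranges[OF g, of _ k]
    by (intro borel_measurable_sum borel_measurable_scaleR borel_measurable_const
      borel_measurable_slice[OF \<phi>] X_measurable) auto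
  then have "(\<lambda>w. lim (\<lambda>k. S k w)) \<in> borel_measurable M" by (rule borel_measurable_lim_metric)
  moreover have "AE w in M. lim (\<lambda>k. S k w) = integral {s..t} (\<lambda>r. \<phi> (r, X r w))"
    using X_continuous
  proof eventually_elim
    case (elim w)
    from fine_grids_riemann_right[OF g continuous_on_path[OF \<phi> elim]] show ?case
      unfolding S_def by (rule limI)
  qed
  ultimately show thesis by (rule that)
qed

text \<open>Splitting the increments of \<open>X\<close> identifies the limit: coordinatewise
  backward integrals of \<open>d\<close> times \<open>h\<close> against \<open>W\<close>, plus the
  time integral \<open>L\<close> of \<open>h\<close> against the drift.\<close>

lemma backward_integral_exists:
  assumes h: "continuous_on ({s..t} \<times> UNIV) h"
  shows "\<exists>I. has_bwd_integral M (\<bullet>) (\<lambda>r w. h (r, X r w)) X s t I"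
proof -
  have hd: "continuous_on ({s..t} \<times> UNIV) (\<lambda>z. d (fst z) * (h z \<bullet> b))" for b
    by (intro continuous_intros h continuous_on_compose2[OF d_continuous]) auto
  define P where "P = (\<lambda>b I. I \<in> borel_measurable M \<and> grid_null s t (\<lambda>n u w.
      (\<Sum>i<n. (d (u (Suc i)) * (h (u (Suc i), X (u (Suc i)) w) \<bullet> b)) *
        ((W (u (Suc i)) w - W (u i) w) \<bullet> b)) - I w))"
  have P: "\<exists>I. P b I" if b: "b \<in> Basis" for b
    unfolding P_def
  proof (rule backward_ito_integral_exists[OF st _ _ b, of "\<lambda>r w. d r * (h (r, X r w) \<bullet> b)"])
    show "(\<lambda>w. d r * (h (r, X r w) \<bullet> b)) \<in> borel_measurable (G r)" if "r \<in> {s..t}" for r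
      using borel_measurable_slice[OF hd that X_adapted[OF that]] by simp
    show "AE w in M. continuous_on {s..t} (\<lambda>r. d r * (h (r, X r w) \<bullet> b))"
      using X_continuous by eventually_elim (use continuous_on_path[OF hd] in simp)
  qed blast
  from P have "\<forall>b\<in>Basis. \<exists>I. P b I" by blast
  from bchoice[OF this] obtain I1 where "\<forall>b\<in>Basis. P b (I1 b)" ..
  then have I1: "\<And>b. b \<in> Basis \<Longrightarrow> I1 b \<in> borel_measurable M"
    "\<And>b. b \<in> Basis \<Longrightarrow> grid_null s t (\<lambda>n u w.
      (\<Sum>i<n. (d (u (Suc i)) * (h (u (Suc i), X (u (Suc i)) w) \<bullet> b)) *
        ((W (u (Suc i)) w - W (u i) w) \<bullet> b)) - I1 b w)"
    by (simp_all add: P_def)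
  have "continuous_on ({s..t} \<times> UNIV) (\<lambda>z. h z \<bullet> a (fst z) (snd z))"
    using drift_continuous by (intro continuous_intros h) (simp add: case_prod_beta)
  from time_integral_measurable[OF this] obtain L where L: "L \<in> borel_measurable M"
    "AE w in M. L w = integral {s..t} (\<lambda>r. h (r, X r w) \<bullet> a r (X r w))" by auto
  define I where "I = (\<lambda>w. (\<Sum>b\<in>Basis. I1 b w) + L w)"
  have IM: "I \<in> borel_measurable M" unfolding I_def using I1(1) L(1) by simp
  have hM: "(\<lambda>w. h (r, X r w)) \<in> borel_measurable M" if "r \<in> {s..t}" for r
    by (rule borel_measurable_slice[OF h that X_measurable[OF that]])
  have "grid_null s t (\<lambda>n u w. bwd_sum h n u w - I w)"
  proof (rule grid_nullI)
    fix n u \<delta> assume g: "fine_grid s t \<delta> n u"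
    show "(\<lambda>w. bwd_sum h n u w - I w) \<in> borel_measurable M"
      using fine_grid_range[OF g]
      by (intro borel_measurable_diff IM borel_measurable_sum borel_measurable_inner hM X_measurable) auto
  next
    fix n u assume g: "fine_grids s t n u"
    define D0 where "D0 = (\<lambda>b m v w. (\<Sum>i<m. (d (v (Suc i)) * (h (v (Suc i), X (v (Suc i)) w) \<bullet> b)) *
        ((W (v (Suc i)) w - W (v i) w) \<bullet> b)) - I1 b w)"
    have D0: "grid_null s t (D0 b)" if "b \<in> Basis" for b unfolding D0_def by (rule I1(2)[OF that])
    have D0M: "D0 b m v \<in> borel_measurable M"
      if "b \<in> Basis" "fine_grid s t \<delta> m v" for b m v \<delta>
      unfolding D0_def using fine_grid_range[OF that(2)]
      by (intro borel_measurable_diff I1(1) that borel_measurable_sum borel_measurable_inner borel_measurable_times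
        hM W_measurable borel_measurable_const) auto
    obtain r where r: "strict_mono r"
      "AE w in M. \<forall>b\<in>Basis. (\<lambda>k. D0 b (n (r k)) (u (r k)) w) \<longlonglongrightarrow> 0"
      by (rule grid_null_common_subseq[of Basis s t D0, OF finite_Basis D0 _ g]) (assumption, erule (1) D0M, blast)
    note gr = fine_grids_subseq[OF g r(1)]
    from r(2) paths L(2) have "AE w in M. (\<lambda>k. (bwd_sum h (n (r k)) (u (r k)) w) - I w) \<longlonglongrightarrow> 0"
    proof eventually_elim
      case (elim w)
      let ?u = "\<lambda>k. u (r k)"
      let ?dX = "\<lambda>k i. X (?u k (Suc i)) w - X (?u k i) w" and ?dW = "\<lambda>k i. W (?u k (Suc i)) w - W (?u k i) w"
      let ?h = "\<lambda>k i. h (?u k (Suc i), X (?u k (Suc i)) w)"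
      have "continuous_on {s..t} (\<lambda>q. h (q, X q w))"
        using elim(2) by (intro continuous_on_path[OF h]) (simp add: sde_path_def)
      from sde_path_drift_sum[OF elim(2) d'_continuous this gr]
      have "(\<lambda>k. (\<Sum>i<n (r k). ?h k i \<bullet> (?dX k i - d (?u k (Suc i)) *\<^sub>R ?dW k i)) - L w) \<longlonglongrightarrow> 0"
        by (simp add: elim(3) LIM_zero)
      moreover have "(\<lambda>k. \<Sum>b\<in>Basis. (\<Sum>i<n (r k). (d (?u k (Suc i)) * (?h k i \<bullet> b)) * (?dW k i \<bullet> b)) - I1 b w)
        \<longlonglongrightarrow> (\<Sum>b\<in>(Basis::'a set). 0)"
        using elim(1) unfolding D0_def by (intro tendsto_sum) auto
      ultimately have "(\<lambda>k. ((\<Sum>i<n (r k). ?h k i \<bullet> (?dX k i - d (?u k (Suc i)) *\<^sub>R ?dW k i)) - L w) +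
        (\<Sum>b\<in>Basis. (\<Sum>i<n (r k). (d (?u k (Suc i)) * (?h k i \<bullet> b)) * (?dW k i \<bullet> b)) - I1 b w))
        \<longlonglongrightarrow> 0 + (\<Sum>b\<in>(Basis::'a set). 0)" by (rule tendsto_add)
      moreover have inner: "(\<Sum>b\<in>Basis. (\<Sum>i<n (r k). (d (?u k (Suc i)) * (?h k i \<bullet> b)) * (?dW k i \<bullet> b)) - I1 b w) =
        (\<Sum>i<n (r k). ?h k i \<bullet> (d (?u k (Suc i)) *\<^sub>R ?dW k i)) - (\<Sum>b\<in>Basis. I1 b w)" for k
      proof -
        have "(d x * (y \<bullet> b)) * (v \<bullet> b) = d x * ((y \<bullet> b) * (v \<bullet> b))" for x b and y v :: 'a by simp
        moreover have "(\<Sum>b\<in>Basis. \<Sum>i<n (r k). d (?u k (Suc i)) * ((?h k i \<bullet> b) * (?dW k i \<bullet> b))) =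
          (\<Sum>i<n (r k). ?h k i \<bullet> (d (?u k (Suc i)) *\<^sub>R ?dW k i))"
          by (subst sum.swap, intro sum.cong refl)
            (simp only: sum_distrib_left[symmetric] euclidean_inner[symmetric] inner_scaleR_right)
        ultimately show ?thesis by (simp only: sum_subtractf)
      qed
      moreover have drift: "(\<Sum>i<n (r k). ?h k i \<bullet> (?dX k i - d (?u k (Suc i)) *\<^sub>R ?dW k i)) =
        (\<Sum>i<n (r k). ?h k i \<bullet> ?dX k i) - (\<Sum>i<n (r k). ?h k i \<bullet> (d (?u k (Suc i)) *\<^sub>R ?dW k i))" for k
        unfolding sum_subtractf[symmetric] by (intro sum.cong refl) (rule inner_diff_right)
      moreover have "(x - y - l) + (y - j) = x - (j + l)" for x y l j :: real by simp
      ultimately show ?case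
        unfolding I_def by (simp only: inner drift) simp
    qed
    with r(1) show "\<exists>r. strict_mono r \<and> (AE w in M. (\<lambda>k. (bwd_sum h (n (r k)) (u (r k)) w) - I w) \<longlonglongrightarrow> 0)" by blast
  qed
  then show ?thesis
    using IM hM X_measurable by (auto simp: has_bwd_integral_def grid_null_def intro!: exI[of _ I])
qed

text \<open>Finitely many weighted quadratic sums of \<open>W\<close> converge on a common
  subsequence and a common event of full measure; there the path statement applies. The subsequence
  depends on the given partitions, the limit does not.\<close>

lemma quadratic_covariation_subseq:
  fixes H :: "real \<times> 'a \<Rightarrow> 'a" and D :: "real \<times> 'a \<Rightarrow> (real \<times> 'a) \<Rightarrow>\<^sub>L 'a"
  assumes H: "\<And>z. z \<in> {s..t} \<times> UNIV \<Longrightarrow> (H has_derivative blinfun_apply (D z)) (at z within {s..t} \<times> UNIV)"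
    and D: "continuous_on ({s..t} \<times> UNIV) D" and g: "fine_grids s t n u"
  obtains r where "strict_mono r" "AE w in M. (\<lambda>k. cov_sum H (n (r k)) (u (r k)) w)
    \<longlonglongrightarrow> cov_integral D w"
proof -
  \<comment> \<open>The weight \<open>1\<close>, selected by \<open>c = False\<close>, makes the sums of squared increments of \<open>W\<close> bounded.\<close>
  define \<kappa> where "\<kappa> = (\<lambda>(b1, b2, c) z. if c then (d (fst z))\<^sup>2 * (D z (0, b1) \<bullet> b2) else 1 :: real)"
  have \<kappa>: "continuous_on ({s..t} \<times> UNIV) (\<kappa> p)" for p
    unfolding \<kappa>_def
    by (cases p; cases "snd (snd p)")
      (auto intro!: continuous_intros D continuous_on_compose2[OF d_continuous])
  let ?Y = "\<lambda>(b1, b2, c :: bool) u i w. ((W (u (Suc i)) w - W (u i) w) \<bullet> b1) * ((W (u (Suc i)) w - W (u i) w) \<bullet> b2) -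
      (if b1 = b2 then u (Suc i) - u i else 0)"
  let ?A = "(Basis :: 'a set) \<times> (Basis :: 'a set) \<times> (UNIV :: bool set)"
  define Q where "Q = (\<lambda>p n u w. \<Sum>i<n. \<kappa> p (u (Suc i), X (u (Suc i)) w) * ?Y p u i w)"
  have "finite ?A" by simp
  moreover have "grid_null s t (Q p)" if "p \<in> ?A" for p
  proof -
    obtain b1 b2 c where p: "p = (b1, b2, c)" by (cases p)
    with that have b: "b1 \<in> Basis" "b2 \<in> Basis" by auto
    have "AE w in M. continuous_on {s..t} (\<lambda>r. \<kappa> p (r, X r w))"
      using X_continuous by eventually_elim (rule continuous_on_path[OF \<kappa>])
    then show ?thesis
      unfolding Q_def p prod.case
      by (intro quadratic_variation[of "\<lambda>r w. \<kappa> (b1, b2, c) (r, X r w)", OF st _ _ b]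
        borel_measurable_slice[OF \<kappa> _ X_adapted])
  qed
  moreover have "Q p n u \<in> borel_measurable M" if "p \<in> ?A" "fine_grid s t \<delta> n u" for p n u \<delta>
    unfolding Q_def using fine_grid_range[OF that(2)]
    by (cases p) (auto intro!: borel_measurable_sum borel_measurable_times borel_measurable_slice[OF \<kappa>] X_measurable
      borel_measurable_diff borel_measurable_inner W_measurable)
  ultimately obtain r where r: "strict_mono r"
    "AE w in M. \<forall>p\<in>?A. (\<lambda>k. Q p (n (r k)) (u (r k)) w) \<longlonglongrightarrow> 0"
    by (rule grid_null_common_subseq[of ?A s t Q, OF _ _ _ g])
  note gr = fine_grids_subseq[OF g r(1)]
  from r(2) paths have "AE w in M. (\<lambda>k. cov_sum H (n (r k)) (u (r k)) w)
    \<longlonglongrightarrow> cov_integral D w"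
  proof eventually_elim
    case (elim w)
    show ?case
    proof (rule sde_path_quadratic_covariation[OF elim(2) d'_continuous d_continuous gr H D, unfolded comp_def])
      fix b1 b2 :: 'a assume "b1 \<in> Basis" "b2 \<in> Basis"
      with elim(1)[rule_format, of "(b1, b2, True)"]
      show "(\<lambda>k. \<Sum>i<n (r k). (d (u (r k) (Suc i)))\<^sup>2 * (D (u (r k) (Suc i), X (u (r k) (Suc i)) w) (0, b1) \<bullet> b2) *
        (((W (u (r k) (Suc i)) w - W (u (r k) i) w) \<bullet> b1) * ((W (u (r k) (Suc i)) w - W (u (r k) i) w) \<bullet> b2) -
          (if b1 = b2 then u (r k) (Suc i) - u (r k) i else 0))) \<longlonglongrightarrow> 0"
        by (simp only: Q_def \<kappa>_def prod.case fst_conv if_True mem_Times_iff snd_conv UNIV_I simp_thms)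
    next
      fix b :: 'a assume "b \<in> Basis"
      with elim(1)[rule_format, of "(b, b, False)"]
      show "(\<lambda>k. \<Sum>i<n (r k). ((W (u (r k) (Suc i)) w - W (u (r k) i) w) \<bullet> b) * ((W (u (r k) (Suc i)) w - W (u (r k) i) w) \<bullet> b) -
          (u (r k) (Suc i) - u (r k) i)) \<longlonglongrightarrow> 0"
        by (simp only: Q_def \<kappa>_def prod.case fst_conv if_False if_True mem_Times_iff snd_conv UNIV_I simp_thms mult_1)
    qed auto
  qed
  with r(1) show thesis by (rule that)
qed

lemma forward_integral_exists:
  fixes h :: "real \<times> 'a \<Rightarrow> 'a" and D :: "real \<times> 'a \<Rightarrow> (real \<times> 'a) \<Rightarrow>\<^sub>L 'a"
  assumes h: "\<And>z. z \<in> {s..t} \<times> UNIV \<Longrightarrow> (h has_derivative blinfun_apply (D z)) (at z within {s..t} \<times> UNIV)"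
    and D: "continuous_on ({s..t} \<times> UNIV) D"
  shows "\<exists>I. has_fwd_integral M (\<bullet>) (\<lambda>r w. h (r, X r w)) X s t I"
proof -
  have hc: "continuous_on ({s..t} \<times> UNIV) h"
    using h by (meson continuous_on_eq_continuous_within has_derivative_continuous)
  obtain I where I: "has_bwd_integral M (\<bullet>) (\<lambda>r w. h (r, X r w)) X s t I"
    using backward_integral_exists[OF hc] by blast
  have "continuous_on ({s..t} \<times> UNIV) (\<lambda>z. (d (fst z))\<^sup>2 * (\<Sum>b\<in>Basis. D z (0, b) \<bullet> b))"
    by (intro continuous_intros D continuous_on_compose2[OF d_continuous]) auto
  from time_integral_measurable[OF this] obtain L where L: "L \<in> borel_measurable M"
    "AE w in M. L w = cov_integral D w" by auto
  have IM: "I \<in> borel_measurable M" using I by (simp add: has_bwd_integral_def)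
  have hM: "(\<lambda>w. h (r, X r w)) \<in> borel_measurable M" if "r \<in> {s..t}" for r
    by (rule borel_measurable_slice[OF hc that X_measurable[OF that]])
  \<comment> \<open>On every partition the backward sum minus the forward sum is exactly the
    covariation sum, so \<open>I - L\<close> is the only possible limit.\<close>
  have "grid_null s t (\<lambda>n u w. fwd_sum h n u w - (I w - L w))"
  proof (rule grid_nullI)
    fix n u \<delta> assume g: "fine_grid s t \<delta> n u"
    show "(\<lambda>w. fwd_sum h n u w - (I w - L w)) \<in> borel_measurable M"
      using fine_grid_range[OF g]
      by (intro borel_measurable_diff IM L(1) borel_measurable_sum borel_measurable_inner hM X_measurable) auto
  next
    fix n u assume g: "fine_grids s t n u"
    from quadratic_covariation_subseq[OF h D g] obtain r1 where r1: "strict_mono r1"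
      "AE w in M. (\<lambda>k. cov_sum h (n (r1 k)) (u (r1 k)) w)
      \<longlonglongrightarrow> cov_integral D w" by blast
    note g1 = fine_grids_subseq[OF g r1(1)]
    let ?B = "\<lambda>n u w. bwd_sum h n u w - I w"
    have "grid_null s t ?B" using I by (simp add: has_bwd_integral_def grid_null_def)
    moreover have "?B ((n \<circ> r1) k) ((u \<circ> r1) k) \<in> borel_measurable M" for k
      using fine_grids_ranges[OF g1, of _ k]
      by (intro borel_measurable_diff IM borel_measurable_sum borel_measurable_inner hM X_measurable) auto
    ultimately obtain r2 where r2: "strict_mono r2"
      "AE w in M. (\<lambda>k. ?B ((n \<circ> r1) (r2 k)) ((u \<circ> r1) (r2 k)) w) \<longlonglongrightarrow> 0"
      using grid_null_subseq[OF _ g1] by blast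
    let ?r = "r1 \<circ> r2"
    from r1(2) r2(2) L(2) have "AE w in M. (\<lambda>k. (fwd_sum h (n (?r k)) (u (?r k)) w) - (I w - L w)) \<longlonglongrightarrow> 0"
    proof eventually_elim
      case (elim w)
      let ?dX = "\<lambda>k i. X (u (?r k) (Suc i)) w - X (u (?r k) i) w"
      let ?F = "\<lambda>k. \<Sum>i<n (?r k). h (u (?r k) i, X (u (?r k) i) w) \<bullet> ?dX k i"
      let ?Bw = "\<lambda>k. \<Sum>i<n (?r k). h (u (?r k) (Suc i), X (u (?r k) (Suc i)) w) \<bullet> ?dX k i"
      have "(\<lambda>k. ?Bw k - I w) \<longlonglongrightarrow> 0" using elim(2) by (simp add: comp_def)
      moreover have "(\<lambda>k. ?Bw k - ?F k) \<longlonglongrightarrow> L w"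
        using LIMSEQ_subseq_LIMSEQ[OF elim(1) r2(1)] elim(3)
        by (simp add: comp_def inner_diff_left[of "h _" "h _"] sum_subtractf)
      ultimately have "(\<lambda>k. (?Bw k - I w) - ((?Bw k - ?F k) - L w)) \<longlonglongrightarrow> 0 - (L w - L w)"
        by (intro tendsto_intros)
      then show ?case by (simp add: algebra_simps)
    qed
    with strict_mono_o[OF r1(1) r2(1)]
    show "\<exists>r. strict_mono r \<and> (AE w in M. (\<lambda>k. (fwd_sum h (n (r k)) (u (r k)) w) - (I w - L w)) \<longlonglongrightarrow> 0)" by blast
  qed
  then show ?thesis
    using IM L(1) hM X_measurable
    by (auto simp: has_fwd_integral_def grid_null_def intro!: exI[of _ "\<lambda>w. I w - L w"])
qed

text \<open>The relations \<open>eq\<close> hold field by field, hence already for the Riemann sums: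
  the combination of the four sums is exactly the covariation sum of \<open>H\<close>. Arbitrary
  versions \<open>I1\<close>, ..., \<open>I4\<close> are allowed, in particular those picked by the
  choice operator in \<open>bwd_integral\<close> and \<open>fwd_integral\<close>.\<close>

lemma backward_forward_difference:
  fixes H :: "real \<times> 'a \<Rightarrow> 'a" and D :: "real \<times> 'a \<Rightarrow> (real \<times> 'a) \<Rightarrow>\<^sub>L 'a"
  assumes H: "\<And>z. z \<in> {s..t} \<times> UNIV \<Longrightarrow> (H has_derivative blinfun_apply (D z)) (at z within {s..t} \<times> UNIV)"
    and D: "continuous_on ({s..t} \<times> UNIV) D"
    and bwd: "has_bwd_integral M (\<bullet>) h1 X s t I1" "has_bwd_integral M (\<bullet>) h2 X s t I2"
    and fwd: "has_fwd_integral M (\<bullet>) h3 X s t I3" "has_fwd_integral M (\<bullet>) h4 X s t I4"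
    and eq: "\<And>r w. r \<in> {s..t} \<Longrightarrow> \<beta> *\<^sub>R h1 r w - h2 r w = H (r, X r w)"
      "\<And>r w. r \<in> {s..t} \<Longrightarrow> \<beta> *\<^sub>R h3 r w - h4 r w = H (r, X r w)"
  shows "AE w in M. (\<beta> * I1 w - I2 w) - (\<beta> * I3 w - I4 w) =
    cov_integral D w"
proof -
  obtain n u where g0: "fine_grids s t n u" using ex_fine_grids[OF st] .
  from quadratic_covariation_subseq[OF H D g0] obtain r where r: "strict_mono r"
      "AE w in M. (\<lambda>k. cov_sum H (n (r k)) (u (r k)) w)
      \<longlonglongrightarrow> cov_integral D w" by blast
  define m v where "m = n \<circ> r" and "v = u \<circ> r"
  have g: "fine_grids s t m v" unfolding m_def v_def by (rule fine_grids_subseq[OF g0 r(1)])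
  \<comment> \<open>The four integrals form one family, backward for \<open>j < 2\<close> and
    forward otherwise, so that a single extraction of a subsequence serves all of them.\<close>
  define h where "h = (\<lambda>j::nat. if j = 0 then h1 else if j = 1 then h2 else if j = 2 then h3 else h4)"
  define I where "I = (\<lambda>j::nat. if j = 0 then I1 else if j = 1 then I2 else if j = 2 then I3 else I4)"
  define S where "S = (\<lambda>j n u w. \<Sum>i<n. h j (if j < 2 then u (Suc i) else u i) w \<bullet> (X (u (Suc i)) w - X (u i) w))"
  have ints: "(j < 2 \<and> has_bwd_integral M (\<bullet>) (h j) X s t (I j)) \<or> (\<not> j < 2 \<and> has_fwd_integral M (\<bullet>) (h j) X s t (I j))" for j
    using bwd fwd by (auto simp: h_def I_def)
  have null: "grid_null s t (\<lambda>n u w. S j n u w - I j w)" for j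
    using ints[of j] by (auto simp: S_def grid_null_def has_bwd_integral_def has_fwd_integral_def)
  have hM: "I j \<in> borel_measurable M" "r \<in> {s..t} \<Longrightarrow> h j r \<in> borel_measurable M" for j r
    using ints[of j] by (auto simp: has_bwd_integral_def has_fwd_integral_def)
  define D0 where "D0 = (\<lambda>j n u w. S j n u w - I j w)"
  have D0: "grid_null s t (D0 j)" for j unfolding D0_def by (rule null)
  have D0M: "D0 j n u \<in> borel_measurable M" if "fine_grid s t \<delta> n u" for j n u \<delta>
    unfolding D0_def S_def using fine_grid_range[OF that]
    by (intro borel_measurable_diff hM borel_measurable_sum borel_measurable_inner X_measurable) auto
  obtain r' where r': "strict_mono r'"
    "AE w in M. \<forall>j\<in>{..<4}. (\<lambda>k. D0 j (m (r' k)) (v (r' k)) w) \<longlonglongrightarrow> 0"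
    by (rule grid_null_common_subseq[of "{..<4::nat}" s t D0, OF _ D0 _ g]) (simp, erule D0M, blast)
  from r(2) r'(2) show ?thesis
  proof eventually_elim
    case (elim w)
    let ?S = "\<lambda>j k. S j (m (r' k)) (v (r' k)) w"
    have lim: "(\<lambda>k. ?S j k) \<longlonglongrightarrow> I j w" if "j < 4" for j
      using elim(2) that by (auto simp: D0_def intro: LIM_zero_cancel)
    have "(\<lambda>k. (\<beta> * ?S 0 k - ?S 1 k) - (\<beta> * ?S 2 k - ?S 3 k)) \<longlonglongrightarrow>
      (\<beta> * I 0 w - I 1 w) - (\<beta> * I 2 w - I 3 w)"
      by (intro tendsto_intros lim) auto
    moreover have "(\<beta> * ?S 0 k - ?S 1 k) - (\<beta> * ?S 2 k - ?S 3 k) = (cov_sum H (m (r' k)) (v (r' k)) w)" for k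
    proof -
      have "H (v (r' k) (Suc i), X (v (r' k) (Suc i)) w) = \<beta> *\<^sub>R h1 (v (r' k) (Suc i)) w - h2 (v (r' k) (Suc i)) w"
        "H (v (r' k) i, X (v (r' k) i) w) = \<beta> *\<^sub>R h3 (v (r' k) i) w - h4 (v (r' k) i) w" if "i < m (r' k)" for i
        using fine_grids_ranges[OF g, of i "r' k"] fine_grids_ranges[OF g, of "Suc i" "r' k"] that eq by auto
      then show ?thesis
        by (simp add: S_def h_def sum_distrib_left sum_subtractf[symmetric] inner_diff_left inner_scaleR_left
          cong: sum.cong_simp)
    qed
    ultimately have "(\<lambda>k. cov_sum H (m (r' k)) (v (r' k)) w) \<longlonglongrightarrow> (\<beta> * I1 w - I2 w) - (\<beta> * I3 w - I4 w)"
      by (simp add: I_def)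
    from LIMSEQ_unique[OF this] LIMSEQ_subseq_LIMSEQ[OF elim(1) r'(1)]
    show ?case by (simp add: comp_def m_def v_def)
  qed
qed

end

text \<open>The weights for all starting times come from one diffusion; each of them is computed on
  the restriction to a later start.\<close>

lemma backward_diffusion_restrict:
  assumes "backward_diffusion M G W s t a d d' X" "s \<le> s'" "s' \<le> t"
  shows "backward_diffusion M G W s' t a d d' X"
proof -
  interpret backward_diffusion M G W s t a d d' X by fact
  have sub: "{s'..t} \<subseteq> {s..t}" using assms by auto
  show ?thesis
  proof unfold_locales
    show "continuous_on ({s'..t} \<times> UNIV) (\<lambda>(r, x). a r x)"
      using sub by (intro continuous_on_subset[OF drift_continuous]) auto
    show "(d has_real_derivative d' r) (at r within {s'..t})" if "r \<in> {s'..t}" for r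
      using d_deriv[of r] that sub by (meson DERIV_subset subsetD)
    show "continuous_on {s'..t} d'" by (rule continuous_on_subset[OF d'_continuous sub])
    show "AE w in M. sde_path s' t (\<lambda>r. a r (X r w)) d d' (\<lambda>r. X r w) (\<lambda>r. W r w)"
      using paths
      by eventually_elim (use sub assms in \<open>auto simp: sde_path_def intro: continuous_on_subset\<close>)
    show "r \<in> {s'..t} \<Longrightarrow> subalgebra M (G r)" for r using sub subalg by blast
    show "s' \<le> r \<Longrightarrow> r \<le> v \<Longrightarrow> v \<le> t \<Longrightarrow> sets (G v) \<subseteq> sets (G r)" for r v
      using assms by (intro anti) auto
    show "r \<in> {s'..t} \<Longrightarrow> W r \<in> borel_measurable (G r)" for r using sub W_adapted by blast
    show "s' \<le> r \<Longrightarrow> r < v \<Longrightarrow> v \<le> t \<Longrightarrow> distributed M lborel (\<lambda>w. W r w - W v w)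
        (\<lambda>x. ennreal (\<Prod>b\<in>Basis. normal_density 0 (sqrt (v - r)) (x \<bullet> b)))" for r v
      using assms by (intro increment_distributed) auto
    show "s' \<le> r \<Longrightarrow> r < v \<Longrightarrow> v \<le> t \<Longrightarrow>
      indep_set (sets (G v)) {(\<lambda>w. W r w - W v w) -` A \<inter> space M | A. A \<in> sets borel}" for r v
      using assms by (intro increment_indep) auto
    show "s' \<le> t" by fact
    show "r \<in> {s'..t} \<Longrightarrow> X r \<in> borel_measurable (G r)" for r using sub X_adapted by blast
  qed
qed

section \<open>Continuously differentiable coefficients\<close>

lemma C1_on_imp_continuous_on:
  assumes "C1_on S g"
  shows "continuous_on S g"
  using assms unfolding C1_on_def
  by (meson continuous_on_eq_continuous_within has_derivative_continuous)

lemma C1_on_subset: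
  assumes "C1_on S g" "S' \<subseteq> S"
  shows "C1_on S' g"
  using assms unfolding C1_on_def by (meson continuous_on_subset has_derivative_subset subsetD)

lemma C1_on_cong:
  assumes "C1_on S g" "\<And>z. z \<in> S \<Longrightarrow> h z = g z"
  shows "C1_on S h"
  using assms unfolding C1_on_def by (meson has_derivative_transform)

lemma C1_on_add:
  assumes "C1_on S g" "C1_on S h"
  shows "C1_on S (\<lambda>z. g z + h z)"
proof -
  from assms obtain g' h' where
    g: "\<And>z. z \<in> S \<Longrightarrow> (g has_derivative blinfun_apply (g' z)) (at z within S)" "continuous_on S g'" and
    h: "\<And>z. z \<in> S \<Longrightarrow> (h has_derivative blinfun_apply (h' z)) (at z within S)" "continuous_on S h'"
    unfolding C1_on_def by blast
  have "((\<lambda>z. g z + h z) has_derivative blinfun_apply (g' z + h' z)) (at z within S)" if "z \<in> S" for z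
    by (rule has_derivative_eq_rhs[OF has_derivative_add[OF g(1)[OF that] h(1)[OF that]]])
      (simp add: fun_eq_iff blinfun.add_left)
  moreover have "continuous_on S (\<lambda>z. g' z + h' z)" by (intro continuous_intros g h)
  ultimately show ?thesis unfolding C1_on_def by (intro exI[of _ "\<lambda>z. g' z + h' z"]) blast
qed

lemma C1_on_scaleR:
  fixes k :: "'a::euclidean_space \<Rightarrow> real"
  assumes "C1_on S k" "C1_on S g"
  shows "C1_on S (\<lambda>z. k z *\<^sub>R g z)"
proof -
  from assms obtain g' k' where
    g: "\<And>z. z \<in> S \<Longrightarrow> (g has_derivative blinfun_apply (g' z)) (at z within S)" "continuous_on S g'" and
    k: "\<And>z. z \<in> S \<Longrightarrow> (k has_derivative blinfun_apply (k' z)) (at z within S)" "continuous_on S k'"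
    unfolding C1_on_def by blast
  let ?D = "\<lambda>z. k z *\<^sub>R g' z + (blinfun_scaleR_left (g z) o\<^sub>L k' z)"
  have "((\<lambda>z. k z *\<^sub>R g z) has_derivative blinfun_apply (?D z)) (at z within S)" if "z \<in> S" for z
    by (rule has_derivative_eq_rhs[OF has_derivative_scaleR[OF k(1)[OF that] g(1)[OF that]]])
      (simp add: fun_eq_iff blinfun.add_left blinfun.scaleR_left)
  moreover have "continuous_on S ?D"
    using C1_on_imp_continuous_on[OF assms(1)] C1_on_imp_continuous_on[OF assms(2)]
    by (intro continuous_on_add continuous_on_scaleR g k
      bounded_bilinear.continuous_on[OF bounded_bilinear_blinfun_compose]
      bounded_linear.continuous_on[OF bounded_linear_blinfun_scaleR_left])
  ultimately show ?thesis unfolding C1_on_def by (intro exI[of _ ?D]) blast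
qed

lemma C1_on_const: "C1_on S (\<lambda>_. c)"
  unfolding C1_on_def by (intro exI[of _ "\<lambda>_. 0"]) (auto simp: blinfun.zero_left[abs_def])

lemma C1_on_real_iff:
  fixes k :: "real \<Rightarrow> real"
  shows "C1_on I k \<longleftrightarrow>
    (\<exists>k'. continuous_on I k' \<and> (\<forall>r\<in>I. (k has_real_derivative k' r) (at r within I)))"
proof
  assume "C1_on I k"
  then obtain D where D: "\<And>r. r \<in> I \<Longrightarrow> (k has_derivative blinfun_apply (D r)) (at r within I)" "continuous_on I D"
    unfolding C1_on_def by blast
  have "blinfun_apply (D r) = (*) (D r 1)" for r
  proof
    fix x show "D r x = D r 1 * x"
      using blinfun.scaleR_right[of "D r" x 1] by simp
  qed
  with D show "\<exists>k'. continuous_on I k' \<and> (\<forall>r\<in>I. (k has_real_derivative k' r) (at r within I))"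
    by (intro exI[of _ "\<lambda>r. D r 1"]) (auto simp: has_field_derivative_def intro!: continuous_intros)
next
  assume "\<exists>k'. continuous_on I k' \<and> (\<forall>r\<in>I. (k has_real_derivative k' r) (at r within I))"
  then obtain k' where "continuous_on I k'" "\<And>r. r \<in> I \<Longrightarrow> (k has_real_derivative k' r) (at r within I)"
    by blast
  moreover have "blinfun_apply (blinfun_scaleR_left (k' r)) = (*) (k' r)" for r
    by (simp add: fun_eq_iff mult.commute)
  ultimately show "C1_on I k"
    unfolding C1_on_def
    by (intro exI[of _ "\<lambda>r. blinfun_scaleR_left (k' r)"] conjI ballI
        bounded_linear.continuous_on[OF bounded_linear_blinfun_scaleR_left])
      (simp_all only: has_field_derivative_def)
qed

lemma C1_on_fst:
  fixes k :: "real \<Rightarrow> real"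
  assumes "C1_on I k"
  shows "C1_on (I \<times> (UNIV :: 'a::euclidean_space set)) (\<lambda>z. k (fst z))"
proof -
  from assms obtain D where D: "\<And>r. r \<in> I \<Longrightarrow> (k has_derivative blinfun_apply (D r)) (at r within I)" "continuous_on I D"
    unfolding C1_on_def by blast
  have "((\<lambda>z. k (fst z)) has_derivative blinfun_apply (D (fst z) o\<^sub>L fst_blinfun)) (at z within I \<times> UNIV)"
    if "z \<in> I \<times> (UNIV :: 'a set)" for z
    by (rule has_derivative_eq_rhs[OF has_derivative_in_compose2[OF D(1), of fst "I \<times> UNIV" z fst]])
      (use that in \<open>auto simp: fun_eq_iff intro!: derivative_eq_intros\<close>)
  moreover have "continuous_on (I \<times> (UNIV :: 'a set)) (\<lambda>z. D (fst z) o\<^sub>L fst_blinfun)"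
    by (intro bounded_bilinear.continuous_on[OF bounded_bilinear_blinfun_compose]
      continuous_on_compose2[OF D(2)] continuous_intros) auto
  ultimately show ?thesis
    unfolding C1_on_def by (intro exI[of _ "\<lambda>z. D (fst z) o\<^sub>L fst_blinfun"]) blast
qed

text \<open>Joint derivatives are taken within a slab, whereas \<open>divergence\<close> needs the
  derivative in space at a fixed time. The slab is unbounded in space, so the slice carries no
  \<open>within\<close>, even at an end point of the time interval.\<close>

lemma has_derivative_slice:
  assumes "(F has_derivative F') (at (r, x) within I \<times> UNIV)" "r \<in> I"
  shows "((\<lambda>x. F (r, x)) has_derivative (\<lambda>v. F' (0, v))) (at x)"
proof (rule has_derivative_in_compose[of "\<lambda>x. (r, x)" "\<lambda>v. (0, v)" x UNIV F F'])
  show "(F has_derivative F') (at (r, x) within range (Pair r))"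
    by (rule has_derivative_subset[OF assms(1)]) (use assms(2) in auto)
qed (auto intro!: derivative_eq_intros)

text \<open>Countably many times suffice for continuous paths: this exchanges one null set per time
  for a single null set.\<close>

lemma (in prob_space) AE_continuous_paths_eq:
  fixes f g :: "real \<Rightarrow> 'a \<Rightarrow> 'b::real_normed_vector"
  assumes f: "AE w in M. continuous_on {s..t} (\<lambda>r. f r w)"
    and g: "AE w in M. continuous_on {s..t} (\<lambda>r. g r w)"
    and eq: "\<And>r. r \<in> {s..t} \<Longrightarrow> AE w in M. f r w = g r w"
  shows "AE w in M. \<forall>r\<in>{s..t}. f r w = g r w"
proof -
  obtain D where D: "countable D" "D \<subseteq> {s..t}" "closure D = {s..t}" by (rule Icc_countable_dense)
  have "AE w in M. \<forall>r\<in>D. f r w = g r w"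
    using D(2) by (intro AE_ball_countable[OF D(1), THEN iffD2] ballI eq) auto
  with f g show ?thesis
  proof eventually_elim
    case (elim w)
    have "continuous_on (closure D) (\<lambda>r. f r w - g r w)"
      unfolding D(3) using elim by (intro continuous_on_diff)
    then have "f r w - g r w = 0" if "r \<in> {s..t}" for r
      by (rule continuous_constant_on_closure[where S=D]) (use elim(3) D(3) that in auto)
    then show ?case by simp
  qed
qed

text \<open>The same sums converge to \<open>J\<close> in probability and, by summation by parts, to
  the explicit expression along every continuous path. On an almost surely convergent subsequence
  the two limits agree.\<close>

lemma (in prob_space) wiener_integral_by_parts:
  fixes W :: "real \<Rightarrow> 'a \<Rightarrow> 'b::euclidean_space"
  assumes J: "has_bwd_integral M (*\<^sub>R) (\<lambda>v w. d v) W s t J" and "s \<le> t"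
    and W: "AE w in M. continuous_on {s..t} (\<lambda>r. W r w)"
    and d: "\<And>r. r \<in> {s..t} \<Longrightarrow> (d has_real_derivative d' r) (at r within {s..t})"
    and d': "continuous_on {s..t} d'"
  shows "AE w in M. J w = d t *\<^sub>R W t w - d s *\<^sub>R W s w - integral {s..t} (\<lambda>q. d' q *\<^sub>R W q w)"
proof -
  obtain n u where g: "fine_grids s t n u" using ex_fine_grids[OF \<open>s \<le> t\<close>] .
  \<comment> \<open>Taking the norm of the error reduces the vector-valued integral to the
    real-valued convergence criteria.\<close>
  define D where "D = (\<lambda>n u w. norm ((\<Sum>i<n. d (u (Suc i)) *\<^sub>R (W (u (Suc i)) w - W (u i) w)) - J w))"
  have "grid_null s t D" using J by (simp add: D_def grid_null_def has_bwd_integral_def)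
  moreover have "D (n k) (u k) \<in> borel_measurable M" for k
  proof -
    have JM: "J \<in> borel_measurable M" and WM: "W r \<in> borel_measurable M" if "r \<in> {s..t}" for r
      using J that \<open>s \<le> t\<close> by (auto simp: has_bwd_integral_def)
    have "(\<lambda>w. (\<Sum>i<n k. d (u k (Suc i)) *\<^sub>R (W (u k (Suc i)) w - W (u k i) w)) - J w) \<in> borel_measurable M"
      using fine_grids_ranges[OF g, of _ k] \<open>s \<le> t\<close>
      by (intro borel_measurable_diff borel_measurable_sum borel_measurable_scaleR
        borel_measurable_const WM JM[of s]) auto
    then show ?thesis unfolding D_def by measurable
  qed
  ultimately obtain r where r: "strict_mono r" "AE w in M. (\<lambda>k. D (n (r k)) (u (r k)) w) \<longlonglongrightarrow> 0"
    using grid_null_subseq[OF _ g, of D] by blast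
  from W r(2) show ?thesis
  proof eventually_elim
    case (elim w)
    have "(\<lambda>k. \<Sum>i<n (r k). d (u (r k) (Suc i)) *\<^sub>R (W (u (r k) (Suc i)) w - W (u (r k) i) w)) \<longlonglongrightarrow> J w"
      using elim(2) unfolding D_def by (rule tendsto_norm_zero_cancel[THEN LIM_zero_cancel])
    moreover have "(\<lambda>k. \<Sum>i<n (r k). d (u (r k) (Suc i)) *\<^sub>R (W (u (r k) (Suc i)) w - W (u (r k) i) w))
      \<longlonglongrightarrow> d t *\<^sub>R W t w - d s *\<^sub>R W s w - integral {s..t} (\<lambda>q. d' q *\<^sub>R W q w)"
      using fine_grids_integration_by_parts[OF fine_grids_subseq[OF g r(1)] elim(1) d d'] by simp
    ultimately show ?case by (rule LIMSEQ_unique)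
  qed
qed

text \<open>The definition gives the integral equation for each time separately, with some version
  of the Wiener integral. Integration by parts makes its right-hand side continuous in time, so that
  the equation holds for all times on one event.\<close>

lemma backward_sde_diffusion:
  assumes sde: "backward_sde M G W a d s t X" and st: "s \<le> t"
    and a: "continuous_on ({s..t} \<times> UNIV) (\<lambda>(r, x). a r x)"
    and d: "\<And>r. r \<in> {s..t} \<Longrightarrow> (d has_real_derivative d' r) (at r within {s..t})"
    and d': "continuous_on {s..t} d'"
  shows "backward_diffusion M G W s t a d d' X"
proof -
  \<comment> \<open>Reflection of the time interval. It is its own inverse, so instantiating the
    Brownian properties at reflected times returns statements about \<open>G\<close> and
    \<open>W\<close>, with the order of times reversed.\<close>
  let ?\<rho> = "\<lambda>r. s + t - r"
  from sde have bm: "brownian_motion M (\<lambda>r. G (?\<rho> r)) (\<lambda>r. W (?\<rho> r)) s t"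
    by (simp add: backward_sde_def)
  then interpret prob_space M by (simp add: brownian_motion_def)
  have filt: "filtration (space M) (\<lambda>r. G (?\<rho> r))" using bm by (simp add: brownian_motion_def)
  have sub: "subalgebra M (G r)" "W r \<in> borel_measurable (G r)" if "r \<in> {s..t}" for r
  proof -
    have "?\<rho> r \<in> {s..t}" using that by auto
    with bm have "subalgebra M (G (?\<rho> (?\<rho> r))) \<and> W (?\<rho> (?\<rho> r)) \<in> borel_measurable (G (?\<rho> (?\<rho> r)))"
      unfolding brownian_motion_def by blast
    then show "subalgebra M (G r)" "W r \<in> borel_measurable (G r)" by simp_all
  qed
  have Wc: "AE w in M. continuous_on {s..t} (\<lambda>r. W r w)"
  proof -
    have "AE w in M. continuous_on {s..t} (\<lambda>r. W (?\<rho> r) w)" using bm by (simp add: brownian_motion_def)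
    then show ?thesis
    proof eventually_elim
      case (elim w)
      have "continuous_on {s..t} (\<lambda>r. W (?\<rho> (?\<rho> r)) w)"
        by (rule continuous_on_compose2[OF elim, of _ ?\<rho>]) (auto intro!: continuous_intros)
      then show ?case by simp
    qed
  qed
  have Xc: "AE w in M. continuous_on {s..t} (\<lambda>r. X r w)"
    using sde by (auto simp: backward_sde_def)
  have dc: "continuous_on {s..t} d"
    unfolding continuous_on_eq_continuous_within using DERIV_continuous[OF d] by blast
  have ac: "continuous_on {s..t} (\<lambda>r. a r (X r w))" if "continuous_on {s..t} (\<lambda>r. X r w)" for w
    using continuous_on_path[OF a that] by simp
  \<comment> \<open>The right-hand side of the integral equation with the stochastic integral over
    \<open>{r..t}\<close> already integrated by parts.\<close>
  define Z where "Z = (\<lambda>r w. integral {r..t} (\<lambda>v. a v (X v w)) +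
    (d t *\<^sub>R W t w - d r *\<^sub>R W r w - integral {r..t} (\<lambda>q. d' q *\<^sub>R W q w)))"
  have "AE w in M. \<forall>r\<in>{s..t}. X t w - X r w = Z r w"
  proof (rule AE_continuous_paths_eq)
    show "AE w in M. continuous_on {s..t} (\<lambda>r. X t w - X r w)"
      using Xc by eventually_elim (intro continuous_intros)
    show "AE w in M. continuous_on {s..t} (\<lambda>r. Z r w)"
      using Xc Wc
    proof eventually_elim
      case (elim w)
      show ?case
        unfolding Z_def
        by (intro continuous_intros dc elim indefinite_integral_continuous_1' integrable_continuous_interval ac d')
    qed
    fix r assume r: "r \<in> {s..t}"
    then obtain J where J: "has_bwd_integral M (*\<^sub>R) (\<lambda>v w. d v) W r t J"
      "AE w in M. X t w - X r w = integral {r..t} (\<lambda>v. a v (X v w)) + J w"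
      using sde unfolding backward_sde_def by blast
    have sub: "{r..t} \<subseteq> {s..t}" using r by auto
    have "AE w in M. J w = d t *\<^sub>R W t w - d r *\<^sub>R W r w - integral {r..t} (\<lambda>q. d' q *\<^sub>R W q w)"
    proof (rule wiener_integral_by_parts[OF J(1)])
      show "AE w in M. continuous_on {r..t} (\<lambda>r. W r w)"
        using Wc by eventually_elim (rule continuous_on_subset[OF _ sub])
      show "(d has_real_derivative d' v) (at v within {r..t})" if "v \<in> {r..t}" for v
        using d[of v] that sub by (meson DERIV_subset subsetD)
    qed (use r in \<open>auto intro: continuous_on_subset[OF d' sub]\<close>)
    with J(2) show "AE w in M. X t w - X r w = Z r w"
      by eventually_elim (simp add: Z_def)
  qed
  with Xc Wc have paths: "AE w in M. sde_path s t (\<lambda>r. a r (X r w)) d d' (\<lambda>r. X r w) (\<lambda>r. W r w)"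
  proof eventually_elim
    case (elim w)
    note ac = ac[OF elim(1)]
    have "X v w - X r w = integral {r..v} (\<lambda>q. a q (X q w) + d' q *\<^sub>R (W r w - W q w)) + d v *\<^sub>R (W v w - W r w)"
      if rv: "s \<le> r" "r \<le> v" "v \<le> t" for r v
    proof -
      have sub: "{r..v} \<subseteq> {s..t}" "{r..t} \<subseteq> {s..t}" using rv by auto
      have c: "continuous_on {s..t} (\<lambda>q. d' q *\<^sub>R W q w)" by (intro continuous_intros d' elim)
      have split: "integral {r..t} h = integral {r..v} h + integral {v..t} h"
        if "continuous_on {s..t} h" for h :: "real \<Rightarrow> 'b"
        using rv sub that
        by (intro Henstock_Kurzweil_Integration.integral_combine[symmetric] integrable_continuous_interval)
          (auto intro: continuous_on_subset)
      have "(d' has_integral d v - d r) {r..v}"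
      proof (rule fundamental_theorem_of_calculus[OF rv(2)])
        fix q assume "q \<in> {r..v}"
        with d[of q] sub show "(d has_vector_derivative d' q) (at q within {r..v})"
          unfolding has_real_derivative_iff_has_vector_derivative
          by (meson has_vector_derivative_within_subset subsetD)
      qed
      from has_integral_scaleR_left[OF this, of "W r w"]
      have i1: "((\<lambda>q. d' q *\<^sub>R W r w) has_integral (d v - d r) *\<^sub>R W r w) {r..v}" .
      have i2: "((\<lambda>q. d' q *\<^sub>R W q w) has_integral integral {r..v} (\<lambda>q. d' q *\<^sub>R W q w)) {r..v}"
        by (intro integrable_integral integrable_continuous_interval continuous_on_subset[OF c sub(1)])
      have i3: "((\<lambda>q. a q (X q w)) has_integral integral {r..v} (\<lambda>q. a q (X q w))) {r..v}"
        by (intro integrable_integral integrable_continuous_interval continuous_on_subset[OF ac sub(1)])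
      have drift: "integral {r..v} (\<lambda>q. a q (X q w) + d' q *\<^sub>R (W r w - W q w)) =
        integral {r..v} (\<lambda>q. a q (X q w)) + ((d v - d r) *\<^sub>R W r w - integral {r..v} (\<lambda>q. d' q *\<^sub>R W q w))"
        using has_integral_add[OF i3 has_integral_diff[OF i1 i2]]
        by (simp add: scaleR_diff_right integral_unique)
      \<comment> \<open>Subtracting the equations for \<open>r\<close> and \<open>v\<close> cancels
        the boundary terms at \<open>t\<close>; the term with \<open>d r\<close> is rewritten by
        means of \<open>i1\<close>, which leaves \<open>d\<close> at the later time
        \<open>v\<close>.\<close>
      have "X t w - X r w = Z r w" "X t w - X v w = Z v w" using elim(3) rv by auto
      then have "X v w - X r w = Z r w - Z v w" by (metis add_diff_cancel_left' diff_diff_eq2 diff_add_cancel add_diff_eq)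
      then show ?thesis
        unfolding drift Z_def split[OF ac] split[OF c] by (simp add: algebra_simps)
    qed
    with elim ac show ?case by (auto simp: sde_path_def)
  qed
  show ?thesis
  proof unfold_locales
    show "subalgebra M (G r)" "W r \<in> borel_measurable (G r)" if "r \<in> {s..t}" for r
      using sub that by blast+
    show "X r \<in> borel_measurable (G r)" if "r \<in> {s..t}" for r
      using sde that unfolding backward_sde_def by blast
    show "sets (G v) \<subseteq> sets (G r)" if "s \<le> r" "r \<le> v" "v \<le> t" for r v
      using filtration.sets_F_mono[OF filt, of "?\<rho> v" "?\<rho> r"] that by simp
    fix r v assume rv: "s \<le> r" "r < v" "v \<le> t"
    then have "s \<le> ?\<rho> v \<and> ?\<rho> v < ?\<rho> r \<and> ?\<rho> r \<le> t" by simp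
    with bm have "distributed M lborel (\<lambda>w. W (?\<rho> (?\<rho> r)) w - W (?\<rho> (?\<rho> v)) w)
          (\<lambda>x. ennreal (\<Prod>b\<in>Basis. normal_density 0 (sqrt (?\<rho> r - ?\<rho> v)) (x \<bullet> b))) \<and>
        prob_space.indep_set M (sets (G (?\<rho> (?\<rho> v))))
          {(\<lambda>w. W (?\<rho> (?\<rho> r)) w - W (?\<rho> (?\<rho> v)) w) -` A \<inter> space M | A. A \<in> sets borel}"
      unfolding brownian_motion_def by blast
    then show "distributed M lborel (\<lambda>w. W r w - W v w)
        (\<lambda>x. ennreal (\<Prod>b\<in>Basis. normal_density 0 (sqrt (v - r)) (x \<bullet> b)))"
      "indep_set (sets (G v)) {(\<lambda>w. W r w - W v w) -` A \<inter> space M | A. A \<in> sets borel}"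
      by simp_all
  qed (fact st a d d' paths)+
qed

section \<open>The annealing weight\<close>

text \<open>The existence claims give the rest its content: without existing integrals the choice
  operator would return arbitrary functions, and without a continuous version the statement about
  all versions would be vacuous.\<close>

theorem propositionH3:
  fixes f :: "real \<Rightarrow> 'a::euclidean_space \<Rightarrow> 'a"
    and p :: "real \<Rightarrow> 'a \<Rightarrow> real"
    and \<sigma> \<epsilon> :: "real \<Rightarrow> real"
    and \<mu> \<nu> a b :: "real \<Rightarrow> 'a \<Rightarrow> 'a"
    and \<beta> c \<eta> \<zeta> \<tau> \<tau>' T :: real
    and N :: "'v measure" and F :: "real \<Rightarrow> 'v measure" and B Y :: "real \<Rightarrow> 'v \<Rightarrow> 'a"
    and M :: "'w measure" and G :: "real \<Rightarrow> 'w measure" and W X :: "real \<Rightarrow> 'w \<Rightarrow> 'a"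
  assumes times: "0 \<le> \<tau>" "\<tau> < \<tau>'" "\<tau>' \<le> T"
    and diffusion: "forward_sde N F B f \<sigma> 0 T Y"
    and marginals: "\<And>t. t \<in> {0..T} \<Longrightarrow> distributed N lborel (Y t) (\<lambda>x. ennreal (p t x))"
    and sigma_pos: "\<And>t. t \<in> {0..T} \<Longrightarrow> 0 < \<sigma> t"
    and p_pos: "\<And>t x. t \<in> {\<tau>..\<tau>'} \<Longrightarrow> 0 < p t x"
    and sigma_smooth: "C1_on {0..T} \<sigma>"
    and f_smooth: "C1_on ({0..T} \<times> UNIV) (\<lambda>(t, x). f t x)"
    and log_p_differentiable: "\<And>t x. t \<in> {\<tau>..\<tau>'} \<Longrightarrow> (\<lambda>y. ln (p t y)) differentiable (at x)"
    and score_smooth: "C1_on ({\<tau>..\<tau>'} \<times> UNIV) (\<lambda>(t, x). score p t x)"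
    and beta: "0 < \<beta>" and c: "c \<in> {0..1/2}"
    and eta: "\<eta> = \<beta> + (1 - \<beta>) * c"
    and zeta: "\<zeta> = sqrt (1 + (1 - \<beta>) * 2 * c / \<beta>)"
    and normalizable: "\<And>t. t \<in> {\<tau>..\<tau>'} \<Longrightarrow> integrable lborel (\<lambda>x. p t x powr \<beta>)"
    and eps: "\<epsilon> = (\<lambda>t. \<zeta> * \<sigma> t)"
    and mu: "\<mu> = reversal_fwd_drift f \<sigma> \<epsilon> p"
    and nu: "\<nu> = reversal_bwd_drift f \<sigma> \<epsilon> p"
    and a: "a = (\<lambda>t x. f t x - (\<eta> * (\<sigma> t)\<^sup>2) *\<^sub>R score p t x)"
    and b: "b = (\<lambda>t x. f t x - (\<eta> * (\<sigma> t)\<^sup>2 - \<beta> * (\<epsilon> t)\<^sup>2) *\<^sub>R score p t x)"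
    and sampling: "backward_sde M G W a \<epsilon> \<tau> \<tau>' X"
    and terminal_law: "distributed M lborel (X \<tau>') (\<lambda>x. ennreal (annealed_density p \<beta> \<tau>' x))"
  shows "backward_sde M G W (\<lambda>t x. f t x - (\<eta> * (\<sigma> t)\<^sup>2) *\<^sub>R score p t x) (\<lambda>t. \<zeta> * \<sigma> t) \<tau> \<tau>' X \<and>
    (\<forall>t\<in>{\<tau>..\<tau>'}.
       (\<forall>h \<in> {\<nu>, a}. \<exists>I. has_bwd_integral M (\<bullet>) (scaled_along \<epsilon> X h) X t \<tau>' I) \<and>
       (\<forall>h \<in> {\<mu>, b}. \<exists>I. has_fwd_integral M (\<bullet>) (scaled_along \<epsilon> X h) X t \<tau>' I)) \<and>
    (\<exists>w. continuous_version M (\<lambda>t. annealing_weight M \<beta> \<epsilon> \<nu> \<mu> a b X t \<tau>') \<tau> \<tau>' w) \<and>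
    (\<forall>w. continuous_version M (\<lambda>t. annealing_weight M \<beta> \<epsilon> \<nu> \<mu> a b X t \<tau>') \<tau> \<tau>' w \<longrightarrow>
       (AE \<omega> in M. ln (w \<tau>' \<omega>) = 0 \<and>
          (\<forall>t\<in>{\<tau>..\<tau>'}. 0 < w t \<omega> \<and>
            ((\<lambda>r. ln (w r \<omega>)) has_real_derivative
               - (\<beta> - 1) * (divergence (f t) (X t \<omega>)
                  + (\<sigma> t)\<^sup>2 / 2 * \<beta> * (norm (score p t (X t \<omega>)))\<^sup>2))
              (at t within {\<tau>..\<tau>'}) \<and>
            ln (w t \<omega>) = - integral {t..\<tau>'}
               (\<lambda>r. - (\<beta> - 1) * (divergence (f r) (X r \<omega>)
                  + (\<sigma> r)\<^sup>2 / 2 * \<beta> * (norm (score p r (X r \<omega>)))\<^sup>2)))))"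
proof -
  let ?I = "{\<tau>..\<tau>'}" and ?S = "{\<tau>..\<tau>'} \<times> (UNIV :: 'a set)"
  have sub: "?I \<subseteq> {0..T}" using times by auto
  interpret prob_space M using sampling by (simp add: backward_sde_def brownian_motion_def)

  \<comment> \<open>The constants and their relation\<close>
  have pos: "0 < \<beta> + (1 - \<beta>) * 2 * c"
  proof -
    \<comment> \<open>A convex combination of \<beta> and 1 with weight \<open>2 * c\<close>, which
      is where \<open>c \<le> 1/2\<close> enters. The radicand in \<zeta> is therefore positive and
      \<zeta> is not 0, also for \<beta> above 1.\<close>
    have "\<beta> + (1 - \<beta>) * 2 * c = \<beta> * (1 - 2 * c) + 2 * c" by (simp add: algebra_simps)
    moreover have "0 \<le> \<beta> * (1 - 2 * c)" "0 \<le> c" using beta c by auto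
    moreover have "0 < \<beta> * (1 - 2 * c)" if "c = 0" using beta that by simp
    ultimately show ?thesis by (cases "c = 0") auto
  qed
  have "1 + (1 - \<beta>) * 2 * c / \<beta> = (\<beta> + (1 - \<beta>) * 2 * c) / \<beta>" using beta by (simp add: field_simps)
  then have \<zeta>2: "\<zeta>\<^sup>2 = (\<beta> + (1 - \<beta>) * 2 * c) / \<beta>"
    unfolding zeta using pos beta by simp
  then have \<beta>\<zeta>: "\<beta> * \<zeta>\<^sup>2 = \<beta> + (1 - \<beta>) * 2 * c" using beta by simp
  have \<zeta>0: "\<zeta> \<noteq> 0" using \<zeta>2 pos beta by auto
  have \<sigma>0: "\<sigma> r \<noteq> 0" if "r \<in> ?I" for r using sigma_pos[of r] that sub by auto
  have \<epsilon>0: "\<epsilon> r \<noteq> 0" if "r \<in> ?I" for r using \<sigma>0[OF that] \<zeta>0 by (simp add: eps)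
  have \<epsilon>2: "(\<epsilon> r)\<^sup>2 = \<zeta>\<^sup>2 * (\<sigma> r)\<^sup>2" for r by (simp add: eps power_mult_distrib)

  \<comment> \<open>Regularity of the coefficients and of the scaled drifts\<close>
  obtain \<sigma>' where \<sigma>': "continuous_on {0..T} \<sigma>'"
    "\<And>r. r \<in> {0..T} \<Longrightarrow> (\<sigma> has_real_derivative \<sigma>' r) (at r within {0..T})"
    using sigma_smooth unfolding C1_on_real_iff by blast
  define \<epsilon>' where "\<epsilon>' = (\<lambda>r. \<zeta> * \<sigma>' r)"
  have \<epsilon>': "(\<epsilon> has_real_derivative \<epsilon>' r) (at r within ?I)" if "r \<in> ?I" for r
  proof -
    have "(\<sigma> has_real_derivative \<sigma>' r) (at r within ?I)"
      using that sub by (intro DERIV_subset[OF \<sigma>'(2)]) auto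
    then show ?thesis unfolding eps \<epsilon>'_def by (rule DERIV_cmult)
  qed
  have \<epsilon>'c: "continuous_on ?I \<epsilon>'"
    unfolding \<epsilon>'_def by (intro continuous_intros continuous_on_subset[OF \<sigma>'(1) sub])
  have \<sigma>c: "continuous_on ?I \<sigma>"
    by (rule continuous_on_subset[OF C1_on_imp_continuous_on[OF sigma_smooth] sub])
  have \<epsilon>c: "continuous_on ?I \<epsilon>" unfolding eps by (intro continuous_intros \<sigma>c)

  define k where "k = (\<lambda>r. 1 / (\<epsilon> r)\<^sup>2)"
  have kC1: "C1_on ?I k"
    unfolding C1_on_real_iff
  proof (intro exI[of _ "\<lambda>r. - (2 * \<epsilon> r * \<epsilon>' r) / ((\<epsilon> r)\<^sup>2)\<^sup>2"] conjI ballI)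
    show "continuous_on ?I (\<lambda>r. - (2 * \<epsilon> r * \<epsilon>' r) / ((\<epsilon> r)\<^sup>2)\<^sup>2)"
      using \<epsilon>0 by (intro continuous_intros \<epsilon>c \<epsilon>'c) auto
    fix r assume r: "r \<in> ?I"
    show "(k has_real_derivative - (2 * \<epsilon> r * \<epsilon>' r) / ((\<epsilon> r)\<^sup>2)\<^sup>2) (at r within ?I)"
      unfolding k_def using \<epsilon>0[OF r]
      by (auto intro!: derivative_eq_intros \<epsilon>'[OF r] simp: power2_eq_square)
  qed

  define Fl where "Fl = (\<lambda>z. f (fst z) (snd z))"
  define sc where "sc = (\<lambda>z. score p (fst z) (snd z))"
  have FlC1: "C1_on ?S Fl"
  proof -
    have "C1_on ?S (\<lambda>(t, x). f t x)" using sub by (intro C1_on_subset[OF f_smooth] Sigma_mono) auto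
    then show ?thesis by (simp add: Fl_def case_prod_beta')
  qed
  have scC1: "C1_on ?S sc" unfolding sc_def using score_smooth by (simp add: case_prod_beta')
  note Flc = C1_on_imp_continuous_on[OF FlC1] and scc = C1_on_imp_continuous_on[OF scC1]
  have \<sigma>Sc: "continuous_on ?S (\<lambda>z. \<sigma> (fst z))"
    by (rule continuous_on_compose2[OF \<sigma>c]) (auto intro!: continuous_intros)

  define hs where "hs = (\<lambda>h :: real \<Rightarrow> 'a \<Rightarrow> 'a. \<lambda>z. (1 / (\<epsilon> (fst z))\<^sup>2) *\<^sub>R h (fst z) (snd z))"
  have scaled: "scaled_along \<epsilon> X h = (\<lambda>r \<omega>. hs h (r, X r \<omega>))" for h
    by (simp add: scaled_along_def hs_def fun_eq_iff)
  \<comment> \<open>All four drifts are \<open>f\<close> plus a constant times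
    \<open>(\<sigma> r)\<^sup>2\<close> times the score. In this form they differ only in one
    number.\<close>
  have fields: "\<mu> r x = f r x + ((\<zeta>\<^sup>2 - 1) / 2 * (\<sigma> r)\<^sup>2) *\<^sub>R score p r x"
    "\<nu> r x = f r x + (- (\<zeta>\<^sup>2 + 1) / 2 * (\<sigma> r)\<^sup>2) *\<^sub>R score p r x"
    "a r x = f r x + (- \<eta> * (\<sigma> r)\<^sup>2) *\<^sub>R score p r x"
    "b r x = f r x + ((\<beta> * \<zeta>\<^sup>2 - \<eta>) * (\<sigma> r)\<^sup>2) *\<^sub>R score p r x" for r x
    unfolding mu nu a b reversal_fwd_drift_def reversal_bwd_drift_def \<epsilon>2
    by (simp_all add: algebra_simps diff_divide_distrib add_divide_distrib)
  \<comment> \<open>Division by \<open>(\<epsilon> r)\<^sup>2 = \<zeta>\<^sup>2 * (\<sigma>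
    r)\<^sup>2\<close> makes the coefficient of the score the constant
    \<open>q / \<zeta>\<^sup>2\<close>.\<close>
  have hsC1: "C1_on ?S (hs h)" if h: "\<And>r x. h r x = f r x + (q * (\<sigma> r)\<^sup>2) *\<^sub>R score p r x" for h q
  proof (rule C1_on_cong)
    show "C1_on ?S (\<lambda>z. k (fst z) *\<^sub>R Fl z + (q / \<zeta>\<^sup>2) *\<^sub>R sc z)"
      by (intro C1_on_add C1_on_scaleR C1_on_const C1_on_fst kC1 FlC1 scC1)
    fix z assume "z \<in> ?S"
    then have "\<sigma> (fst z) \<noteq> 0" using \<sigma>0 by auto
    then have "q * (\<sigma> (fst z))\<^sup>2 / (\<epsilon> (fst z))\<^sup>2 = q / \<zeta>\<^sup>2" unfolding \<epsilon>2 by simp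
    then show "hs h z = k (fst z) *\<^sub>R Fl z + (q / \<zeta>\<^sup>2) *\<^sub>R sc z"
      by (simp add: hs_def h k_def Fl_def sc_def scaleR_add_right)
  qed
  note C1 = hsC1[OF fields(1)] hsC1[OF fields(2)] hsC1[OF fields(3)] hsC1[OF fields(4)]

  \<comment> \<open>The sampling process as a backward diffusion; existence of the integrals\<close>
  have BD: "backward_diffusion M G W \<tau> \<tau>' a \<epsilon> \<epsilon>' X"
  proof (rule backward_sde_diffusion[OF sampling _ _ \<epsilon>' \<epsilon>'c])
    have "continuous_on ?S (\<lambda>z. Fl z + (- \<eta> * (\<sigma> (fst z))\<^sup>2) *\<^sub>R sc z)"
      by (intro continuous_intros Flc scc \<sigma>Sc)
    then show "continuous_on ?S (\<lambda>(r, x). a r x)"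
      by (simp add: fields Fl_def sc_def case_prod_beta')
  qed (use times in auto)
  have BDr: "backward_diffusion M G W t \<tau>' a \<epsilon> \<epsilon>' X" if "t \<in> ?I" for t
    using backward_diffusion_restrict[OF BD] that by simp
  have Xc: "AE \<omega> in M. continuous_on ?I (\<lambda>r. X r \<omega>)"
    by (rule backward_diffusion.X_continuous[OF BD])

  have ints: "\<exists>I. has_bwd_integral M (\<bullet>) (scaled_along \<epsilon> X h) X t \<tau>' I"
    "\<exists>I. has_fwd_integral M (\<bullet>) (scaled_along \<epsilon> X h) X t \<tau>' I"
    if t: "t \<in> ?I" and h: "C1_on ?S (hs h)" for t h
  proof -
    interpret D: backward_diffusion M G W t \<tau>' a \<epsilon> \<epsilon>' X by (rule BDr[OF t])
    have h': "C1_on ({t..\<tau>'} \<times> UNIV) (hs h)" using t by (intro C1_on_subset[OF h]) auto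
    show "\<exists>I. has_bwd_integral M (\<bullet>) (scaled_along \<epsilon> X h) X t \<tau>' I"
      unfolding scaled by (rule D.backward_integral_exists[OF C1_on_imp_continuous_on[OF h']])
    from h' obtain D where "\<And>z. z \<in> {t..\<tau>'} \<times> UNIV \<Longrightarrow>
        (hs h has_derivative blinfun_apply (D z)) (at z within {t..\<tau>'} \<times> UNIV)"
      "continuous_on ({t..\<tau>'} \<times> UNIV) D" unfolding C1_on_def by blast
    then show "\<exists>I. has_fwd_integral M (\<bullet>) (scaled_along \<epsilon> X h) X t \<tau>' I"
      unfolding scaled by (rule D.forward_integral_exists)
  qed

  \<comment> \<open>Divergence of the drift and the rate of the log weight\<close>
  obtain f' where f': "\<And>z. z \<in> ?S \<Longrightarrow> (Fl has_derivative blinfun_apply (f' z)) (at z within ?S)"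
    "continuous_on ?S f'"
    using FlC1 unfolding C1_on_def by blast
  have slice_f: "(f r has_derivative (\<lambda>v. f' (r, x) (0, v))) (at x)" if "r \<in> ?I" for r x
    using has_derivative_slice[OF f'(1), of r x] that by (simp add: Fl_def)
  have div_f: "divergence (f r) x = (\<Sum>b\<in>Basis. f' (r, x) (0, b) \<bullet> b)" if "r \<in> ?I" for r x
    unfolding divergence_def frechet_derivative_at[OF slice_f[OF that, of x], symmetric] ..

  define g where "g = (\<lambda>r x. - (\<beta> - 1) * (divergence (f r) x + (\<sigma> r)\<^sup>2 / 2 * \<beta> * (norm (score p r x))\<^sup>2))"
  have divc: "continuous_on ?S (\<lambda>z. divergence (f (fst z)) (snd z))"
  proof -
    have "continuous_on ?S (\<lambda>z. \<Sum>b\<in>Basis. f' z (0, b) \<bullet> b)"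
      by (intro continuous_intros f'(2))
    then show ?thesis
      by (rule continuous_on_eq) (auto simp: div_f)
  qed
  have gc: "continuous_on ?S (\<lambda>z. g (fst z) (snd z))"
    unfolding g_def by (intro continuous_intros divc \<sigma>Sc scc[unfolded sc_def]) auto
  have gpath: "continuous_on ?I (\<lambda>r. g r (X r \<omega>))" if "continuous_on ?I (\<lambda>r. X r \<omega>)" for \<omega>
    using continuous_on_path[OF gc that] by simp

  \<comment> \<open>The weight for a fixed starting time\<close>
  have weight: "AE \<omega> in M. annealing_weight M \<beta> \<epsilon> \<nu> \<mu> a b X t \<tau>' \<omega> =
    exp (- integral {t..\<tau>'} (\<lambda>r. g r (X r \<omega>)))" if t: "t \<in> ?I" for t
  proof -
    interpret D: backward_diffusion M G W t \<tau>' a \<epsilon> \<epsilon>' X by (rule BDr[OF t])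
    have tsub: "{t..\<tau>'} \<subseteq> ?I" using t by auto

    \<comment> \<open>Existence turns the functions chosen by the choice operator into genuine
      versions of the integrals.\<close>
    have Bn: "has_bwd_integral M (\<bullet>) (scaled_along \<epsilon> X h) X t \<tau>' (bwd_integral M (scaled_along \<epsilon> X h) X t \<tau>')"
      if "C1_on ?S (hs h)" for h
      unfolding bwd_integral_def by (rule someI_ex[OF ints(1)[OF t that]])
    have Fm: "has_fwd_integral M (\<bullet>) (scaled_along \<epsilon> X h) X t \<tau>' (fwd_integral M (scaled_along \<epsilon> X h) X t \<tau>')"
      if "C1_on ?S (hs h)" for h
      unfolding fwd_integral_def by (rule someI_ex[OF ints(2)[OF t that]])
    define H where "H = (\<lambda>z. ((\<beta> - 1) * k (fst z)) *\<^sub>R Fl z)"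
    have "C1_on ?S (\<lambda>z. (\<beta> - 1) *\<^sub>R (k (fst z) *\<^sub>R Fl z))"
      by (intro C1_on_scaleR C1_on_const C1_on_fst kC1 FlC1)
    then have "C1_on ?S H" unfolding H_def scaleR_scaleR .
    then have "C1_on ({t..\<tau>'} \<times> UNIV) H" by (rule C1_on_subset) (use t in auto)
    then obtain D where D: "\<And>z. z \<in> {t..\<tau>'} \<times> UNIV \<Longrightarrow>
        (H has_derivative blinfun_apply (D z)) (at z within {t..\<tau>'} \<times> UNIV)"
      "continuous_on ({t..\<tau>'} \<times> UNIV) D" unfolding C1_on_def by blast
    have \<eta>: "\<eta> = \<beta> * (\<zeta>\<^sup>2 + 1) / 2"
      using \<beta>\<zeta> unfolding eta by (simp add: algebra_simps)
    \<comment> \<open>Score terms cancel as soon as \<open>\<beta> * q1 = q2\<close>. By the formula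
      for \<eta> this holds for both pairs:
      \<open>\<beta> * (\<zeta>\<^sup>2 + 1) / 2 = \<eta>\<close> for \<nu> and \<open>a\<close>,
      and \<open>\<beta> * (\<zeta>\<^sup>2 - 1) / 2 = \<beta> * \<zeta>\<^sup>2 - \<eta>\<close>
      for \<mu> and \<open>b\<close>.\<close>
    have comb: "\<beta> *\<^sub>R (f r x + (q1 * s2) *\<^sub>R y) - (f r x + (q2 * s2) *\<^sub>R y) = (\<beta> - 1) *\<^sub>R f r x"
      if "\<beta> * q1 = q2" for r x q1 q2 s2 and y :: 'a
    proof -
      have "\<beta> * (q1 * s2) = q2 * s2" using that by (simp flip: mult.assoc)
      then show ?thesis by (simp add: scaleR_add_right scaleR_diff_left)
    qed
    have eq: "\<beta> *\<^sub>R scaled_along \<epsilon> X \<nu> r \<omega> - scaled_along \<epsilon> X a r \<omega> = H (r, X r \<omega>)"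
      "\<beta> *\<^sub>R scaled_along \<epsilon> X \<mu> r \<omega> - scaled_along \<epsilon> X b r \<omega> = H (r, X r \<omega>)" for r \<omega>
    proof -
      have "\<beta> *\<^sub>R \<nu> r (X r \<omega>) - a r (X r \<omega>) = (\<beta> - 1) *\<^sub>R f r (X r \<omega>)"
        "\<beta> *\<^sub>R \<mu> r (X r \<omega>) - b r (X r \<omega>) = (\<beta> - 1) *\<^sub>R f r (X r \<omega>)"
        unfolding fields \<eta> by (rule comb, simp add: field_simps)+
      then have "k r *\<^sub>R (\<beta> *\<^sub>R \<nu> r (X r \<omega>) - a r (X r \<omega>)) = H (r, X r \<omega>)"
        "k r *\<^sub>R (\<beta> *\<^sub>R \<mu> r (X r \<omega>) - b r (X r \<omega>)) = H (r, X r \<omega>)"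
        by (simp_all add: H_def Fl_def mult.commute)
      then show "\<beta> *\<^sub>R scaled_along \<epsilon> X \<nu> r \<omega> - scaled_along \<epsilon> X a r \<omega> = H (r, X r \<omega>)"
        "\<beta> *\<^sub>R scaled_along \<epsilon> X \<mu> r \<omega> - scaled_along \<epsilon> X b r \<omega> = H (r, X r \<omega>)"
        by (simp_all add: scaled_along_def k_def scaleR_diff_right mult.commute)
    qed
    \<comment> \<open>\<open>D\<close> is only known as some joint derivative of \<open>H\<close>;
      uniqueness of the derivative of the spatial slice identifies its spatial part. The factor
      \<open>k r\<close> then cancels the squared diffusion coefficient.\<close>
    have DH: "(\<epsilon> r)\<^sup>2 * (\<Sum>b\<in>Basis. D (r, x) (0, b) \<bullet> b) = (\<beta> - 1) * divergence (f r) x"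
      if r: "r \<in> {t..\<tau>'}" for r x
    proof -
      have r': "r \<in> ?I" using r tsub by blast
      have "((\<lambda>x. H (r, x)) has_derivative (\<lambda>v. D (r, x) (0, v))) (at x)"
        using r by (intro has_derivative_slice[OF D(1)]) auto
      moreover have "((\<lambda>x. H (r, x)) has_derivative (\<lambda>v. ((\<beta> - 1) * k r) *\<^sub>R f' (r, x) (0, v))) (at x)"
        unfolding H_def Fl_def using has_derivative_scaleR_right[OF slice_f[OF r', of x]] by simp
      ultimately have "(\<lambda>v. D (r, x) (0, v)) = (\<lambda>v. ((\<beta> - 1) * k r) *\<^sub>R f' (r, x) (0, v))"
        by (rule has_derivative_unique)
      then have "D (r, x) (0, v) = ((\<beta> - 1) * k r) *\<^sub>R f' (r, x) (0, v)" for v by meson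
      then have "(\<Sum>b\<in>Basis. D (r, x) (0, b) \<bullet> b) = ((\<beta> - 1) * k r) * divergence (f r) x"
        by (simp add: div_f[OF r'] sum_distrib_left)
      then show ?thesis using \<epsilon>0[OF r'] by (simp add: k_def)
    qed
    \<comment> \<open>The scaled differences of squared norms. Their score coefficients differ by
      \<open>(\<epsilon> r)\<^sup>2\<close> for the pair \<mu>, \<nu> and by
      \<open>\<beta> * (\<epsilon> r)\<^sup>2\<close> for the pair \<open>b\<close>,
      \<open>a\<close>, so the division by \<open>(\<epsilon> r)\<^sup>2\<close> disappears.\<close>
    define \<phi>1 where "\<phi>1 = (\<lambda>z. 2 * (Fl z \<bullet> sc z) - (\<sigma> (fst z))\<^sup>2 * (sc z \<bullet> sc z))"
    define \<phi>2 where "\<phi>2 = (\<lambda>z. \<beta> * (2 * (Fl z \<bullet> sc z) + (\<beta> * \<zeta>\<^sup>2 - 2 * \<eta>) * (\<sigma> (fst z))\<^sup>2 * (sc z \<bullet> sc z)))"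
    have norms: "(norm (f r x + q1 *\<^sub>R score p r x))\<^sup>2 - (norm (f r x + q2 *\<^sub>R score p r x))\<^sup>2 =
      (q1 - q2) * (2 * (Fl (r, x) \<bullet> sc (r, x)) + (q1 + q2) * (sc (r, x) \<bullet> sc (r, x)))" for q1 q2 r x
      unfolding power2_norm_eq_inner Fl_def sc_def
      by (simp add: inner_add_left inner_add_right inner_commute algebra_simps)
    have \<phi>: "1 / (\<epsilon> r)\<^sup>2 * ((norm (\<mu> r x))\<^sup>2 - (norm (\<nu> r x))\<^sup>2) = \<phi>1 (r, x)"
      "1 / (\<epsilon> r)\<^sup>2 * ((norm (b r x))\<^sup>2 - (norm (a r x))\<^sup>2) = \<phi>2 (r, x)" if r: "r \<in> ?I" for r x
    proof -
      have "(\<zeta>\<^sup>2 - 1) / 2 * (\<sigma> r)\<^sup>2 - - (\<zeta>\<^sup>2 + 1) / 2 * (\<sigma> r)\<^sup>2 = (\<epsilon> r)\<^sup>2"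
        "(\<zeta>\<^sup>2 - 1) / 2 * (\<sigma> r)\<^sup>2 + - (\<zeta>\<^sup>2 + 1) / 2 * (\<sigma> r)\<^sup>2 = - (\<sigma> r)\<^sup>2"
        "(\<beta> * \<zeta>\<^sup>2 - \<eta>) * (\<sigma> r)\<^sup>2 - - \<eta> * (\<sigma> r)\<^sup>2 = \<beta> * (\<epsilon> r)\<^sup>2"
        "(\<beta> * \<zeta>\<^sup>2 - \<eta>) * (\<sigma> r)\<^sup>2 + - \<eta> * (\<sigma> r)\<^sup>2 = (\<beta> * \<zeta>\<^sup>2 - 2 * \<eta>) * (\<sigma> r)\<^sup>2"
        unfolding \<epsilon>2 by (simp_all add: field_simps)
      then show "1 / (\<epsilon> r)\<^sup>2 * ((norm (\<mu> r x))\<^sup>2 - (norm (\<nu> r x))\<^sup>2) = \<phi>1 (r, x)"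
        "1 / (\<epsilon> r)\<^sup>2 * ((norm (b r x))\<^sup>2 - (norm (a r x))\<^sup>2) = \<phi>2 (r, x)"
        unfolding fields norms using \<epsilon>0[OF r] by (simp_all add: \<phi>1_def \<phi>2_def)
    qed
    \<comment> \<open>The cross terms of \<open>f\<close> with the score occur with the same factor
      \<beta> in both parts and cancel. The squared score keeps the coefficient
      \<open>\<beta> / 2 * (2 * \<eta> - \<beta> * \<zeta>\<^sup>2 - 1)\<close>, from which
      \<open>c\<close> disappears.\<close>
    have total: "(\<beta> - 1) * divergence (f r) x + \<beta> / 2 * \<phi>1 (r, x) - 1 / 2 * \<phi>2 (r, x) = - g r x" for r x
    proof -
      have "\<beta> / 2 * \<phi>1 (r, x) - 1 / 2 * \<phi>2 (r, x) =
        \<beta> / 2 * (2 * \<eta> - \<beta> * \<zeta>\<^sup>2 - 1) * (\<sigma> r)\<^sup>2 * (sc (r, x) \<bullet> sc (r, x))"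
        unfolding \<phi>1_def \<phi>2_def by (simp add: algebra_simps)
      also have "2 * \<eta> - \<beta> * \<zeta>\<^sup>2 - 1 = \<beta> - 1" using \<beta>\<zeta> unfolding eta by (simp add: algebra_simps)
      finally have "\<beta> / 2 * \<phi>1 (r, x) - 1 / 2 * \<phi>2 (r, x) =
        \<beta> / 2 * (\<beta> - 1) * (\<sigma> r)\<^sup>2 * (sc (r, x) \<bullet> sc (r, x))" .
      moreover have "- g r x = (\<beta> - 1) * divergence (f r) x +
        \<beta> / 2 * (\<beta> - 1) * (\<sigma> r)\<^sup>2 * (sc (r, x) \<bullet> sc (r, x))"
        unfolding g_def sc_def power2_norm_eq_inner by (simp add: field_simps)
      ultimately show ?thesis by linarith
    qed
    have \<phi>c: "continuous_on ?S \<phi>1" "continuous_on ?S \<phi>2"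
      unfolding \<phi>1_def \<phi>2_def by (intro continuous_intros Flc scc \<sigma>Sc)+
    have diff: "AE \<omega> in M.
      (\<beta> * bwd_integral M (scaled_along \<epsilon> X \<nu>) X t \<tau>' \<omega> - bwd_integral M (scaled_along \<epsilon> X a) X t \<tau>' \<omega>) -
      (\<beta> * fwd_integral M (scaled_along \<epsilon> X \<mu>) X t \<tau>' \<omega> - fwd_integral M (scaled_along \<epsilon> X b) X t \<tau>' \<omega>) =
      integral {t..\<tau>'} (\<lambda>q. (\<epsilon> q)\<^sup>2 * (\<Sum>b\<in>Basis. D (q, X q \<omega>) (0, b) \<bullet> b))"
      by (rule D.backward_forward_difference[OF D Bn[OF C1(2)] Bn[OF C1(3)] Fm[OF C1(1)] Fm[OF C1(4)] eq])
    from diff Xc show ?thesis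
    proof eventually_elim
      case (elim \<omega>)
      let ?X = "\<lambda>r. (r, X r \<omega>)"
      have hi: "((\<lambda>r. \<phi> (?X r)) has_integral integral {t..\<tau>'} (\<lambda>r. \<phi> (?X r))) {t..\<tau>'}"
        if "continuous_on ?S \<phi>" for \<phi> :: "real \<times> 'a \<Rightarrow> real"
        by (intro integrable_integral integrable_continuous_interval
          continuous_on_subset[OF continuous_on_path[OF that elim(2)] tsub])
      let ?i0 = "integral {t..\<tau>'} (\<lambda>r. divergence (f r) (X r \<omega>))"
      let ?i1 = "integral {t..\<tau>'} (\<lambda>r. \<phi>1 (?X r))" and ?i2 = "integral {t..\<tau>'} (\<lambda>r. \<phi>2 (?X r))"
      have "((\<lambda>r. (\<beta> - 1) * divergence (f r) (X r \<omega>) + \<beta> / 2 * \<phi>1 (?X r) - 1 / 2 * \<phi>2 (?X r))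
        has_integral (\<beta> - 1) * ?i0 + \<beta> / 2 * ?i1 - 1 / 2 * ?i2) {t..\<tau>'}"
        using hi[OF divc] hi[OF \<phi>c(1)] hi[OF \<phi>c(2)]
        by (intro has_integral_add has_integral_diff has_integral_mult_right) auto
      then have "((\<lambda>r. - g r (X r \<omega>)) has_integral (\<beta> - 1) * ?i0 + \<beta> / 2 * ?i1 - 1 / 2 * ?i2) {t..\<tau>'}"
        unfolding total .
      from integral_unique[OF this]
      have tot: "(\<beta> - 1) * ?i0 + \<beta> / 2 * ?i1 - 1 / 2 * ?i2 = - integral {t..\<tau>'} (\<lambda>r. g r (X r \<omega>))"
        by simp
      have j0: "integral {t..\<tau>'} (\<lambda>q. (\<epsilon> q)\<^sup>2 * (\<Sum>b\<in>Basis. D (q, X q \<omega>) (0, b) \<bullet> b)) = (\<beta> - 1) * ?i0"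
        by (subst integral_mult_right[symmetric]) (rule integral_cong, rule DH)
      have j1: "integral {t..\<tau>'} (\<lambda>r. 1 / (\<epsilon> r)\<^sup>2 * ((norm (\<mu> r (X r \<omega>)))\<^sup>2 - (norm (\<nu> r (X r \<omega>)))\<^sup>2)) = ?i1"
        using tsub by (intro integral_cong \<phi>(1)) auto
      have j2: "integral {t..\<tau>'} (\<lambda>r. 1 / (\<epsilon> r)\<^sup>2 * ((norm (b r (X r \<omega>)))\<^sup>2 - (norm (a r (X r \<omega>)))\<^sup>2)) = ?i2"
        using tsub by (intro integral_cong \<phi>(2)) auto
      show ?case
        unfolding annealing_weight_def path_ratio_def j1 j2 exp_powr_real exp_minus[symmetric] exp_add[symmetric]
        using elim(1) unfolding j0 tot[symmetric] by (simp add: algebra_simps)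
    qed
  qed

  \<comment> \<open>The continuous version and its differential equation\<close>
  define w0 where "w0 = (\<lambda>r \<omega>. exp (- integral {r..\<tau>'} (\<lambda>q. g q (X q \<omega>))))"
  have w0c: "AE \<omega> in M. continuous_on ?I (\<lambda>r. w0 r \<omega>)"
    using Xc
  proof eventually_elim
    case (elim \<omega>)
    show ?case
      unfolding w0_def
      by (intro continuous_intros indefinite_integral_continuous_1' integrable_continuous_interval gpath elim)
  qed
  have "continuous_version M (\<lambda>t. annealing_weight M \<beta> \<epsilon> \<nu> \<mu> a b X t \<tau>') \<tau> \<tau>' w0"
    unfolding continuous_version_def
  proof (intro conjI ballI w0c)
    fix t assume "t \<in> ?I"
    from weight[OF this] show "AE \<omega> in M. w0 t \<omega> = annealing_weight M \<beta> \<epsilon> \<nu> \<mu> a b X t \<tau>' \<omega>"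
      unfolding w0_def by eventually_elim simp
  qed
  moreover have "AE \<omega> in M. ln (w \<tau>' \<omega>) = 0 \<and>
      (\<forall>t\<in>?I. 0 < w t \<omega> \<and>
        ((\<lambda>r. ln (w r \<omega>)) has_real_derivative g t (X t \<omega>)) (at t within ?I) \<and>
        ln (w t \<omega>) = - integral {t..\<tau>'} (\<lambda>r. g r (X r \<omega>)))"
    if w: "continuous_version M (\<lambda>t. annealing_weight M \<beta> \<epsilon> \<nu> \<mu> a b X t \<tau>') \<tau> \<tau>' w" for w
  proof -
    have "AE \<omega> in M. \<forall>r\<in>?I. w r \<omega> = w0 r \<omega>"
    proof (rule AE_continuous_paths_eq[OF _ w0c])
      show "AE \<omega> in M. continuous_on ?I (\<lambda>r. w r \<omega>)" using w by (simp add: continuous_version_def)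
      fix r assume r: "r \<in> ?I"
      with w have "AE \<omega> in M. w r \<omega> = annealing_weight M \<beta> \<epsilon> \<nu> \<mu> a b X r \<tau>' \<omega>"
        by (simp add: continuous_version_def)
      with weight[OF r] show "AE \<omega> in M. w r \<omega> = w0 r \<omega>"
        unfolding w0_def by eventually_elim simp
    qed
    with Xc show ?thesis
    proof eventually_elim
      case (elim \<omega>)
      let ?G = "\<lambda>r. g r (X r \<omega>)"
      note Gc = gpath[OF elim(1)]
      have lnw: "ln (w r \<omega>) = - integral {r..\<tau>'} ?G" "0 < w r \<omega>" if "r \<in> ?I" for r
        using elim(2) that by (simp_all add: w0_def)
      have "((\<lambda>r. ln (w r \<omega>)) has_real_derivative ?G t) (at t within ?I)" if t: "t \<in> ?I" for t
      proof -
        \<comment> \<open>The variable is the lower limit of the integral in the log weight.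
          Rewriting it with the upper limit variable, up to a constant, makes the fundamental
          theorem applicable and turns the minus sign into plus.\<close>
        have "((\<lambda>r. integral {\<tau>..r} ?G - integral ?I ?G) has_real_derivative ?G t - 0) (at t within ?I)"
          by (intro DERIV_diff integral_has_real_derivative[OF Gc t] DERIV_const)
        moreover have "ln (w r \<omega>) = integral {\<tau>..r} ?G - integral ?I ?G" if r: "r \<in> ?I" for r
          using Henstock_Kurzweil_Integration.integral_combine[of \<tau> r \<tau>' ?G] r
            integrable_continuous_interval[OF Gc] lnw(1)[OF r] by simp
        ultimately show ?thesis
          unfolding has_field_derivative_def by (auto intro: has_derivative_transform[OF t])
      qed
      with lnw times show ?case by auto
    qed
  qed
  moreover have "backward_sde M G W (\<lambda>t x. f t x - (\<eta> * (\<sigma> t)\<^sup>2) *\<^sub>R score p t x) (\<lambda>t. \<zeta> * \<sigma> t) \<tau> \<tau>' X"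
    using sampling unfolding a eps .
  ultimately show ?thesis
    using ints C1 unfolding g_def by blast
qed

end
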